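(* Let $K$ be a field, $A = K[x_1,\ldots,x_n]$ the polynomial ring in $n \geq 1$ variables with each $\deg x_i = 1$, and let $I \neq A$ be a homogeneous ideal of $A$ that is critical. Let $I^{\mathrm{lex}}$ be the unique lexsegment ideal of $A$ such that $A/I$ and $A/I^{\mathrm{lex}}$ have the same Hilbert function. Then \[ \operatorname{depth} A/I = \operatorname{depth} A/I^{\mathrm{lex}}. \]
   Context: The lexicographic order $<_{\mathrm{lex}}$ is the one induced by the ordering $x_1 > x_2 > \cdots > x_n$ of the variables. A monomial ideal $L$ of $A$ is lexsegment if, whenever a monomial $u$ of $A$ belongs to $L$ and $v$ is a monomial of $A$ with $\deg v = \deg u$ and $v >_{\mathrm{lex}} u$, one has $v \in L$. For $m \geq 1$ let $A_{[m]} = K[x_1,\ldots,x_{n+m}]$. A lexsegment ideal $L$ of $A$ is universal lexsegment if, for every integer $m \geq 1$, the extended ideal $L A_{[m]}$ is a lexsegment ideal of $A_{[m]}$. The Hilbert function of $R = A/I$ is $H_R(q) = \dim_K R_q$, $q = 0,1,2,\ldots$. For every homogeneous ideal $I$ of $A$ there is a unique lexsegment ideal $I^{\mathrm{lex}}$ of $A$ with $H_{A/I^{\mathrm{lex}}} = H_{A/I}$. A homogeneous ideal $I \neq A$ is called critical if $I^{\mathrm{lex}}$ is universal lexsegment. *)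

theory Defs
  imports "HOL-Algebra.Algebra" "HOL-Library.Poly_Mapping" "HOL-Library.Extended_Nat"
begin

text \<open>A monomial is its finitely supported exponent vector, the variable \<open>x\<^sub>i\<close> having index
  \<open>i \<ge> 1\<close>; a polynomial is a finitely supported map from monomials to coefficients, with the
  convolution product of \<^theory>\<open>HOL-Library.Poly_Mapping\<close>. The number of variables is a
  parameter of the carrier and not of the type, so that \<open>K[x\<^sub>1,\<dots>,x\<^sub>n]\<close> is literally a subset of
  \<open>K[x\<^sub>1,\<dots>,x\<^sub>n\<^sub>+\<^sub>m]\<close>.\<close>

type_synonym monom = "nat \<Rightarrow>\<^sub>0 nat"
type_synonym 'k polyn = "monom \<Rightarrow>\<^sub>0 'k"

definition monoms :: "nat \<Rightarrow> monom set" where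
  "monoms n = {u. Poly_Mapping.keys u \<subseteq> {1..n}}"

definition mdeg :: "monom \<Rightarrow> nat" where
  "mdeg u = (\<Sum>i\<in>Poly_Mapping.keys u. Poly_Mapping.lookup u i)"

definition mpoly :: "monom \<Rightarrow> 'k::field polyn" where
  "mpoly u = Poly_Mapping.single u 1"

definition const :: "'k::field \<Rightarrow> 'k polyn" where
  "const c = Poly_Mapping.single 0 c"

definition PR :: "nat \<Rightarrow> 'k::field polyn ring" where
  "PR n = \<lparr>carrier = {p. Poly_Mapping.keys p \<subseteq> monoms n},
           monoid.mult = (*), one = 1, ring.zero = 0, add = (+)\<rparr>"

definition hcomp :: "nat \<Rightarrow> nat \<Rightarrow> 'k::field polyn set" where
  "hcomp n q = {p \<in> carrier (PR n). \<forall>u\<in>Poly_Mapping.keys p. mdeg u = q}"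

definition homogeneous_ideal :: "nat \<Rightarrow> 'k::field polyn set \<Rightarrow> bool" where
  "homogeneous_ideal n I \<longleftrightarrow>
     ideal I (PR n) \<and> (\<exists>S \<subseteq> (\<Union>q. hcomp n q). I = Idl\<^bsub>PR n\<^esub> S)"

definition monomial_ideal :: "nat \<Rightarrow> 'k::field polyn set \<Rightarrow> bool" where
  "monomial_ideal n I \<longleftrightarrow>
     ideal I (PR n) \<and> (\<exists>S \<subseteq> monoms n. I = Idl\<^bsub>PR n\<^esub> (mpoly ` S))"

text \<open>The library order on finitely supported maps is \<^const>\<open>less_fun\<close>: \<open>u < v\<close> iff
  \<open>u\<^sub>i < v\<^sub>i\<close> at the smallest index \<open>i\<close> at which \<open>u\<close> and \<open>v\<close> differ. On exponent vectors this is
  the lexicographic order induced by \<open>x\<^sub>1 > x\<^sub>2 > \<dots>\<close>.\<close>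

definition lexsegment :: "nat \<Rightarrow> 'k::field polyn set \<Rightarrow> bool" where
  "lexsegment n L \<longleftrightarrow> monomial_ideal n L \<and>
     (\<forall>u\<in>monoms n. \<forall>v\<in>monoms n.
        mpoly u \<in> L \<and> mdeg v = mdeg u \<and> v > u \<longrightarrow> mpoly v \<in> L)"

definition universal_lexsegment :: "nat \<Rightarrow> 'k::field polyn set \<Rightarrow> bool" where
  "universal_lexsegment n L \<longleftrightarrow>
     lexsegment n L \<and> (\<forall>m\<ge>1. lexsegment (n + m) (Idl\<^bsub>PR (n + m)\<^esub> L))"

text \<open>\<open>dim\<^sub>K R\<^sub>q\<close> for \<open>R = A/I\<close>, with \<open>K\<close> and \<open>R\<^sub>q\<close> the images in \<open>R\<close> of the constants and
  of \<open>A\<^sub>q\<close>. For \<open>I = A\<close> the quotient is the zero ring, where \<^const>\<open>ring.dimension\<close> only admits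
  the value \<open>0\<close>.\<close>

definition hilbert_fun :: "nat \<Rightarrow> 'k::field polyn set \<Rightarrow> nat \<Rightarrow> nat" where
  "hilbert_fun n I q =
     (THE d. ring.dimension (PR n Quot I) d
               ((\<lambda>c. I +>\<^bsub>PR n\<^esub> const c) ` UNIV)
               ((\<lambda>p. I +>\<^bsub>PR n\<^esub> p) ` hcomp n q))"

text \<open>\<open>L = I\<^sup>l\<^sup>e\<^sup>x\<close>. This is a relation and not a function of \<open>I\<close>; it determines \<open>L\<close>,
  because a lexsegment ideal is determined by its Hilbert function.\<close>

definition is_lex_ideal_of :: "nat \<Rightarrow> 'k::field polyn set \<Rightarrow> 'k polyn set \<Rightarrow> bool" where
  "is_lex_ideal_of n I L \<longleftrightarrow>
     lexsegment n L \<and> (\<forall>q. hilbert_fun n L q = hilbert_fun n I q)"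

definition critical :: "nat \<Rightarrow> 'k::field polyn set \<Rightarrow> bool" where
  "critical n I \<longleftrightarrow> homogeneous_ideal n I \<and> I \<noteq> carrier (PR n) \<and>
     (\<exists>L. is_lex_ideal_of n I L \<and> universal_lexsegment n L)"

definition regular_sequence :: "('a, 'b) ring_scheme \<Rightarrow> 'a list \<Rightarrow> bool" where
  "regular_sequence R fs \<longleftrightarrow> set fs \<subseteq> carrier R \<and> Idl\<^bsub>R\<^esub> (set fs) \<noteq> carrier R \<and>
     (\<forall>i<length fs. \<forall>r\<in>carrier R.
        fs ! i \<otimes>\<^bsub>R\<^esub> r \<in> Idl\<^bsub>R\<^esub> (set (take i fs)) \<longrightarrow> r \<in> Idl\<^bsub>R\<^esub> (set (take i fs)))"

definition max_ideal :: "nat \<Rightarrow> 'k::field polyn set" where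
  "max_ideal n = Idl\<^bsub>PR n\<^esub> ((\<lambda>i. mpoly (Poly_Mapping.single i 1)) ` {1..n})"

text \<open>\<open>depth A/I\<close> is the supremum of the lengths of the \<open>A/I\<close>-regular sequences in the graded
  maximal ideal; the elements of the sequences need not be homogeneous.\<close>

definition depth_quot :: "nat \<Rightarrow> 'k::field polyn set \<Rightarrow> enat" where
  "depth_quot n I =
     (SUP fs \<in> {fs. regular_sequence (PR n Quot I) fs \<and>
                    set fs \<subseteq> (\<lambda>f. I +>\<^bsub>PR n\<^esub> f) ` max_ideal n}. enat (length fs))"

end

theory Submission
  imports Defs "HOL-Computational_Algebra.Polynomial"
begin

text \<open>A nonzero proper universal lexsegment ideal has the form \<open>L = x\<^sub>1\<^sup>a (x\<^sub>1, L')\<close> with \<open>L'\<close>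
  universal lexsegment in one variable less. If \<open>I\<close> has the same Hilbert function, then the
  growth of that function forces the elements of \<open>I\<close> to have a greatest common divisor \<open>f\<close> of
  degree \<open>a\<close> (or \<open>a + 1\<close> if \<open>L' = 0\<close>): by unique factorization, ideals without a common divisor
  have codimension at least two. The ideal \<open>I : f\<close> contains a linear form \<open>\<ell>\<close>, as \<open>(x\<^sub>1, L')\<close>
  does, and modulo \<open>\<ell>\<close> one is left with an ideal with the Hilbert function of \<open>L'\<close>. Hence \<open>I\<close> is
  generated by \<open>f\<^sub>1 \<ell>\<^sub>1, f\<^sub>1 f\<^sub>2 \<ell>\<^sub>2, \<dots>, f\<^sub>1 \<cdots> f\<^sub>s\<close>, where \<open>s\<close> depends only on the Hilbert
  function.

  For every such ideal the depth of the quotient is \<open>n - s\<close>. The \<open>s\<close>-th Koszul homology does not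
  vanish, by induction along the construction, and each member of a regular sequence raises by
  one the degree of a nonvanishing homology module; this bounds the length of regular sequences
  by \<open>n - s\<close>. A regular sequence of that length is formed by elements \<open>x\<^sub>v - x\<^sub>w\<^sup>e\<close> with
  suitable exponents.\<close>

section \<open>Polynomial rings in finite sets of variables\<close>

text \<open>The argument sees \<open>I\<close> only through homogeneity and its Hilbert function. So
  \<open>L\<close> is treated as one more such ideal, and the depths agree because both equal
  \<open>n - s\<close>. The degree b of the common divisor is found by counting. An element of
  degree a + 1 gives b at most a + 1. If b < a, the cofactor ideal misses in each large degree q at
  least as many dimensions as there are monomials of degree q in n - 1 variables, which grows like
  the power n - 2 of q; codimension two permits only the power n - 3. If b = a + 1, the ideal is
  principal, which is the case L' = 0. Members of a regular sequence may be inhomogeneous, so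
  lengths cannot be bounded by comparing Hilbert series. A Koszul class survives the passage modulo
  any regular element without constant term, moving up one degree. Multiplication of all generators
  by one polynomial keeps classes of positive degree, because the Koszul complex of the polynomial
  ring is acyclic there. These two moves follow the construction of the generators.\<close>

abbreviation "lk \<equiv> Poly_Mapping.lookup"
abbreviation "kys \<equiv> Poly_Mapping.keys"
abbreviation "sgl \<equiv> Poly_Mapping.single"

text \<open>Arbitrary sets of indices are allowed, and not only \<open>{1..n}\<close>, because the
  elimination of a linear form removes an arbitrary variable.\<close>

definition polys :: "nat set \<Rightarrow> 'k::field polyn set" where
  "polys V = {p. \<forall>u\<in>kys p. kys u \<subseteq> V}"

definition var :: "nat \<Rightarrow> 'k::field polyn" where
  "var i = mpoly (sgl i 1)"

lemma polyn_induct [case_names zero add]: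
  fixes p :: "'a \<Rightarrow>\<^sub>0 'b::ab_group_add"
  assumes "P 0" and "\<And>u c q. P q \<Longrightarrow> u \<in> kys p \<Longrightarrow> P (sgl u c + q)"
  shows "P p"
proof -
  have "P (\<Sum>u\<in>S. sgl u (lk p u))" if "finite S" "S \<subseteq> kys p" for S
    using that by (induction S) (auto simp: assms)
  moreover have "(\<Sum>u\<in>kys p. sgl u (lk p u)) = p"
    by (rule poly_mapping_eqI)
      (auto simp: lookup_sum lookup_single when_def sum.delta in_keys_iff)
  ultimately show ?thesis by (metis finite_keys order_refl)
qed

section \<open>Evaluation of polynomials in commutative rings\<close>

definition meval :: "(nat \<Rightarrow> 'b::comm_ring_1) \<Rightarrow> monom \<Rightarrow> 'b" where
  "meval \<phi> u = (\<Prod>i\<in>kys u. \<phi> i ^ lk u i)"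

definition peval :: "('k::field \<Rightarrow> 'b::comm_ring_1) \<Rightarrow> (nat \<Rightarrow> 'b) \<Rightarrow> 'k polyn \<Rightarrow> 'b" where
  "peval \<kappa> \<phi> p = (\<Sum>u\<in>kys p. \<kappa> (lk p u) * meval \<phi> u)"

lemma meval_superset:
  assumes "finite S" "kys u \<subseteq> S"
  shows "meval \<phi> u = (\<Prod>i\<in>S. \<phi> i ^ lk u i)"
  unfolding meval_def
  by (rule prod.mono_neutral_left) (use assms in \<open>auto simp: in_keys_iff\<close>)

lemma meval_0 [simp]: "meval \<phi> 0 = 1"
  by (simp add: meval_def)

lemma meval_add: "meval \<phi> (u + v) = meval \<phi> u * meval \<phi> v"
  by (simp add: meval_superset[of "kys u \<union> kys v"] keys_add lookup_add power_add prod.distrib)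

lemma meval_single: "meval \<phi> (sgl i k) = \<phi> i ^ k"
  by (cases "k = 0") (auto simp: meval_def)

lemma mdeg_superset:
  assumes "finite S" "kys u \<subseteq> S"
  shows "mdeg u = (\<Sum>i\<in>S. lk u i)"
  unfolding mdeg_def
  by (rule sum.mono_neutral_left) (use assms in \<open>auto simp: in_keys_iff\<close>)

lemma mdeg_0 [simp]: "mdeg 0 = 0"
  by (simp add: mdeg_def)

lemma mdeg_add: "mdeg (u + v) = mdeg u + mdeg v"
  by (simp add: mdeg_superset[of "kys u \<union> kys v"] keys_add lookup_add sum.distrib)

lemma mdeg_single [simp]: "mdeg (sgl i k) = k"
  by (cases "k = 0") (auto simp: mdeg_def)

lemma mdeg_eq_0_iff: "mdeg u = 0 \<longleftrightarrow> u = 0"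
  by (auto simp: mdeg_def in_keys_iff intro: poly_mapping_eqI)

text \<open>One evaluation map serves for substitutions, with \<open>const\<close> as coefficient
  map, and for the two univariate views, with \<open>[:const c:]\<close>.\<close>

locale coeff_hom =
  fixes \<kappa> :: "'k::field \<Rightarrow> 'b::comm_ring_1"
  assumes \<kappa>0: "\<kappa> 0 = 0" and \<kappa>1: "\<kappa> 1 = 1"
    and \<kappa>add: "\<kappa> (a + b) = \<kappa> a + \<kappa> b" and \<kappa>mult: "\<kappa> (a * b) = \<kappa> a * \<kappa> b"
begin

lemma peval_superset:
  assumes "finite S" "kys p \<subseteq> S"
  shows "peval \<kappa> \<phi> p = (\<Sum>u\<in>S. \<kappa> (lk p u) * meval \<phi> u)"
  unfolding peval_def
  by (rule sum.mono_neutral_left) (use assms in \<open>auto simp: in_keys_iff \<kappa>0\<close>)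

lemma peval_0 [simp]: "peval \<kappa> \<phi> 0 = 0"
  by (simp add: peval_def)

lemma peval_add: "peval \<kappa> \<phi> (p + q) = peval \<kappa> \<phi> p + peval \<kappa> \<phi> q"
  by (simp add: peval_superset[of "kys p \<union> kys q"] keys_add lookup_add \<kappa>add
      sum.distrib distrib_right)

lemma peval_single: "peval \<kappa> \<phi> (sgl u c) = \<kappa> c * meval \<phi> u"
  by (cases "c = 0") (auto simp: peval_def \<kappa>0)

lemma peval_mult: "peval \<kappa> \<phi> (p * q) = peval \<kappa> \<phi> p * peval \<kappa> \<phi> q"
proof (induction p rule: polyn_induct)
  case (add u c p)
  have "peval \<kappa> \<phi> (sgl u c * q) = peval \<kappa> \<phi> (sgl u c) * peval \<kappa> \<phi> q"
    by (induction q rule: polyn_induct)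
      (simp_all add: distrib_left peval_add mult_single peval_single \<kappa>mult meval_add mult_ac)
  then show ?case
    by (simp add: distrib_right peval_add add)
qed simp

lemma peval_const: "peval \<kappa> \<phi> (const c) = \<kappa> c"
  by (simp add: const_def peval_single)

lemma peval_var: "peval \<kappa> \<phi> (var i) = \<phi> i"
  by (simp add: var_def mpoly_def peval_single \<kappa>1 meval_single)

lemma peval_1 [simp]: "peval \<kappa> \<phi> 1 = 1"
  using peval_const[of \<phi> 1] by (simp add: const_def \<kappa>1)

lemma peval_uminus: "peval \<kappa> \<phi> (- p) = - peval \<kappa> \<phi> p"
  using peval_add[of \<phi> p "- p"] by (simp add: eq_neg_iff_add_eq_0 add.commute)

lemma peval_diff: "peval \<kappa> \<phi> (p - q) = peval \<kappa> \<phi> p - peval \<kappa> \<phi> q"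
  using peval_add[of \<phi> p "- q"] by (simp add: peval_uminus)

lemma peval_power: "peval \<kappa> \<phi> (p ^ k) = peval \<kappa> \<phi> p ^ k"
  by (induction k) (simp_all add: peval_mult)

lemma peval_sum: "peval \<kappa> \<phi> (sum f S) = (\<Sum>i\<in>S. peval \<kappa> \<phi> (f i))"
  by (induction S rule: infinite_finite_induct) (simp_all add: peval_add)

end

lemma const_0 [simp]: "const 0 = 0" and const_1 [simp]: "const 1 = 1"
  and const_add: "const (a + b) = const a + const b"
  and const_mult: "const (a * b) = const a * const b"
  by (simp_all add: const_def single_add mult_single)

lemma const_eq_0_iff [simp]: "const c = 0 \<longleftrightarrow> c = 0"
  by (metis const_def keys_single keys_zero insert_not_empty single_zero)

lemma var_nonzero [simp]: "var i \<noteq> 0"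
  by (metis var_def mpoly_def keys_single keys_zero insert_not_empty one_neq_zero)

lemma const_inverse: "c \<noteq> 0 \<Longrightarrow> const c * const (inverse c) = 1"
  by (simp flip: const_mult)

lemma single_sum_eq: "(\<Sum>u\<in>kys p. sgl u (lk p u)) = p"
  by (rule poly_mapping_eqI)
    (auto simp: lookup_sum lookup_single when_def sum.delta in_keys_iff)

lemma mpoly_0 [simp]: "mpoly 0 = 1"
  by (simp add: mpoly_def)

lemma mpoly_add: "mpoly (u + v) = mpoly u * mpoly v"
  by (simp add: mpoly_def mult_single)

lemma mpoly_single: "mpoly (sgl i k) = var i ^ k"
proof (induction k)
  case (Suc k)
  have "sgl i (Suc k) = sgl i 1 + sgl i k" by (simp flip: single_add)
  then show ?case using Suc by (simp add: mpoly_add var_def)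
qed simp

lemma single_sum_monom: "(\<Sum>i\<in>kys u. sgl i (lk u i)) = (u :: monom)"
  by (rule poly_mapping_eqI)
    (auto simp: lookup_sum lookup_single when_def sum.delta in_keys_iff)

lemma mpoly_sum: "mpoly (sum f S) = (\<Prod>i\<in>S. mpoly (f i))"
  by (induction S rule: infinite_finite_induct) (simp_all add: mpoly_add)

lemma mpoly_eq_meval: "(mpoly u :: 'a::field polyn) = meval var u"
proof -
  have "mpoly u = (mpoly (\<Sum>i\<in>kys u. sgl i (lk u i)) :: 'a polyn)"
    by (rule arg_cong[of _ _ mpoly], rule single_sum_monom[symmetric])
  also have "\<dots> = (\<Prod>i\<in>kys u. mpoly (sgl i (lk u i)))"
    by (rule mpoly_sum)
  also have "\<dots> = meval var u"
    unfolding meval_def by (intro prod.cong refl mpoly_single)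
  finally show ?thesis .
qed

lemma single_eq: "sgl u c = const c * mpoly u"
  by (simp add: const_def mpoly_def mult_single)

interpretation const_hom: coeff_hom const
  by unfold_locales (simp_all add: const_add const_mult)

lemma peval_const_var [simp]: "peval const var p = p"
  unfolding peval_def by (simp add: mpoly_eq_meval[symmetric] single_eq[symmetric] single_sum_eq)

section \<open>Subrings of polynomials in given variables\<close>

lemma polys_mono: "V \<subseteq> W \<Longrightarrow> polys V \<subseteq> polys W"
  by (auto simp: polys_def)

lemma polys_0 [simp]: "0 \<in> polys V" and polys_1 [simp]: "1 \<in> polys V"
  and polys_const [simp]: "const c \<in> polys V"
  by (auto simp: polys_def const_def split: if_splits)

lemma polys_add: "p \<in> polys V \<Longrightarrow> q \<in> polys V \<Longrightarrow> p + q \<in> polys V"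
  using keys_add[of p q] by (auto simp: polys_def)

lemma polys_mult: "p \<in> polys V \<Longrightarrow> q \<in> polys V \<Longrightarrow> p * q \<in> polys V"
proof -
  assume p: "p \<in> polys V" and q: "q \<in> polys V"
  have "kys w \<subseteq> V" if w: "w \<in> kys (p * q)" for w
  proof -
    obtain a b where "w = a + b" "a \<in> kys p" "b \<in> kys q"
      using keys_mult[of p q] w by auto
    then show ?thesis using p q keys_add[of a b] by (fastforce simp: polys_def)
  qed
  then show ?thesis by (auto simp: polys_def)
qed

lemma keys_uminus [simp]: "kys (- p) = kys (p :: 'a \<Rightarrow>\<^sub>0 'b::ab_group_add)"
  by (auto simp: in_keys_iff)

lemma polys_uminus: "p \<in> polys V \<Longrightarrow> - p \<in> polys V"
  by (simp add: polys_def)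

lemma polys_diff: "p \<in> polys V \<Longrightarrow> q \<in> polys V \<Longrightarrow> p - q \<in> polys V"
  using polys_add[OF _ polys_uminus, of p V q] by simp

lemma polys_sum: "(\<And>i. i \<in> S \<Longrightarrow> f i \<in> polys V) \<Longrightarrow> sum f S \<in> polys V"
  by (induction S rule: infinite_finite_induct) (auto intro: polys_add)

lemma polys_prod: "(\<And>i. i \<in> S \<Longrightarrow> f i \<in> polys V) \<Longrightarrow> prod f S \<in> polys V"
  by (induction S rule: infinite_finite_induct) (auto intro: polys_mult)

lemma polys_power: "p \<in> polys V \<Longrightarrow> p ^ k \<in> polys V"
  by (induction k) (auto intro: polys_mult)

lemma polys_var [simp]: "var i \<in> polys V \<longleftrightarrow> i \<in> V"
  by (auto simp: polys_def var_def mpoly_def)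

lemma polys_single: "kys u \<subseteq> V \<Longrightarrow> sgl u c \<in> polys V"
  by (auto simp: polys_def)

lemma polys_mpoly [simp]: "mpoly u \<in> polys V \<longleftrightarrow> kys u \<subseteq> V"
  by (auto simp: polys_def mpoly_def)

lemmas polys_intros = polys_add polys_mult polys_uminus polys_diff polys_sum polys_prod polys_power

lemma polys_induct [consumes 1, case_names zero add]:
  assumes "p \<in> polys V" and "P 0"
    and "\<And>u c q. P q \<Longrightarrow> q \<in> polys V \<Longrightarrow> kys u \<subseteq> V \<Longrightarrow> P (sgl u c + q)"
  shows "P p"
proof -
  have "P p \<and> p \<in> polys V"
  proof (induction p rule: polyn_induct)
    case (add u c q)
    moreover have "kys u \<subseteq> V" using add assms(1) by (auto simp: polys_def)
    ultimately show ?case using assms by (blast intro: polys_intros polys_single)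
  qed (use assms in auto)
  then show ?thesis ..
qed

lemma polys_finite:
  obtains V where "finite V" "p \<in> polys V"
proof
  show "finite (\<Union>u\<in>kys p. kys u)" by simp
  show "p \<in> polys (\<Union>u\<in>kys p. kys u)" by (auto simp: polys_def)
qed

lemma polys_meval: "(\<And>i. i \<in> kys u \<Longrightarrow> \<phi> i \<in> polys W) \<Longrightarrow> meval \<phi> u \<in> polys W"
  by (auto simp: meval_def intro!: polys_intros)

lemma peval_polys: "p \<in> polys V \<Longrightarrow> (\<And>i. i \<in> V \<Longrightarrow> \<phi> i \<in> polys W) \<Longrightarrow> peval const \<phi> p \<in> polys W"
  unfolding peval_def by (intro polys_intros polys_const polys_meval) (auto simp: polys_def[of V])

lemma meval_cong: "(\<And>i. i \<in> kys u \<Longrightarrow> \<phi> i = \<psi> i) \<Longrightarrow> meval \<phi> u = meval \<psi> u"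
  by (simp add: meval_def)

lemma peval_cong: "p \<in> polys V \<Longrightarrow> (\<And>i. i \<in> V \<Longrightarrow> \<phi> i = \<psi> i) \<Longrightarrow> peval \<kappa> \<phi> p = peval \<kappa> \<psi> p"
  unfolding peval_def by (intro sum.cong) (auto intro!: arg_cong[of _ _
    "(*) _"] meval_cong simp: polys_def)

lemma peval_id: "p \<in> polys V \<Longrightarrow> (\<And>i. i \<in> V \<Longrightarrow> \<phi> i = var i) \<Longrightarrow> peval const \<phi> p = p"
  using peval_cong[of p V \<phi> var const] by simp

text \<open>Uniqueness in the universal property of the polynomial ring: identities between
  homomorphisms are checked on constants and variables only.\<close>

lemma (in coeff_hom) hom_eqI:
  assumes "\<And>p q. F (p + q) = F p + F q" "\<And>p q. F (p * q) = F p * F q"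
    and "\<And>c. F (const c) = \<kappa> c" and "\<And>i. F (var i) = \<phi> i"
  shows "F p = peval \<kappa> \<phi> p"
proof (induction p rule: polyn_induct)
  case zero
  show ?case using assms(3)[of 0] by (simp add: \<kappa>0)
next
  case (add u c q)
  have one: "F 1 = 1" using assms(3)[of 1] by (simp add: \<kappa>1)
  have pw: "F (a ^ k) = F a ^ k" for a k by (induction k) (simp_all add: one assms(2))
  have "F (prod f S) = (\<Prod>i\<in>S. F (f i))" for f :: "nat \<Rightarrow> _" and S
    by (induction S rule: infinite_finite_induct) (simp_all add: one assms(2))
  then have "F (mpoly u) = meval \<phi> u"
    by (simp add: mpoly_eq_meval meval_def pw assms(4))
  then show ?case
    by (simp add: assms(1) add peval_add single_eq assms(2,3) peval_mult peval_const)
      (simp add: mpoly_def peval_single \<kappa>1)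
qed


section \<open>Univariate view in one variable\<close>

interpretation poly_hom: coeff_hom "\<lambda>c. [:const c:]"
  by unfold_locales (simp_all add: const_add const_mult pCons_one)

text \<open>View of a polynomial as a univariate polynomial in \<open>x\<close>. Its coefficients keep the full
  type, so that the library theory of \<^typ>\<open>'a poly\<close> over an integral domain applies to them.\<close>

definition as_univ :: "nat \<Rightarrow> 'k::field polyn \<Rightarrow> 'k polyn poly" where
  "as_univ x = peval (\<lambda>c. [:const c:]) (\<lambda>i. if i = x then [:0, 1:] else [:var i:])"

lemma as_univ_simps [simp]:
  "as_univ x 0 = 0" "as_univ x 1 = 1" "as_univ x (p + q) = as_univ x p + as_univ x q"
    "as_univ x (p * q) = as_univ x p * as_univ x q"
  "as_univ x (p - q) = as_univ x p - as_univ x q" "as_univ x (- p) = - as_univ x p"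
    "as_univ x (p ^ k) = as_univ x p ^ k"
  "as_univ x (const c) = [:const c:]" "as_univ x (var i) = (if i = x then [:0, 1:] else [:var i:])"
  "as_univ x (sum f S) = (\<Sum>i\<in>S. as_univ x (f i))"
  by (simp_all add: as_univ_def poly_hom.peval_add poly_hom.peval_mult poly_hom.peval_diff
      poly_hom.peval_uminus poly_hom.peval_power poly_hom.peval_const poly_hom.peval_var
      poly_hom.peval_sum)

lemma poly_as_univ [simp]: "poly (as_univ x p) (var x) = p"
  using const_hom.hom_eqI[of "\<lambda>p. poly (as_univ x p) (var x)" var p] by simp

lemma poly_as_univ_subst: "poly (as_univ x p) q = peval const (var(x := q)) p"
  by (rule const_hom.hom_eqI) auto

lemma as_univ_eq_iff [simp]: "as_univ x p = as_univ x q \<longleftrightarrow> p = q"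
  by (metis poly_as_univ)

lemma as_univ_eq_0_iff [simp]: "as_univ x p = 0 \<longleftrightarrow> p = 0"
  by (metis as_univ_eq_iff as_univ_simps(1))

lemma polys_gen_induct [consumes 1, case_names const var add mult]:
  assumes "p \<in> polys V" and "\<And>c. P (const c)" and "\<And>i. i \<in> V \<Longrightarrow> P (var i)"
    and "\<And>p q. P p \<Longrightarrow> P q \<Longrightarrow> P (p + q)" and "\<And>p q. P p \<Longrightarrow> P q \<Longrightarrow> P (p * q)"
  shows "P p"
  using assms(1)
proof (induction p rule: polys_induct)
  case zero
  show ?case using assms(2)[of 0] by simp
next
  case (add u c q)
  have one: "P 1" using assms(2)[of 1] by simp
  have pw: "P (a ^ k)" if "P a" for a k by (induction k) (auto simp: one intro: assms that)
  have pr: "P (prod f S)" if "\<And>i. i \<in> S \<Longrightarrow> P (f i)" for f :: "nat \<Rightarrow> _" and S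
    using that by (induction S rule: infinite_finite_induct) (auto simp: one intro: assms)
  have "P (meval var u)"
    unfolding meval_def by (intro pr pw assms(3)) (use add in auto)
  then show ?case
    unfolding single_eq mpoly_eq_meval by (intro assms add.IH)
qed

lemma as_univ_const: "p \<in> polys V \<Longrightarrow> x \<notin> V \<Longrightarrow> as_univ x p = [:p:]"
  by (induction p rule: polys_gen_induct) auto

lemma coeff_as_univ_polys: "p \<in> polys V \<Longrightarrow> coeff (as_univ x p) i \<in> polys (V - {x})"
proof (induction p arbitrary: i rule: polys_gen_induct)
  case (mult p q)
  then show ?case by (auto simp: coeff_mult intro!: polys_intros)
qed (auto simp: coeff_pCons intro!: polys_intros split: nat.splits)

lemma degree_as_univ_0: "p \<in> polys V \<Longrightarrow> degree (as_univ x p) = 0 \<Longrightarrow> p \<in> polys (V - {x})"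
proof -
  assume p: "p \<in> polys V" and "degree (as_univ x p) = 0"
  then obtain c where c: "as_univ x p = [:c:]" by (auto elim: degree_eq_zeroE)
  then have "p = c" using poly_as_univ[of x p] by simp
  then show ?thesis using coeff_as_univ_polys[OF p, of x 0] c by simp
qed

lemma polys_factor:
  assumes "a * b \<in> polys V" "a * b \<noteq> 0"
  shows "a \<in> polys V"
proof -
  obtain W where W: "finite W" "a \<in> polys W" by (rule polys_finite)
  have "a \<in> polys (W - S)" if "finite S" "S \<inter> V = {}" for S
    using that
  proof (induction S)
    case (insert x S)
    have "degree (as_univ x (a * b)) = 0"
      using insert by (subst as_univ_const[OF assms(1)]) auto
    then have "degree (as_univ x a) = 0"
      using assms(2) by (simp add: degree_mult_eq)
    then have "a \<in> polys (W - S - {x})"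
      using degree_as_univ_0[of a "W - S" x] insert by auto
    then show ?case by (metis Diff_insert)
  qed (use W in auto)
  from this[of "W - V"] have "a \<in> polys (W - (W - V))" using W by auto
  then show ?thesis using polys_mono[of "W - (W - V)" V] by auto
qed

lemma polys_factor2: "a * b \<in> polys V \<Longrightarrow> a * b \<noteq> 0 \<Longrightarrow> b \<in> polys V"
  using polys_factor[of b a V] by (simp add: mult.commute)

section \<open>Total degree and homogeneous components\<close>

definition homog :: "nat \<Rightarrow> 'k::field polyn \<Rightarrow> bool" where
  "homog q p \<longleftrightarrow> (\<forall>u\<in>kys p. mdeg u = q)"

text \<open>Substituting \<open>x\<^sub>i t\<close> for \<open>x\<^sub>i\<close> makes the coefficient of \<open>t\<^sup>q\<close> the homogeneous component of
  degree \<open>q\<close>. Degrees and components of products are thereby read off in a univariate polynomial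
  ring.\<close>

definition as_graded :: "'k::field polyn \<Rightarrow> 'k polyn poly" where
  "as_graded = peval (\<lambda>c. [:const c:]) (\<lambda>i. Polynomial.monom (var i) 1)"

definition tot_deg :: "'k::field polyn \<Rightarrow> nat" where
  "tot_deg p = degree (as_graded p)"

lemma as_graded_simps [simp]:
  "as_graded 0 = 0" "as_graded 1 = 1" "as_graded (p + q) = as_graded p + as_graded q"
    "as_graded (p * q) = as_graded p * as_graded q"
  "as_graded (p - q) = as_graded p - as_graded q" "as_graded (- p) = - as_graded p"
  "as_graded (const c) = [:const c:]" "as_graded (var i) = Polynomial.monom (var i) 1"
  by (simp_all add: as_graded_def poly_hom.peval_add poly_hom.peval_mult poly_hom.peval_diff
      poly_hom.peval_uminus poly_hom.peval_const poly_hom.peval_var)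

lemma poly_as_graded [simp]: "poly (as_graded p) 1 = p"
  using const_hom.hom_eqI[of "\<lambda>p. poly (as_graded p) 1" var p] by (simp add: poly_monom)

lemma as_graded_eq_0_iff [simp]: "as_graded p = 0 \<longleftrightarrow> p = 0"
  by (metis poly_as_graded as_graded_simps(1))

lemma prod_monom:
  "(\<Prod>i\<in>S. Polynomial.monom (a i) (k i)) = Polynomial.monom (\<Prod>i\<in>S. a i :: 'a::comm_ring_1) (\<Sum>i\<in>S. k
    i)"
  by (induction S rule: infinite_finite_induct) (simp_all add: mult_monom)

lemma as_graded_single: "as_graded (sgl u c) = Polynomial.monom (sgl u c) (mdeg u)"
proof -
  have "meval (\<lambda>i. Polynomial.monom (var i :: 'a polyn) 1) u = Polynomial.monom (mpoly u) (mdeg u)"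
    by (simp add: mpoly_eq_meval meval_def monom_power prod_monom mdeg_def)
  then show ?thesis
    unfolding as_graded_def poly_hom.peval_single by (simp add: smult_monom single_eq)
qed

lemma lookup_coeff_as_graded: "lk (coeff (as_graded p) q) u = (if mdeg u = q then lk p u else 0)"
  by (induction p rule: polyn_induct)
    (auto simp: as_graded_single lookup_add lookup_single when_def)

lemma homog_iff_as_graded: "homog q p \<longleftrightarrow> as_graded p = Polynomial.monom p q"
proof
  assume "homog q p"
  then show "as_graded p = Polynomial.monom p q"
    by (intro poly_eqI poly_mapping_eqI) (auto simp: lookup_coeff_as_graded homog_def in_keys_iff)
next
  assume *: "as_graded p = Polynomial.monom p q"
  have "lk p u = 0" if "mdeg u \<noteq> q" for u
    using lookup_coeff_as_graded[of p "mdeg u" u] that by (simp add: *)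
  then show "homog q p" by (auto simp: homog_def in_keys_iff)
qed

lemma homog_0 [simp]: "homog q 0" and homog_const [simp]: "homog 0 (const c)"
  and homog_1 [simp]: "homog 0 1" and homog_var [simp]: "homog 1 (var i)"
  and homog_mpoly: "homog q (mpoly u) \<longleftrightarrow> mdeg u = q"
  by (auto simp: homog_def const_def var_def mpoly_def)

lemma homog_add: "homog q p \<Longrightarrow> homog q r \<Longrightarrow> homog q (p + r)"
  by (simp add: homog_iff_as_graded add_monom)

lemma homog_mult: "homog q p \<Longrightarrow> homog r s \<Longrightarrow> homog (q + r) (p * s)"
  by (simp add: homog_iff_as_graded mult_monom)

lemma tot_deg_homog: "homog q p \<Longrightarrow> p \<noteq> 0 \<Longrightarrow> tot_deg p = q"
  by (simp add: tot_deg_def homog_iff_as_graded degree_monom_eq)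

lemma tot_deg_mult: "p \<noteq> 0 \<Longrightarrow> q \<noteq> 0 \<Longrightarrow> tot_deg (p * q) = tot_deg p + tot_deg q"
  by (simp add: tot_deg_def degree_mult_eq)

text \<open>For \<open>as_graded\<close> both the order at 0 and the degree are additive. They
  coincide for the product, and the order never exceeds the degree, so they coincide for each
  factor.\<close>

lemma homog_factor:
  assumes "homog q (a * b)" "a * b \<noteq> 0"
  shows "homog (tot_deg a) a"
proof -
  have nz: "a \<noteq> 0" "b \<noteq> 0" "as_graded a \<noteq> 0" "as_graded b \<noteq> 0" using assms by auto
  have "order 0 (as_graded a * as_graded b) = degree (as_graded a * as_graded b)"
    using assms unfolding homog_iff_as_graded by (simp add: degree_monom_eq order_0_monom)
  then have "order 0 (as_graded a) + order 0 (as_graded b)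
    = degree (as_graded a) + degree (as_graded b)"
    using nz by (simp add: degree_mult_eq order_mult)
  then have "order 0 (as_graded a) = degree (as_graded a)"
    using order_degree[OF nz(3), of 0] order_degree[OF nz(4), of 0] by linarith
  then have "Polynomial.monom 1 (tot_deg a) dvd as_graded a"
    using nz by (simp add: monom_1_dvd_iff tot_deg_def)
  then have low: "coeff (as_graded a) k = 0" if "k < tot_deg a" for k
    using that by (simp add: monom_1_dvd_iff')
  have "mdeg u = tot_deg a" if "u \<in> kys a" for u
  proof -
    have "coeff (as_graded a) (mdeg u) \<noteq> 0"
      using lookup_coeff_as_graded[of a "mdeg u" u] that by (auto simp: in_keys_iff)
    then have "\<not> mdeg u < tot_deg a" "mdeg u \<le> tot_deg a"
      using low le_degree[of "as_graded a" "mdeg u"] unfolding tot_deg_def by blast+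
    then show ?thesis by linarith
  qed
  then show ?thesis by (simp add: homog_def)
qed

lemma homog_factor2: "homog q (a * b) \<Longrightarrow> a * b \<noteq> 0 \<Longrightarrow> homog (tot_deg b) b"
  using homog_factor[of q b a] by (simp add: mult.commute)

lemma homog_0_const: "homog 0 p \<Longrightarrow> \<exists>c. p = const c"
  unfolding homog_def mdeg_eq_0_iff const_def
  by (intro exI[of _ "lk p 0"] poly_mapping_eqI) (auto simp: lookup_single when_def in_keys_iff)

lemma tot_deg_0_const:
  assumes "tot_deg p = 0"
  shows "\<exists>c. p = const c"
proof (rule homog_0_const)
  obtain c where "as_graded p = [:c:]" using assms by (auto simp: tot_deg_def elim: degree_eq_zeroE)
  then show "homog 0 p" using poly_as_graded[of p] by (simp add: homog_iff_as_graded monom_0)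
qed

lemma tot_deg_const [simp]: "tot_deg (const c) = 0"
  by (simp add: tot_deg_def)

definition homog_part :: "nat \<Rightarrow> 'k::field polyn \<Rightarrow> 'k polyn" where
  "homog_part q p = coeff (as_graded p) q"

lemma lookup_homog_part: "lk (homog_part q p) u = (if mdeg u = q then lk p u else 0)"
  by (simp add: homog_part_def lookup_coeff_as_graded)

lemma homog_part_add: "homog_part q (p + r) = homog_part q p + homog_part q r"
  and homog_part_0 [simp]: "homog_part q 0 = 0"
  by (simp_all add: homog_part_def)

lemma homog_homog_part [simp]: "homog q (homog_part q p)"
  by (auto simp: homog_def in_keys_iff lookup_homog_part split: if_splits)

lemma homog_part_homog: "homog q p \<Longrightarrow> homog_part r p = (if r = q then p else 0)"
  by (auto simp: homog_part_def homog_iff_as_graded)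

lemma homog_part_polys: "p \<in> polys V \<Longrightarrow> homog_part q p \<in> polys V"
  by (auto simp: polys_def in_keys_iff lookup_homog_part split: if_splits)

lemma sum_homog_part: "(\<Sum>q\<le>tot_deg p. homog_part q p) = p"
  using poly_altdef[of "as_graded p" 1] by (simp add: homog_part_def tot_deg_def)

lemma homog_part_mult_homog:
  assumes "homog d a"
  shows "homog_part (d + q) (a * p) = a * homog_part q p"
  using assms by (simp add: homog_part_def homog_iff_as_graded coeff_monom_mult)

lemma homog_part_mult_homog':
  assumes "homog d a"
  shows "homog_part q (a * p) = (if d \<le> q then a * homog_part (q - d) p else 0)"
  using assms by (simp add: homog_part_def homog_iff_as_graded coeff_monom_mult)

section \<open>Irreducible polynomials are prime\<close>

definition irred :: "'k::field polyn \<Rightarrow> bool" where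
  "irred p \<longleftrightarrow> tot_deg p > 0 \<and> (\<forall>a b. p = a * b \<longrightarrow> tot_deg a = 0 \<or> tot_deg b = 0)"

text \<open>Relative to the variables in \<open>V\<close>, because the proof is by induction on \<open>V\<close>. Divisibility
  itself does not depend on \<open>V\<close>: see \<open>polys_factor\<close>.\<close>

definition prime_on :: "nat set \<Rightarrow> 'k::field polyn \<Rightarrow> bool" where
  "prime_on V p \<longleftrightarrow> (\<forall>f\<in>polys V. \<forall>g\<in>polys V. p dvd f * g \<longrightarrow> p dvd f \<or> p dvd g)"

lemma tot_deg_0 [simp]: "tot_deg 0 = 0" "tot_deg 1 = 0"
  by (simp_all add: tot_deg_def)

lemma irred_nonzero: "irred p \<Longrightarrow> p \<noteq> 0"
  by (auto simp: irred_def)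

lemma tot_deg_0_dvd_1: "tot_deg p = 0 \<Longrightarrow> p \<noteq> 0 \<Longrightarrow> p dvd 1"
  by (metis tot_deg_0_const const_eq_0_iff const_inverse dvdI)

lemma ex_irred_dvd:
  assumes "tot_deg f > 0"
  obtains p where "irred p" "p dvd f"
proof -
  define p where "p = arg_min tot_deg (\<lambda>p. p dvd f \<and> tot_deg p > 0)"
  have p: "p dvd f \<and> tot_deg p > 0"
    unfolding p_def by (rule arg_min_natI[of _ f]) (use assms in auto)
  have le: "tot_deg p \<le> tot_deg q" if "q dvd f" "tot_deg q > 0" for q
    unfolding p_def by (rule arg_min_nat_le) (use that in auto)
  have "irred p"
    unfolding irred_def
  proof (intro conjI allI impI)
    show "tot_deg p > 0" using p by simp
    fix a b assume ab: "p = a * b"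
    have nz: "a \<noteq> 0" "b \<noteq> 0" using p ab by auto
    show "tot_deg a = 0 \<or> tot_deg b = 0"
    proof (rule ccontr)
      assume "\<not> ?thesis"
      then have "tot_deg a > 0" "tot_deg a < tot_deg p" using tot_deg_mult[OF nz] ab by auto
      moreover have "a dvd f" using p ab by (meson dvd_mult_left)
      ultimately show False using le[of a] by auto
    qed
  qed
  then show ?thesis using p that by blast
qed

lemma dvd_iff_coeff_as_univ:
  assumes "p \<in> polys V" "x \<notin> V"
  shows "p dvd f \<longleftrightarrow> (\<forall>i. p dvd coeff (as_univ x f) i)"
proof
  assume "p dvd f"
  then obtain k where "f = p * k" ..
  then have "as_univ x f = [:p:] * as_univ x k" using as_univ_const[OF assms] by simp
  then show "\<forall>i. p dvd coeff (as_univ x f) i" by auto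
next
  assume "\<forall>i. p dvd coeff (as_univ x f) i"
  then have "[:p:] dvd as_univ x f" by (simp add: const_poly_dvd_iff)
  then obtain r where "as_univ x f = [:p:] * r" ..
  then have "poly (as_univ x f) (var x) = poly ([:p:] * r) (var x)" by (rule arg_cong)
  then have "f = p * poly r (var x)" by (simp only: poly_as_univ poly_mult poly_pCons poly_0
    mult_zero_right add_0_right)
  then show "p dvd f" by simp
qed

text \<open>Gauss's argument: if \<open>i\<close> and \<open>j\<close> are the least indices of
  coefficients not divisible by \<open>p\<close>, then in the coefficient of the product at
  \<open>i + j\<close> every summand except \<open>?F i * ?G j\<close> is divisible by
  \<open>p\<close>.\<close>

lemma prime_on_insert:
  assumes p: "p \<in> polys V" "x \<notin> V" and prime: "prime_on V p"
  shows "prime_on (insert x V) p"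
  unfolding prime_on_def
proof (intro ballI impI, rule ccontr)
  fix f g assume fg: "f \<in> polys (insert x V)" "g \<in> polys (insert x V)" "p dvd f * g"
    "\<not> (p dvd f \<or> p dvd g)"
  let ?F = "coeff (as_univ x f)" and ?G = "coeff (as_univ x g)"
  define i where "i = (LEAST i. \<not> p dvd ?F i)"
  define j where "j = (LEAST i. \<not> p dvd ?G i)"
  have F: "?F k \<in> polys V" and G: "?G k \<in> polys V" for k
    using coeff_as_univ_polys[OF fg(1), of x k] coeff_as_univ_polys[OF fg(2), of x k] p(2) by auto
  have "\<exists>i. \<not> p dvd ?F i" "\<exists>i. \<not> p dvd ?G i" using fg(4) dvd_iff_coeff_as_univ[OF p] by blast+
  then have i: "\<not> p dvd ?F i" and j: "\<not> p dvd ?G j"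
    unfolding i_def j_def using LeastI_ex[of "\<lambda>i. \<not> p dvd ?F i"] LeastI_ex[of "\<lambda>i. \<not> p dvd ?G i"]
    by blast+
  have li: "p dvd ?F k" if "k < i" for k using that not_less_Least unfolding i_def by blast
  have lj: "p dvd ?G k" if "k < j" for k using that not_less_Least unfolding j_def by blast
  have "p dvd coeff (as_univ x (f * g)) (i + j)" using fg(3) dvd_iff_coeff_as_univ[OF p] by blast
  then have "p dvd (\<Sum>k\<le>i + j. ?F k * ?G (i + j - k))" by (simp add: coeff_mult)
  also have "(\<Sum>k\<le>i + j. ?F k * ?G (i + j - k)) =
    ?F i * ?G j + (\<Sum>k\<in>{..i + j} - {i}. ?F k * ?G (i + j - k))"
    by (subst sum.remove[of _ i]) auto
  finally have *: "p dvd ?F i * ?G j + (\<Sum>k\<in>{..i + j} - {i}. ?F k * ?G (i + j - k))" .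
  have "p dvd (\<Sum>k\<in>{..i + j} - {i}. ?F k * ?G (i + j - k))"
  proof (rule dvd_sum)
    fix k assume "k \<in> {..i + j} - {i}"
    then have "k < i \<or> i + j - k < j" by auto
    then show "p dvd ?F k * ?G (i + j - k)" using li lj by (auto intro: dvd_mult dvd_mult2)
  qed
  then have "p dvd ?F i * ?G j" using * dvd_add_left_iff by blast
  then show False using prime i j F G by (auto simp: prime_on_def)
qed

context
  fixes V :: "nat set" and x :: nat and dummy :: "'k::field"
  assumes xV: "x \<notin> V" and IH: "\<And>p :: 'k polyn. p \<in> polys V \<Longrightarrow> irred p \<Longrightarrow> prime_on V p"
begin

text \<open>Irreducible factors of \<open>c\<close> are removed one at a time. Each stays prime
  after adjoining \<open>x\<close> and does not divide \<open>h\<close>, hence it divides the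
  cofactor \<open>k\<close> in \<open>c * f = h * k\<close> and cancels.\<close>

lemma primitive_dvd_cancel:
  fixes h :: "'k polyn"
  assumes h: "h \<in> polys (insert x V)" and prim: "\<And>q. q \<in> polys V \<Longrightarrow> irred q \<Longrightarrow> \<not> q dvd h"
    and "c \<in> polys V" "c \<noteq> 0" "f \<in> polys (insert x V)" "h dvd c * f"
  shows "h dvd f"
  using assms(3-)
proof (induction "tot_deg c" arbitrary: c rule: less_induct)
  case less
  show ?case
  proof (cases "tot_deg c = 0 \<or> f = 0")
    case True
    then have "c dvd 1 \<or> f = 0"
      using less.prems tot_deg_0_dvd_1[of c] by blast
    then show ?thesis
    proof
      assume "c dvd 1"
      then obtain d where "1 = c * d" ..
      then have "f = d * (c * f)" by (simp add: mult_ac flip: mult.assoc)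
      then show ?thesis using less.prems by (metis dvd_mult)
    qed simp
  next
    case False
    then obtain q where q: "irred q" "q dvd c" using ex_irred_dvd by auto
    then obtain c' where c': "c = q * c'" by blast
    have qV: "q \<in> polys V" "c' \<in> polys V"
      using c' less.prems polys_factor polys_factor2 by blast+
    have nz: "q \<noteq> 0" "c' \<noteq> 0" using c' less.prems by auto
    obtain k where k: "c * f = h * k" using less.prems by blast
    have kV: "k \<in> polys (insert x V)"
    proof (rule polys_factor2)
      show "h * k \<in> polys (insert x V)" unfolding k[symmetric]
        using less.prems polys_mono[of V "insert x V"] by (auto intro!: polys_intros)
      show "h * k \<noteq> 0" using k False less.prems by auto
    qed
    have "q dvd h * k" using k c' by (metis dvd_triv_left mult.assoc)
    then have "q dvd k"
      using prime_on_insert[OF qV(1) xV IH[OF qV(1) q(1)]] h kV prim[OF qV(1) q(1)]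
      by (auto simp: prime_on_def)
    then obtain k' where "k = q * k'" ..
    then have "q * (c' * f) = q * (h * k')" using k c' by (simp add: mult_ac)
    then have "h dvd c' * f" using nz by simp
    moreover have "tot_deg c' < tot_deg c" using tot_deg_mult[OF nz] c' q by (auto simp: irred_def)
    ultimately show ?thesis using less nz qV by blast
  qed
qed

lemma ex_primitive_part:
  fixes h :: "'k polyn"
  assumes "h \<noteq> 0" "h \<in> polys (insert x V)"
  obtains c g where "h = c * g" "c \<in> polys V" "\<And>q. q \<in> polys V \<Longrightarrow> irred q \<Longrightarrow> \<not> q dvd g"
  using assms
proof (induction "tot_deg h" arbitrary: h thesis rule: less_induct)
  case less
  show ?case
  proof (cases "\<exists>q\<in>polys V. irred q \<and> q dvd h")
    case False
    then show ?thesis using less.prems(1)[of 1 h] by auto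
  next
    case True
    then obtain q h' where q: "q \<in> polys V" "irred q" "h = q * h'" by blast
    have nz: "q \<noteq> 0" "h' \<noteq> 0" using q less.prems by auto
    have "tot_deg h' < tot_deg h" using tot_deg_mult[OF nz] q by (auto simp: irred_def)
    moreover have "h' \<in> polys (insert x V)" using q less.prems polys_factor2 by blast
    ultimately obtain c g where "h' = c * g" "c \<in> polys V" "\<And>q. q \<in> polys V \<Longrightarrow> irred q \<Longrightarrow> \<not> q dvd g"
      using less.hyps nz by metis
    then show ?thesis using less.prems(1)[of "q * c" g] q by (auto intro: polys_mult simp: mult_ac)
  qed
qed

text \<open>Gauss's argument without fraction fields: an element \<open>h\<close> of least degree in \<open>x\<close> of the
  ideal \<open>(p, f)\<close> divides a multiple \<open>c r\<close>, with \<open>c\<close> free of \<open>x\<close>, of every \<open>r\<close> in that ideal. Its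
  primitive part then divides \<open>p\<close> and \<open>f\<close>, and is a constant or an associate of \<open>p\<close>.\<close>

lemma irred_prime_on_step:
  fixes p :: "'k polyn"
  assumes p: "p \<in> polys (insert x V)" "irred p"
  shows "prime_on (insert x V) p"
proof (cases "p \<in> polys V")
  case True
  then show ?thesis using prime_on_insert xV IH p by blast
next
  case False
  let ?W = "insert x V"
  have VW: "a \<in> polys ?W" if "a \<in> polys V" for a :: "'k polyn" using that polys_mono[of V ?W]
    by auto
  have prim: "\<not> q dvd p" if q: "q \<in> polys V" "irred q" for q
  proof
    assume "q dvd p"
    then obtain k where k: "p = q * k" ..
    then have "tot_deg k = 0" using p(2) q(2) unfolding irred_def by (metis less_irrefl)
    then obtain c where "k = const c" using tot_deg_0_const by blast
    then have "p \<in> polys V" using k q by (auto intro!: polys_mult)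
    then show False using False by simp
  qed
  show ?thesis
    unfolding prime_on_def
  proof (intro ballI impI)
    fix f g assume fg: "f \<in> polys ?W" "g \<in> polys ?W" "p dvd f * g"
    define J where "J = {u * p + v * f | u v. u \<in> polys ?W \<and> v \<in> polys ?W}"
    define h where "h = arg_min (\<lambda>h. degree (as_univ x h)) (\<lambda>h. h \<in> J \<and> h \<noteq> 0)"
    have J_I: "u * p + v * f \<in> J" if "u \<in> polys ?W" "v \<in> polys ?W" for u v
      unfolding J_def using that by blast
    have pJ: "p \<in> J" and fJ: "f \<in> J" using J_I[of 1 0] J_I[of 0 1] by simp_all
    have p0: "p \<noteq> 0" using p irred_nonzero by auto
    have h: "h \<in> J \<and> h \<noteq> 0"
      unfolding h_def by (rule arg_min_natI[of _ p]) (use pJ p0 in auto)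
    have hmin: "degree (as_univ x h) \<le> degree (as_univ x r)" if "r \<in> J" "r \<noteq> 0" for r
      unfolding h_def by (rule arg_min_nat_le) (use that in auto)
    have JW: "J \<subseteq> polys ?W" unfolding J_def using fg p by (auto intro!: polys_intros)
    have Jlin: "a * r - b * s \<in> J" if rs: "r \<in> J" "s \<in> J" "a \<in> polys ?W" "b \<in> polys ?W" for a b r s
    proof -
      obtain u v where r: "r = u * p + v * f" "u \<in> polys ?W" "v \<in> polys ?W" using rs
        unfolding J_def by auto
      obtain u' v' where s: "s = u' * p + v' * f" "u' \<in> polys ?W" "v' \<in> polys ?W" using rs
        unfolding J_def by auto
      have "a * r - b * s = (a * u - b * u') * p + (a * v - b * v') * f"
        by (simp add: r s algebra_simps)
      then show ?thesis using r s rs by (auto intro!: J_I polys_intros)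
    qed
    have div: "\<exists>c\<in>polys V. c \<noteq> 0 \<and> h dvd c * r" if "r \<in> J" for r
      using that
    proof (induction "degree (as_univ x r)" arbitrary: r rule: less_induct)
      case less
      show ?case
      proof (cases "r = 0")
        case True
        then show ?thesis by (intro bexI[of _ 1]) auto
      next
        case False
        \<comment> \<open>Pseudo-division: multiplying by the leading coefficients makes the leading
          terms cancel without inverting anything in the coefficient ring.\<close>
        define c where "c = lead_coeff (as_univ x h)"
        define b where "b = lead_coeff (as_univ x r)"
        define e where "e = degree (as_univ x r) - degree (as_univ x h)"
        define r' where "r' = c * r - (b * var x ^ e) * h"
        have cb: "c \<in> polys V" "b \<in> polys V" "c \<noteq> 0" "b \<noteq> 0"
          using coeff_as_univ_polys[of h ?W x] coeff_as_univ_polys[of r ?W x] h less.prems JW xV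
            False
          by (auto simp: c_def b_def)
        have le: "degree (as_univ x h) \<le> degree (as_univ x r)" using hmin less.prems False by auto
        have r'J: "r' \<in> J" unfolding r'_def
          by (rule Jlin) (use less.prems h cb VW in \<open>auto intro!: polys_intros\<close>)
        have toPr': "as_univ x r' = [:c:] * as_univ x r - Polynomial.monom b e * as_univ x h"
          using as_univ_const[OF cb(1) xV] as_univ_const[OF cb(2) xV]
          by (simp add: r'_def monom_altdef)
        have "h dvd r' \<or> (\<exists>c\<in>polys V. c \<noteq> 0 \<and> h dvd c * r')"
        proof (cases "r' = 0")
          case r'0: False
          have "degree (as_univ x r') < degree (as_univ x r)"
          proof -
            have "degree (as_univ x r') \<le> degree (as_univ x r)"
              unfolding toPr' using le cb
              by (intro degree_diff_le) (auto simp: e_def degree_mult_eq degree_monom_eq intro: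
                order_trans[OF degree_mult_le])
            moreover have "coeff (as_univ x r') (degree (as_univ x r)) = 0"
            proof -
              have "coeff (as_univ x r') (degree (as_univ x r)) = c * b - b * c"
                unfolding toPr' using le by (simp add: coeff_monom_mult e_def c_def b_def)
              then show ?thesis by simp
            qed
            moreover have "as_univ x r' \<noteq> 0" using r'0 by simp
            ultimately show ?thesis by (metis leading_coeff_0_iff le_neq_implies_less)
          qed
          then show ?thesis using less.hyps r'J by blast
        qed simp
        then obtain d where d: "d \<in> polys V" "d \<noteq> 0" "h dvd d * r'"
          by (metis polys_1 mult_1 one_neq_zero)
        have "d * c * r = d * r' + d * b * var x ^ e * h" by (simp add: r'_def algebra_simps)
        then have "h dvd (d * c) * r" using d by (metis dvd_add dvd_triv_right)
        then show ?thesis using d cb by (intro bexI[of _ "d * c"]) (auto intro: polys_mult)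
      qed
    qed
    have hW: "h \<in> polys ?W" using h JW by auto
    obtain c h' where h': "h = c * h'" "c \<in> polys V" "\<And>q. q \<in> polys V \<Longrightarrow> irred q \<Longrightarrow> \<not> q dvd h'"
      using ex_primitive_part[of h] h hW by metis
    have h'W: "h' \<in> polys ?W" using polys_factor2[of c h'] h' hW h by auto
    have h'dvd: "h' dvd r" if r: "r \<in> J" for r
    proof -
      obtain d where d: "d \<in> polys V" "d \<noteq> 0" "h dvd d * r" using div r by blast
      then have "h' dvd d * r" using h' by (meson dvd_mult_right)
      then show ?thesis using primitive_dvd_cancel[OF h'W h'(3) d(1,2)] r JW by blast
    qed
    obtain k where k: "p = h' * k" using h'dvd[OF pJ] by blast
    have "\<And>a b. p = a * b \<Longrightarrow> tot_deg a = 0 \<or> tot_deg b = 0" using p(2) by (simp add: irred_def)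
    from this[OF k] show "p dvd f \<or> p dvd g"
    proof
      assume 1: "tot_deg h' = 0"
      have "h' \<noteq> 0" using h h' by auto
      \<comment> \<open>Now \<open>h\<close> is free of \<open>x\<close>. Since
        \<open>h = u * p + v * f\<close>, the prime candidate \<open>p\<close> divides
        \<open>h * g\<close>, and \<open>h\<close> cancels because \<open>p\<close> is
        primitive.\<close>
      then have hV: "h \<in> polys V" using h' tot_deg_0_const[OF 1] by (auto intro!: polys_mult)
      obtain u v where uv: "h = u * p + v * f" using h unfolding J_def by blast
      have "h * g = p * (u * g) + v * (f * g)" by (simp add: uv algebra_simps)
      then have "p dvd h * g" using fg(3) by simp
      then have "p dvd g" using primitive_dvd_cancel[OF p(1) prim hV] h fg by blast
      then show ?thesis ..
    next
      assume 2: "tot_deg k = 0"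
      have "k \<noteq> 0" using k p0 by auto
      then have "k dvd 1" using 2 tot_deg_0_dvd_1 by blast
      then have "p dvd h'" using k by (simp add: mult_unit_dvd_iff)
      then show ?thesis using h'dvd[OF fJ] dvd_trans by blast
    qed
  qed
qed

end

theorem irred_prime_on:
  assumes "finite V" "p \<in> polys V" "irred p"
  shows "prime_on V p"
  using assms
proof (induction V arbitrary: p)
  case empty
  have "kys p \<subseteq> {0}" using empty by (auto simp: polys_def)
  then have "homog 0 p" by (auto simp: homog_def)
  then have "tot_deg p = 0" using homog_0_const tot_deg_const by metis
  then show ?case using empty by (simp add: irred_def)
next
  case (insert x V)
  then show ?case using irred_prime_on_step[of x V p] by blast
qed

section \<open>Koszul homology and the length of regular sequences\<close>

inductive_set gen_ideal :: "nat set \<Rightarrow> 'k::field polyn set \<Rightarrow> 'k polyn set" for W G where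
  gen_ideal_0 [simp]: "0 \<in> gen_ideal W G"
| gen_ideal_step: "p \<in> gen_ideal W G \<Longrightarrow> a \<in> polys W \<Longrightarrow> g \<in> G \<Longrightarrow> p + a * g \<in> gen_ideal W G"

lemma gen_ideal_add: "p \<in> gen_ideal W G \<Longrightarrow> q \<in> gen_ideal W G \<Longrightarrow> p + q \<in> gen_ideal W G"
proof (induction p rule: gen_ideal.induct)
  case (gen_ideal_step p a g)
  then have "(p + q) + a * g \<in> gen_ideal W G" by (intro gen_ideal.gen_ideal_step)
  then show ?case by (simp add: add_ac)
qed simp

lemma gen_ideal_mult: "p \<in> gen_ideal W G \<Longrightarrow> a \<in> polys W \<Longrightarrow> a * p \<in> gen_ideal W G"
proof (induction p rule: gen_ideal.induct)
  case (gen_ideal_step p b g)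
  then have "a * p + (a * b) * g \<in> gen_ideal W G"
    by (intro gen_ideal.gen_ideal_step polys_mult) auto
  then show ?case by (simp add: algebra_simps)
qed simp

lemma gen_ideal_mult2: "p \<in> gen_ideal W G \<Longrightarrow> a \<in> polys W \<Longrightarrow> p * a \<in> gen_ideal W G"
  using gen_ideal_mult[of p W G a] by (simp add: mult.commute)

lemma gen_ideal_uminus: "p \<in> gen_ideal W G \<Longrightarrow> - p \<in> gen_ideal W G"
  using gen_ideal_mult[of p W G "- 1"] polys_uminus[OF polys_1, of W] by simp

lemma gen_ideal_diff: "p \<in> gen_ideal W G \<Longrightarrow> q \<in> gen_ideal W G \<Longrightarrow> p - q \<in> gen_ideal W G"
  using gen_ideal_add[OF _ gen_ideal_uminus, of p W G q] by simp

lemma gen_ideal_base: "g \<in> G \<Longrightarrow> g \<in> gen_ideal W G"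
  using gen_ideal_step[of 0 W G 1 g] by simp

lemma gen_ideal_sum: "(\<And>i. i \<in> S \<Longrightarrow> f i \<in> gen_ideal W G) \<Longrightarrow> sum f S \<in> gen_ideal W G"
  by (induction S rule: infinite_finite_induct) (auto intro: gen_ideal_add)

lemma gen_ideal_polys: "G \<subseteq> polys W \<Longrightarrow> gen_ideal W G \<subseteq> polys W"
proof
  fix p assume "G \<subseteq> polys W" "p \<in> gen_ideal W G"
  from this(2,1) show "p \<in> polys W" by (induction p rule: gen_ideal.induct) (auto intro!:
    polys_intros)
qed

definition is_ideal :: "nat set \<Rightarrow> 'k::field polyn set \<Rightarrow> bool" where
  "is_ideal W J \<longleftrightarrow> J \<subseteq> polys W \<and> 0 \<in> J \<and> (\<forall>p\<in>J. \<forall>q\<in>J. p + q \<in> J) \<and> (\<forall>a\<in>polys W. \<forall>p\<in>J. a * p \<in> J)"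

lemma is_ideal_gen_ideal: "G \<subseteq> polys W \<Longrightarrow> is_ideal W (gen_ideal W G)"
  using gen_ideal_polys by (auto simp: is_ideal_def gen_ideal_add gen_ideal_mult)

lemma gen_ideal_least: "is_ideal W J \<Longrightarrow> G \<subseteq> J \<Longrightarrow> gen_ideal W G \<subseteq> J"
proof
  fix p assume "is_ideal W J" "G \<subseteq> J" "p \<in> gen_ideal W G"
  from this(3,1,2) show "p \<in> J" by (induction p rule: gen_ideal.induct) (auto simp: is_ideal_def)
qed

lemma gen_ideal_is_ideal: "is_ideal W J \<Longrightarrow> gen_ideal W J = J"
  using gen_ideal_least[of W J J] gen_ideal_base[of _ J W] by auto

lemma gen_ideal_subset: "(\<And>g. g \<in> G \<Longrightarrow> g \<in> gen_ideal W H) \<Longrightarrow> gen_ideal W G \<subseteq> gen_ideal W H"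
proof
  fix p assume *: "\<And>g. g \<in> G \<Longrightarrow> g \<in> gen_ideal W H" and "p \<in> gen_ideal W G"
  from this(2) show "p \<in> gen_ideal W H" by (induction p rule: gen_ideal.induct) (auto intro:
    gen_ideal_add gen_ideal_mult *)
qed

lemma gen_ideal_mono: "G \<subseteq> H \<Longrightarrow> gen_ideal W G \<subseteq> gen_ideal W H"
  by (rule gen_ideal_subset) (auto intro: gen_ideal_base)

lemma gen_ideal_mono_vars: "V \<subseteq> W \<Longrightarrow> gen_ideal V G \<subseteq> gen_ideal W G"
proof
  fix p assume VW: "V \<subseteq> W" and "p \<in> gen_ideal V G"
  from this(2) show "p \<in> gen_ideal W G"
    by (induction p rule: gen_ideal.induct) (use polys_mono[OF VW] in \<open>auto intro!:
      gen_ideal.gen_ideal_step\<close>)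
qed

lemma gen_ideal_Un: "p \<in> gen_ideal W (G \<union> H) \<longleftrightarrow> (\<exists>a\<in>gen_ideal W G. \<exists>b\<in>gen_ideal W H. p = a + b)"
proof
  assume "p \<in> gen_ideal W (G \<union> H)"
  then show "\<exists>a\<in>gen_ideal W G. \<exists>b\<in>gen_ideal W H. p = a + b"
  proof (induction p rule: gen_ideal.induct)
    case gen_ideal_0
    show ?case by (intro bexI[of _ 0]) auto
  next
    case (gen_ideal_step p c g)
    then obtain a b where ab: "a \<in> gen_ideal W G" "b \<in> gen_ideal W H" "p = a + b" by blast
    show ?case
    proof (cases "g \<in> G")
      case True
      then show ?thesis using ab gen_ideal_step
        by (intro bexI[of _ "a + c * g"] bexI[of _ b]) (auto simp: add_ac intro:
          gen_ideal.gen_ideal_step)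
    next
      case False
      then show ?thesis using ab gen_ideal_step
        by (intro bexI[of _ a] bexI[of _ "b
          + c * g"]) (auto simp: add_ac intro: gen_ideal.gen_ideal_step)
    qed
  qed
next
  assume "\<exists>a\<in>gen_ideal W G. \<exists>b\<in>gen_ideal W H. p = a + b"
  then show "p \<in> gen_ideal W (G \<union> H)"
    using gen_ideal_mono[of G "G \<union> H" W] gen_ideal_mono[of H "G \<union> H" W]
      by (auto intro!: gen_ideal_add)
qed

lemma gen_ideal_empty [simp]: "gen_ideal W {} = {0}"
proof -
  have "p = 0" if "p \<in> gen_ideal W {}" for p :: "'a polyn" using that
    by (induction p rule: gen_ideal.induct) auto
  then show ?thesis by auto
qed

lemma gen_ideal_singleton: "gen_ideal W {g} = {a * g | a. a \<in> polys W}"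
proof -
  have "\<exists>a. p = a * g \<and> a \<in> polys W" if "p \<in> gen_ideal W {g}" for p
    using that
  proof (induction p rule: gen_ideal.induct)
    case gen_ideal_0
    show ?case by (intro exI[of _ 0]) auto
  next
    case (gen_ideal_step p b h)
    then obtain a where "p = a * g" "a \<in> polys W" by blast
    then show ?case using gen_ideal_step by (intro exI[of _
      "a + b"]) (auto simp: algebra_simps intro: polys_add)
  qed
  then show ?thesis by (auto intro: gen_ideal_mult gen_ideal_base)
qed

lemma gen_ideal_insert: "p \<in> gen_ideal W (insert l G) \<longleftrightarrow> (\<exists>a\<in>polys W. \<exists>r\<in>gen_ideal W G. p
  = r + a * l)"
  using gen_ideal_Un[of p W G "{l}"] by (auto simp: gen_ideal_singleton)

lemma gen_ideal_image_mult: "gen_ideal W ((*) f ` G) = (*) f ` gen_ideal W G"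
proof -
  have "p \<in> (*) f ` gen_ideal W G" if "p \<in> gen_ideal W ((*) f ` G)" for p
    using that
  proof (induction p rule: gen_ideal.induct)
    case gen_ideal_0
    show ?case by (intro image_eqI[of _ _ 0]) auto
  next
    case (gen_ideal_step p a h)
    then obtain q g where "p = f * q" "q \<in> gen_ideal W G" "h = f * g" "g \<in> G" by auto
    then show ?case using gen_ideal_step
      by (intro image_eqI[of _ _ "q + a * g"]) (auto simp: algebra_simps intro:
        gen_ideal.gen_ideal_step)
  qed
  moreover have "f * p \<in> gen_ideal W ((*) f ` G)" if "p \<in> gen_ideal W G" for p
    using that
  proof (induction p rule: gen_ideal.induct)
    case (gen_ideal_step p a g)
    then have "f * p + a * (f * g) \<in> gen_ideal W ((*) f ` G)"
      by (intro gen_ideal.gen_ideal_step) auto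
    then show ?case by (simp add: algebra_simps)
  qed simp
  ultimately show ?thesis by auto
qed

text \<open>Extension of an ideal to one more variable is coefficientwise, because
  \<open>polys W\<close> is free over \<open>polys (W - {j})\<close> on the powers of
  \<open>var j\<close>.\<close>

lemma gen_ideal_iff_coeff_as_univ:
  assumes G: "G \<subseteq> polys (W - {j})" and j: "j \<in> W" and p: "p \<in> polys W"
  shows "p \<in> gen_ideal W G \<longleftrightarrow> (\<forall>i. coeff (as_univ j p) i \<in> gen_ideal (W - {j}) G)"
proof
  assume "p \<in> gen_ideal W G"
  then show "\<forall>i. coeff (as_univ j p) i \<in> gen_ideal (W - {j}) G"
  proof (induction p rule: gen_ideal.induct)
    case (gen_ideal_step p a g)
    have "as_univ j g = [:g:]" using gen_ideal_step G by (intro as_univ_const[of _ "W - {j}"]) auto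
    then show ?case
      using gen_ideal_step coeff_as_univ_polys[of a W j]
        by (auto intro!: gen_ideal.gen_ideal_step simp: mult.commute[of g])
  qed simp
next
  assume *: "\<forall>i. coeff (as_univ j p) i \<in> gen_ideal (W - {j}) G"
  have "p = (\<Sum>i\<le>degree (as_univ j p). coeff (as_univ j p) i * var j ^ i)"
    using poly_as_univ[of j p] by (simp add: poly_altdef)
  also have "\<dots> \<in> gen_ideal W G"
    using * gen_ideal_mono_vars[of "W - {j}" W G] j
      by (intro gen_ideal_sum gen_ideal_mult2) (auto intro: polys_power)
  finally show "p \<in> gen_ideal W G" .
qed

text \<open>The coefficient of \<open>var j\<close> in the linear form is a unit. Comparing
  coefficients of the product from the top down puts each coefficient of \<open>p\<close> into the
  ideal generated in the smaller ring.\<close>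

lemma linear_form_regular:
  assumes G: "G \<subseteq> polys (W - {j})" and j: "j \<in> W" and p: "p \<in> polys W"
    and c: "c \<noteq> 0" and r: "r \<in> polys (W - {j})" and lp: "(const c * var j + r) * p \<in> gen_ideal W G"
  shows "p \<in> gen_ideal W G"
proof -
  let ?P = "as_univ j p"
  have "as_univ j r = [:r:]" using r by (rule as_univ_const) simp
  then have as_univ: "as_univ j ((const c * var j + r) * p)
    = pCons 0 (smult (const c) ?P) + smult r ?P"
    by (simp add: algebra_simps)
  have l: "(const c * var j + r) * p \<in> polys W"
    using r polys_mono[of "W - {j}" W] p j by (auto intro!: polys_intros)
  have ci: "const c * coeff ?P i + r * coeff ?P (Suc i) \<in> gen_ideal (W - {j}) G" for i
    using lp gen_ideal_iff_coeff_as_univ[OF G j l] unfolding as_univ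
      by (auto dest!: spec[of _ "Suc i"])
  have "coeff ?P (Suc (degree ?P) - m) \<in> gen_ideal (W - {j}) G" for m
  proof (induction m)
    case (Suc m)
    show ?case
    proof (cases "m < Suc (degree ?P)")
      case True
      define i where "i = Suc (degree ?P) - Suc m"
      have i: "Suc (degree ?P) - m = Suc i" using True by (simp add: i_def)
      have "const c * coeff ?P i \<in> gen_ideal (W - {j}) G"
        using gen_ideal_diff[OF ci[of i] gen_ideal_mult[OF Suc[unfolded i] r]] by simp
      then have "const (inverse c) * (const c * coeff ?P i) \<in> gen_ideal (W - {j}) G"
        by (rule gen_ideal_mult) simp
      moreover have "const (inverse c) * const c = 1"
        using const_inverse[OF c] by (simp add: mult.commute)
      ultimately show ?thesis unfolding i_def by (metis mult.assoc mult_1)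
    qed (use Suc in \<open>simp add: not_less\<close>)
  qed (simp add: coeff_eq_0)
  from this[of "Suc (degree ?P) - i" for i] have "coeff ?P i \<in> gen_ideal (W - {j}) G" if
    "i \<le> degree ?P" for i
    using that by (metis diff_diff_cancel le_SucI)
  then have "coeff ?P i \<in> gen_ideal (W - {j}) G" for i
    by (cases "i \<le> degree ?P") (auto simp: coeff_eq_0)
  then show ?thesis using gen_ideal_iff_coeff_as_univ[OF G j p] by blast
qed

section \<open>The Koszul complex of the variables\<close>

text \<open>Koszul chains on the variables \<open>x\<^sub>i\<close>, \<open>i \<in> W\<close>: the coefficient of \<open>e\<^sub>S\<close> is the value at
  the set \<open>S \<subseteq> W\<close>, and values at other sets are junk. The sign is that of \<open>e\<^sub>i \<and> e\<^sub>T\<close>.\<close>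

definition koszul_sign :: "nat \<Rightarrow> nat set \<Rightarrow> 'k::field polyn" where
  "koszul_sign i T = (-1) ^ card {j\<in>T. j < i}"

definition boundary :: "nat set \<Rightarrow> (nat set \<Rightarrow> 'k::field polyn) \<Rightarrow> nat set \<Rightarrow> 'k polyn" where
  "boundary W c T = (\<Sum>i\<in>W - T. koszul_sign i T * var i * c (insert i T))"

text \<open>Exterior multiplication by \<open>e\<^sub>j\<close> from the left, after
  \<open>D\<close> has been applied to the coefficients.\<close>

definition homotopy_op :: "nat \<Rightarrow> ('k::field polyn \<Rightarrow> 'k polyn) \<Rightarrow> (nat set \<Rightarrow> 'k polyn) \<Rightarrow> nat set \<Rightarrow>
  'k polyn" where
  "homotopy_op j D c S = (if j \<in> S then koszul_sign j (S - {j}) * D (c (S - {j})) else 0)"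

lemma koszul_sign_sq [simp]: "koszul_sign i T * koszul_sign i T = 1"
  by (simp add: koszul_sign_def flip: power_mult_distrib)

lemma koszul_sign_polys [simp]: "koszul_sign i T \<in> polys W"
  by (cases "even (card {j\<in>T. j < i})") (simp_all add: koszul_sign_def polys_uminus)

lemma koszul_sign_insert:
  assumes "finite T" "j \<notin> T"
  shows "koszul_sign i (insert j T) = (if j < i then - koszul_sign i T else koszul_sign i T)"
proof -
  have "{k \<in> insert j T. k < i} = (if j < i then insert j {k \<in> T. k < i} else {k \<in> T. k < i})"
    by auto
  then show ?thesis using assms by (simp add: koszul_sign_def)
qed

lemma koszul_sign_swap:
  assumes "finite T" "i \<notin> T" "j \<notin> T" "i \<noteq> j"
  shows "koszul_sign i (insert j T) * koszul_sign j (insert i T)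
    = - (koszul_sign i T * koszul_sign j T)"
  using assms by (simp add: koszul_sign_insert)

text \<open>One homotopy formula serves twice: with multiplication by \<open>a\<^sub>j\<close> it shows that \<open>\<Sum> a\<^sub>j x\<^sub>j\<close>
  annihilates homology, and with division by \<open>x\<^sub>j\<close> it shows that the complex of the polynomial
  ring is acyclic.\<close>

locale derivation_like =
  fixes D :: "'k::field polyn \<Rightarrow> 'k polyn" and j :: nat
  assumes D_add: "D (p + q) = D p + D q"
    and D_var: "i \<noteq> j \<Longrightarrow> D (var i * p) = var i * D p"
begin

lemma D_0 [simp]: "D 0 = 0"
  using D_add[of 0 0] by (simp only: add_0_right) (metis add_cancel_right_right)

lemma D_uminus: "D (- p) = - D p"
  using D_add[of p "- p"] by (simp add: eq_neg_iff_add_eq_0 add.commute)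

lemma D_koszul_sign: "D (koszul_sign i T * p) = koszul_sign i T * D p"
  by (cases "even (card {j\<in>T. j < i})") (simp_all add: koszul_sign_def D_uminus)

lemma D_sum: "D (sum f S) = (\<Sum>i\<in>S. D (f i))"
  by (induction S rule: infinite_finite_induct) (simp_all add: D_add)

text \<open>Terms with \<open>i \<noteq> j\<close> cancel by \<open>koszul_sign_swap\<close>, since
  \<open>D\<close> commutes with \<open>var i\<close>; only \<open>i = j\<close> survives. Whether
  \<open>j\<close> lies in \<open>T\<close> decides if \<open>D\<close> acts after or before
  multiplication by \<open>var j\<close>. For multiplication by \<open>a\<^sub>j\<close> this makes
  no difference; for division by \<open>x\<^sub>j\<close> only the first order gives the
  identity.\<close>

lemma homotopy:
  assumes W: "finite W" "j \<in> W" "T \<subseteq> W"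
  shows "boundary W (homotopy_op j D c) T + homotopy_op j D (boundary W c) T
    = (if j \<in> T then D (var j * c T) else var j * D (c T))"
proof (cases "j \<in> T")
  case False
  have "boundary W (homotopy_op j D c) T = (\<Sum>i\<in>W - T. if i = j then var j * D (c T) else 0)"
    unfolding boundary_def
    by (intro sum.cong refl) (use False in \<open>auto simp: homotopy_op_def mult_ac simp flip:
      mult.assoc\<close>)
  then show ?thesis using False W by (simp add: homotopy_op_def sum.delta)
next
  case True
  define T' where "T' = T - {j}"
  have T: "T = insert j T'" "j \<notin> T'" "finite T'" using True W
    by (auto simp: T'_def intro: finite_subset)
  have WT: "W - T' = insert j (W - T)" using T W by auto
  let ?t = "\<lambda>i. koszul_sign i T' * koszul_sign j T' * (var i * D (c (insert i T')))"
  have 1: "boundary W (homotopy_op j D c) T = - (\<Sum>i\<in>W - T. ?t i)"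
    unfolding boundary_def sum_negf[symmetric]
  proof (intro sum.cong refl)
    fix i assume i: "i \<in> W - T"
    have "insert i T - {j} = insert i T'" using T i by auto
    then have "koszul_sign i T * var i * homotopy_op j D c (insert i T)
      = (koszul_sign i (insert j T') * koszul_sign j (insert i T')) * (var i * D (c (insert i T')))"
      using T i by (simp add: homotopy_op_def mult_ac)
    also have "\<dots> = - ?t i" using T i by (subst koszul_sign_swap) auto
    finally show "koszul_sign i T * var i * homotopy_op j D c (insert i T) = - ?t i" .
  qed
  have "D (boundary W c T') = D (koszul_sign j T' * var j * c T)
    + (\<Sum>i\<in>W - T. D (koszul_sign i T' * var i * c (insert i T')))"
    unfolding boundary_def D_sum WT using W T by (subst sum.insert) auto
  also have "\<dots> = koszul_sign j T' * D (var j * c T)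
    + (\<Sum>i\<in>W - T. koszul_sign i T' * (var i * D (c (insert i T'))))"
    using T by (auto simp: mult.assoc D_koszul_sign D_var intro!: sum.cong)
  finally have "homotopy_op j D (boundary W c) T = D (var j * c T) + (\<Sum>i\<in>W - T. ?t i)"
    using T by (simp add: homotopy_op_def T'_def[symmetric] distrib_left sum_distrib_left mult_ac
      flip: mult.assoc[of "koszul_sign j T'" "koszul_sign j T'"])
  then show ?thesis using 1 True by simp
qed

end

lemma boundary_add: "boundary W (\<lambda>S. c S + d S) T = boundary W c T + boundary W d T"
  by (simp add: boundary_def distrib_left sum.distrib)

lemma boundary_diff: "boundary W (\<lambda>S. c S - d S) T = boundary W c T - boundary W d T"
  by (simp add: boundary_def right_diff_distrib sum_subtractf)

lemma boundary_mult: "boundary W (\<lambda>S. f * c S) T = f * boundary W c T"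
  by (simp add: boundary_def sum_distrib_left mult_ac)

lemma boundary_sum: "boundary W (\<lambda>S. \<Sum>k\<in>K. c k S) T = (\<Sum>k\<in>K. boundary W (c k) T)"
  by (induction K rule: infinite_finite_induct) (simp_all add: boundary_add, simp_all add:
    boundary_def)

lemma boundary_cong: "T \<subseteq> W \<Longrightarrow> (\<And>S. S \<subseteq> W \<Longrightarrow> c S = d S) \<Longrightarrow> boundary W c T = boundary W d T"
  unfolding boundary_def by (intro sum.cong refl) auto

lemma boundary_polys: "T \<subseteq> W \<Longrightarrow> (\<And>S. S \<subseteq> W \<Longrightarrow> c S \<in> polys W) \<Longrightarrow> boundary W c T \<in> polys W"
  unfolding boundary_def by (auto intro!: polys_intros)

lemma boundary_gen_ideal: "T \<subseteq> W \<Longrightarrow> (\<And>S. S \<subseteq> W \<Longrightarrow> c S \<in> gen_ideal W G)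
  \<Longrightarrow> boundary W c T \<in> gen_ideal W G"
  unfolding boundary_def by (auto intro!: gen_ideal_sum gen_ideal_mult polys_intros)

text \<open>The summands are antisymmetric in the ordered pair of removed indices. In characteristic
  2 it would not suffice that the sum is its own negative, so it is split into the pairs with
  \<open>i < k\<close> and their swaps.\<close>

lemma boundary_boundary:
  assumes W: "finite W" "T \<subseteq> W"
  shows "boundary W (boundary W c) T = 0"
proof -
  have T: "finite T" using W finite_subset by blast
  define g where "g = (\<lambda>(i, k). koszul_sign i T * koszul_sign k (insert i T) * (var i * var k * c
    (insert k (insert i T))))"
  let ?P = "SIGMA i:W - T. W - insert i T"
  let ?A = "{x\<in>?P. fst x < snd x}"
  have anti: "g (k, i) = - g (i, k)" if "(i, k) \<in> ?P" for i k
  proof -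
    have ik: "i \<notin> T" "k \<notin> T" "i \<noteq> k" using that by auto
    have com: "insert k (insert i T) = insert i (insert k T)" by auto
    have sw: "koszul_sign k T * koszul_sign i (insert k T)
      = - (koszul_sign i T * koszul_sign k (insert i T) :: 'a polyn)"
      using T ik by (simp add: koszul_sign_insert)
    show ?thesis unfolding g_def split com sw by (simp add: mult_ac)
  qed
  have "boundary W (boundary W c) T = (\<Sum>i\<in>W - T. \<Sum>k\<in>W - insert i T. g (i, k))"
    by (simp add: boundary_def g_def sum_distrib_left mult_ac)
  also have "\<dots> = sum g ?P"
    using W by (subst sum.Sigma) auto
  also have "\<dots> = sum g (?A \<union> prod.swap ` ?A)"
  proof (rule arg_cong[of _ _ "sum g"], intro equalityI subsetI)
    fix x assume x: "x \<in> ?P"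
    obtain i k where ik: "x = (i, k)" by (cases x)
    show "x \<in> ?A \<union> prod.swap ` ?A"
    proof (cases "i < k")
      case False
      then have "(k, i) \<in> ?A" using x ik by auto
      then have "prod.swap (k, i) \<in> prod.swap ` ?A" by (rule imageI)
      then show ?thesis by (simp add: ik)
    qed (use x ik in simp)
  qed auto
  also have "\<dots> = sum g ?A + sum g (prod.swap ` ?A)"
  proof (rule sum.union_disjoint)
    have "finite ?P" using W by simp
    then show fA: "finite ?A" by (rule rev_finite_subset) blast
    then show "finite (prod.swap ` ?A)" by (rule finite_imageI)
    show "?A \<inter> prod.swap ` ?A = {}" by force
  qed
  also have "sum g (prod.swap ` ?A) = (\<Sum>x\<in>?A. - g x)"
    by (subst sum.reindex) (auto intro!: sum.cong anti)
  finally show ?thesis by (simp add: sum_negf)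
qed

text \<open>Division by \<open>var j\<close> made total by dropping the part free of
  \<open>var j\<close>. In this form it is additive and can serve as \<open>D\<close>.\<close>

definition var_quot :: "nat \<Rightarrow> 'k::field polyn \<Rightarrow> 'k polyn" where
  "var_quot j p = poly (poly_shift 1 (as_univ j p)) (var j)"

lemma poly_shift_add: "poly_shift n (p + q) = poly_shift n p + poly_shift n q"
  and poly_shift_smult: "poly_shift n (smult c p) = smult c (poly_shift n p)"
  by (rule poly_eqI, simp add: coeff_poly_shift)+

lemma var_quot_polys: "p \<in> polys W \<Longrightarrow> j \<in> W \<Longrightarrow> var_quot j p \<in> polys W"
  unfolding var_quot_def poly_altdef
  using coeff_as_univ_polys[of p W j] polys_mono[of "W - {j}" W]
  by (auto simp: coeff_poly_shift intro!: polys_intros)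

interpretation var_quot: derivation_like "var_quot j" j
  by unfold_locales (simp_all add: var_quot_def poly_shift_add poly_shift_smult)

lemma var_quot_var: "var_quot j (var j * p) = p"
proof -
  have "poly_shift 1 (pCons 0 (as_univ j p)) = as_univ j p"
    by (rule poly_eqI) (simp add: coeff_poly_shift)
  then show ?thesis by (simp add: var_quot_def)
qed

text \<open>The homotopy for \<open>var_quot j\<close> reproduces a cycle at the sets containing
  \<open>j\<close>. Applied to the current defect \<open>y'\<close>, it repairs these sets and
  changes nothing at the sets meeting \<open>E\<close>, where the defect is already 0. Running
  through all variables reaches every nonempty set.\<close>

lemma koszul_acyclic:
  assumes W: "finite W" and y: "\<And>S. S \<subseteq> W \<Longrightarrow> y S \<in> polys W"
    and cycle: "\<And>T. T \<subseteq> W \<Longrightarrow> boundary W y T = 0"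
  shows "\<exists>w. (\<forall>S\<subseteq>W. w S \<in> polys W) \<and> (\<forall>S\<subseteq>W. S \<noteq> {} \<longrightarrow> y S = boundary W w S)"
proof -
  have "\<exists>w. (\<forall>S\<subseteq>W. w S \<in> polys W) \<and> (\<forall>S\<subseteq>W. S \<inter> E \<noteq> {} \<longrightarrow> y S = boundary W w S)"
    if "finite E" "E \<subseteq> W" for E
    using that
  proof (induction E)
    case empty
    show ?case by (intro exI[of _ "\<lambda>_. 0"]) auto
  next
    case (insert j E)
    then obtain w where w: "\<And>S. S \<subseteq> W \<Longrightarrow> w S \<in> polys W"
      and yw: "\<And>S. S \<subseteq> W \<Longrightarrow> S \<inter> E \<noteq> {} \<Longrightarrow> y S = boundary W w S" by auto
    define y' where "y' S = y S - boundary W w S" for S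
    define w' where "w' S = w S + homotopy_op j (var_quot j) y' S" for S
    have y'PV: "y' S \<in> polys W" if "S \<subseteq> W" for S
      unfolding y'_def using that y w by (intro polys_intros boundary_polys) auto
    have y'0: "boundary W y' T = 0" if "T \<subseteq> W" for T
    proof -
      have "boundary W y' T = boundary W y T - boundary W (boundary W w) T" unfolding y'_def
        by (rule boundary_diff)
      then show ?thesis using that cycle boundary_boundary W by simp
    qed
    have htp0: "homotopy_op j (var_quot j) (boundary W y') S = 0" if "S \<subseteq> W" for S
    proof -
      have "boundary W y' (S - {j}) = 0" using y'0[of "S - {j}"] that by blast
      then show ?thesis by (simp add: homotopy_op_def)
    qed
    have eq: "y S - boundary W w' S = (if j \<in> S then 0 else y' S - var j * var_quot j (y' S))" if
      "S \<subseteq> W" for S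
    proof -
      have "boundary W w' S = boundary W w S + boundary W (homotopy_op j (var_quot j) y') S"
        unfolding w'_def by (rule boundary_add)
      moreover have "boundary W (homotopy_op j (var_quot j) y') S
        = (if j \<in> S then y' S else var j * var_quot j (y' S))"
        using var_quot.homotopy[of W j S y'] htp0[OF that] W insert.prems that
          by (simp add: var_quot_var)
      ultimately show ?thesis by (simp add: y'_def)
    qed
    have "w' S \<in> polys W" if "S \<subseteq> W" for S
      unfolding w'_def homotopy_op_def using that w y'PV[of "S - {j}"] insert.prems
      by (auto intro!: polys_intros var_quot_polys)
    moreover have "y S = boundary W w' S" if "S \<subseteq> W" "S \<inter> insert j E \<noteq> {}" for S
    proof (cases "j \<in> S")
      case True
      then show ?thesis using eq[OF that(1)] by simp
    next
      case False
      then have "y' S = 0" using yw[of S] that by (auto simp: y'_def)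
      then show ?thesis using eq[OF that(1)] by (auto split: if_splits)
    qed
    ultimately show ?case by blast
  qed
  from this[of W] W show ?thesis by (auto simp: Int_absorb2)
qed

text \<open>The \<open>i\<close>-th Koszul homology of \<open>K[x\<^sub>j : j \<in> W]\<close> modulo the ideal generated by \<open>G\<close> does not
  vanish. The degree of the bounding chain \<open>u\<close> need not be prescribed.\<close>

definition koszul_nonzero :: "nat set \<Rightarrow> 'k::field polyn set \<Rightarrow> nat \<Rightarrow> bool" where
  "koszul_nonzero W G i \<longleftrightarrow> (\<exists>z. (\<forall>S\<subseteq>W. z S \<in> polys W \<and> (card S \<noteq> i \<longrightarrow> z S
    = 0) \<and> boundary W z S \<in> gen_ideal W G) \<and>
     \<not> (\<exists>u. (\<forall>S\<subseteq>W. u S \<in> polys W) \<and> (\<forall>S\<subseteq>W. z S - boundary W u S \<in> gen_ideal W G)))"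

lemma koszul_nonzero_le:
  assumes "finite W" "koszul_nonzero W G i"
  shows "i \<le> card W"
proof (rule ccontr)
  assume i: "\<not> i \<le> card W"
  obtain z where z: "\<And>S. S \<subseteq> W \<Longrightarrow> card S \<noteq> i \<Longrightarrow> z S = 0"
    and nb: "\<not> (\<exists>u. (\<forall>S\<subseteq>W. u S \<in> polys W) \<and> (\<forall>S\<subseteq>W. z S - boundary W u S \<in> gen_ideal W G))"
    using assms(2) unfolding koszul_nonzero_def by metis
  have "z S = 0" if "S \<subseteq> W" for S
    using z[OF that] i card_mono[OF assms(1) that] by auto
  then have "\<forall>S\<subseteq>W. z S - boundary W (\<lambda>_. 0) S \<in> gen_ideal W G" by (simp add: boundary_def)
  then show False using nb by (metis polys_0)
qed

text \<open>The class of \<open>1\<close> at the empty set survives: a boundary there is a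
  combination of the variables and vanishes at the origin.\<close>

lemma koszul_nonzero_zero: "koszul_nonzero W ({} :: 'k::field polyn set) 0"
  unfolding koszul_nonzero_def
proof (intro exI[of _ "\<lambda>S. if S = {} then 1 else 0"] conjI notI allI impI)
  assume "\<exists>u. (\<forall>S\<subseteq>W. u S \<in> polys W) \<and> (\<forall>S\<subseteq>W. (if S
    = {} then 1 else 0) - boundary W u S \<in> gen_ideal W ({} :: 'k polyn set))"
  then obtain u where "1 - boundary W u {} \<in> gen_ideal W ({} :: 'k polyn set)" by force
  then have "1 = (boundary W u {} :: 'k polyn)" by simp
  then have "peval const (\<lambda>_. 0) 1 = peval const (\<lambda>_. 0) (boundary W u {} :: 'k polyn)" by simp
  then show False by (simp add: boundary_def const_hom.peval_sum const_hom.peval_mult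
    const_hom.peval_var)
qed (auto simp: boundary_def)

text \<open>If \<open>z\<close> is a cycle modulo \<open>G\<close> that is not a boundary, then \<open>\<theta> z\<close> is the boundary of some
  \<open>w\<close> modulo \<open>G\<close>; this \<open>w\<close> is a cycle modulo \<open>\<theta>\<close>, and bounds only if \<open>z\<close> does.\<close>

lemma koszul_nonzero_regular:
  assumes W: "finite W" and K: "koszul_nonzero W G i" and a: "\<And>j. j \<in> W \<Longrightarrow> a j \<in> polys W"
    and th: "\<theta> = (\<Sum>j\<in>W. a j * var j)"
    and reg: "\<And>p. p \<in> polys W \<Longrightarrow> \<theta> * p \<in> gen_ideal W G \<Longrightarrow> p \<in> gen_ideal W G"
  shows "koszul_nonzero W (insert \<theta> G) (Suc i)"
proof -
  obtain z where z: "\<And>S. S \<subseteq> W \<Longrightarrow> z S \<in> polys W" "\<And>S. S \<subseteq> W \<Longrightarrow> card S \<noteq> i \<Longrightarrow> z S = 0"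
     "\<And>S. S \<subseteq> W \<Longrightarrow> boundary W z S \<in> gen_ideal W G"
    and nb: "\<not> (\<exists>u. (\<forall>S\<subseteq>W. u S \<in> polys W) \<and> (\<forall>S\<subseteq>W. z S - boundary W u S \<in> gen_ideal W G))"
    using K unfolding koszul_nonzero_def by metis
  \<comment> \<open>The exterior product of the 1-chain \<open>\<Sum> a\<^sub>j e\<^sub>j\<close>,
    whose boundary is \<open>\<theta>\<close>, with \<open>z\<close>.\<close>
  define w where "w S = (\<Sum>j\<in>W. homotopy_op j ((*) (a j)) z S)" for S
  have thW: "\<theta> \<in> polys W" unfolding th using a by (auto intro!: polys_intros)
  have wPV: "w S \<in> polys W" if "S \<subseteq> W" for S
  proof -
    have "z (S - {j}) \<in> polys W" for j using z(1)[of "S - {j}"] that by blast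
    then show ?thesis unfolding w_def homotopy_op_def using a by (auto intro!: polys_intros)
  qed
  have dl: "derivation_like ((*) (a j)) j" for j
    by unfold_locales (simp_all add: algebra_simps)
  have bdw: "\<theta> * z T - boundary W w T \<in> gen_ideal W G" if T: "T \<subseteq> W" for T
  proof -
    have "boundary W w T + (\<Sum>j\<in>W. homotopy_op j ((*) (a j)) (boundary W z) T)
      = (\<Sum>j\<in>W. a j * var j * z T)"
      unfolding w_def boundary_sum sum.distrib[symmetric]
      by (intro sum.cong refl) (use derivation_like.homotopy[OF dl W _ T] in \<open>simp add: mult_ac\<close>)
    then have "\<theta> * z T - boundary W w T = (\<Sum>j\<in>W. homotopy_op j ((*) (a j)) (boundary W z) T)"
      by (simp add: th sum_distrib_right eq_diff_eq diff_eq_eq add.commute)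
    also have "\<dots> \<in> gen_ideal W G"
    proof -
      have "boundary W z (T - {j}) \<in> gen_ideal W G" for j using z(3)[of "T - {j}"] T by blast
      then show ?thesis unfolding homotopy_op_def using a
        by (auto intro!: gen_ideal_sum gen_ideal_mult)
    qed
    finally show ?thesis .
  qed
  have sub: "gen_ideal W G \<subseteq> gen_ideal W (insert \<theta> G)" by (rule gen_ideal_mono) auto
  have thz: "z T * \<theta> \<in> gen_ideal W (insert \<theta> G)" if "T \<subseteq> W" for T
    by (rule gen_ideal_mult[OF gen_ideal_base z(1)[OF that]]) simp
  show ?thesis
    unfolding koszul_nonzero_def
  proof (intro exI[of _ w] conjI allI impI notI)
    fix S assume S: "S \<subseteq> W"
    show "w S \<in> polys W" using wPV S .
    have "finite S" using S W finite_subset by blast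
    have "homotopy_op j ((*) (a j)) z S = 0" if cS: "card S \<noteq> Suc i" for j
    proof (cases "j \<in> S")
      case True
      then have "Suc (card (S - {j})) = card S" using \<open>finite S\<close> by (intro card_Suc_Diff1)
      then have "z (S - {j}) = 0" using z(2)[of "S - {j}"] S cS by auto
      then show ?thesis by (simp add: homotopy_op_def)
    qed (simp add: homotopy_op_def)
    then show "card S \<noteq> Suc i \<Longrightarrow> w S = 0" by (simp add: w_def)
    have "z S * \<theta> - (\<theta> * z S - boundary W w S) \<in> gen_ideal W (insert \<theta> G)"
      using thz[OF S] bdw[OF S] sub by (intro gen_ideal_diff[of "z S * \<theta>"]) auto
    then show "boundary W w S \<in> gen_ideal W (insert \<theta> G)" by (simp add: mult.commute)
  next
    assume "\<exists>u. (\<forall>S\<subseteq>W. u S \<in> polys W) \<and> (\<forall>S\<subseteq>W. w S - boundary W u S \<in> gen_ideal W (insert \<theta> G))"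
    then obtain u where u: "\<And>S. S \<subseteq> W \<Longrightarrow> u S \<in> polys W"
      "\<And>S. S \<subseteq> W \<Longrightarrow> w S - boundary W u S \<in> gen_ideal W (insert \<theta> G)" by blast
    then have "\<forall>S. \<exists>b r. S \<subseteq> W \<longrightarrow> b \<in> polys W \<and> r \<in> gen_ideal W G \<and> w S - boundary W u S = r + b * \<theta>"
      unfolding gen_ideal_insert by blast
    then obtain b r where br: "\<And>S. S \<subseteq> W \<Longrightarrow> b S \<in> polys W" "\<And>S. S \<subseteq> W \<Longrightarrow> r S \<in> gen_ideal W G"
      "\<And>S. S \<subseteq> W \<Longrightarrow> w S - boundary W u S = r S + b S * \<theta>" by metis
    \<comment> \<open>Taking boundaries in \<open>w = boundary u + r + \<theta> b\<close> kills the
      first term. Comparison with the boundary of \<open>w\<close>, and cancellation of the regular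
      \<open>\<theta>\<close>, shows that \<open>z\<close> is bounded by \<open>b\<close> modulo
      \<open>G\<close>.\<close>
    have "z T - boundary W b T \<in> gen_ideal W G" if T: "T \<subseteq> W" for T
    proof (rule reg)
      show "z T - boundary W b T \<in> polys W" using T z br by (intro polys_intros boundary_polys) auto
      have "boundary W w T = boundary W (\<lambda>S. boundary W u S + (r S + \<theta> * b S)) T"
      proof (rule boundary_cong[OF T])
        fix S assume "S \<subseteq> W"
        from br(3)[OF this] show "w S = boundary W u S + (r S + \<theta> * b S)"
          by (simp add: algebra_simps)
      qed
      also have "\<dots> = boundary W (boundary W u) T + (boundary W r T + \<theta> * boundary W b T)"
        by (simp only: boundary_add boundary_mult)
      finally have "boundary W w T = boundary W r T + \<theta> * boundary W b T"
        using boundary_boundary[OF W T] by simp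
      then have "\<theta> * (z T - boundary W b T) = (\<theta> * z T - boundary W w T) + boundary W r T"
        by (simp add: algebra_simps)
      also have "\<dots> \<in> gen_ideal W G" using bdw[OF T] br(2) T
        by (intro gen_ideal_add boundary_gen_ideal) auto
      finally show "\<theta> * (z T - boundary W b T) \<in> gen_ideal W G" .
    qed
    then show False using nb br(1) by blast
  qed
qed

text \<open>If \<open>f z\<close> bounds modulo the multiplied ideal, dividing by \<open>f\<close>
  gives a chain \<open>y\<close>, congruent to \<open>z\<close> modulo \<open>G\<close>, which is a
  cycle over the polynomial ring itself. Acyclicity turns \<open>y\<close> into a boundary away from
  the empty set, and so \<open>z\<close> would bound modulo \<open>G\<close>.\<close>

lemma koszul_nonzero_mult:
  assumes W: "finite W" and K: "koszul_nonzero W G i" and i: "i \<ge> 1" and f: "f \<noteq> 0" "f \<in> polys W"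
    and G: "G \<subseteq> polys W"
  shows "koszul_nonzero W ((*) f ` G) i"
proof -
  obtain z where z: "\<And>S. S \<subseteq> W \<Longrightarrow> z S \<in> polys W" "\<And>S. S \<subseteq> W \<Longrightarrow> card S \<noteq> i \<Longrightarrow> z S = 0"
     "\<And>S. S \<subseteq> W \<Longrightarrow> boundary W z S \<in> gen_ideal W G"
    and nb: "\<not> (\<exists>u. (\<forall>S\<subseteq>W. u S \<in> polys W) \<and> (\<forall>S\<subseteq>W. z S - boundary W u S \<in> gen_ideal W G))"
    using K unfolding koszul_nonzero_def by metis
  show ?thesis
    unfolding koszul_nonzero_def gen_ideal_image_mult
  proof (intro exI[of _ "\<lambda>S. f * z S"] conjI allI impI notI)
    assume "\<exists>u. (\<forall>S\<subseteq>W. u S \<in> polys W) \<and> (\<forall>S\<subseteq>W. f * z S - boundary W u S \<in> (*) f ` gen_ideal W G)"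
    then obtain u where u: "\<And>S. S \<subseteq> W \<Longrightarrow> u S \<in> polys W"
      "\<And>S. S \<subseteq> W \<Longrightarrow> f * z S - boundary W u S \<in> (*) f ` gen_ideal W G" by blast
    then have "\<forall>S. \<exists>v. S \<subseteq> W \<longrightarrow> v \<in> gen_ideal W G \<and> f * z S - boundary W u S = f * v" by blast
    then obtain v where v: "\<And>S. S \<subseteq> W \<Longrightarrow> v S \<in> gen_ideal W G"
      "\<And>S. S \<subseteq> W \<Longrightarrow> f * z S - boundary W u S = f * v S" by metis
    define y where "y S = z S - v S" for S
    have bu: "boundary W u S = f * y S" if "S \<subseteq> W" for S
      using v(2)[OF that] by (simp add: y_def algebra_simps)
    have "f * boundary W y T = 0" if T: "T \<subseteq> W" for T
    proof -
      have "f * boundary W y T = boundary W (\<lambda>S. f * y S) T" by (rule boundary_mult[symmetric])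
      also have "\<dots> = boundary W (boundary W u) T" by (rule boundary_cong[OF T]) (simp add: bu)
      finally show ?thesis using boundary_boundary[OF W T] by simp
    qed
    then have cyc: "boundary W y T = 0" if "T \<subseteq> W" for T using f that by simp
    have "y S \<in> polys W" if "S \<subseteq> W" for S
      unfolding y_def using z(1) v(1) gen_ideal_polys[OF G] that by (intro polys_intros) auto
    then obtain w where w: "\<And>S. S \<subseteq> W \<Longrightarrow> w S \<in> polys W" "\<And>S. S \<subseteq> W \<Longrightarrow> S \<noteq> {} \<Longrightarrow> y S = boundary W w S"
      using koszul_acyclic[OF W _ cyc] by blast
    \<comment> \<open>Clearing the singletons makes the boundary vanish at the empty set, where
      \<open>z\<close> is 0 because \<open>i \<ge> 1\<close>. At a nonempty set the boundary only
      reads sets with at least two elements.\<close>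
    define w' where "w' S = (if card S = 1 then 0 else w S)" for S
    have "z S - boundary W w' S \<in> gen_ideal W G" if S: "S \<subseteq> W" for S
    proof (cases "S = {}")
      case True
      have "boundary W w' {} = 0" by (simp add: boundary_def w'_def)
      then show ?thesis using z(2)[of "{}"] i True by simp
    next
      case False
      have finS: "finite S" using S W finite_subset by blast
      have "boundary W w' S = boundary W w S"
        unfolding boundary_def w'_def using finS False by (intro sum.cong refl) auto
      then have "z S - boundary W w' S = v S" using w(2)[OF S False]
        by (simp add: y_def diff_eq_eq add.commute)
      then show ?thesis using v(1)[OF S] by simp
    qed
    moreover have "w' S \<in> polys W" if "S \<subseteq> W" for S using w(1) that by (simp add: w'_def)
    ultimately show False using nb by blast
  qed (use z f in \<open>auto simp: boundary_mult intro: polys_mult\<close>)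
qed

lemma const_term_0_decomp:
  assumes W: "finite W" and p: "p \<in> polys W" "lk p 0 = 0"
  shows "\<exists>a. (\<forall>j\<in>W. a j \<in> polys W) \<and> p = (\<Sum>j\<in>W. a j * var j)"
proof -
  define P where "P p \<longleftrightarrow> (\<exists>a. (\<forall>j\<in>W. a j \<in> polys W) \<and> p = const (lk p 0) + (\<Sum>j\<in>W. a j * var j))"
    for p :: "'a polyn"
  have "P p" using p(1)
  proof (induction p rule: polys_induct)
    case zero
    show ?case unfolding P_def by (intro exI[of _ "\<lambda>_. 0"]) auto
  next
    case (add u c q)
    then obtain a where a: "\<forall>j\<in>W. a j \<in> polys W" "q = const (lk q 0) + (\<Sum>j\<in>W. a j * var j)"
      unfolding P_def by blast
    show ?case
    proof (cases "u = 0")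
      case True
      have "sgl u c + q = const (lk (sgl u c + q) 0) + (\<Sum>j\<in>W. a j * var j)"
        using True arg_cong[OF a(2), of "\<lambda>q. sgl 0 c + q"]
        by (simp add: lookup_add const_def single_add add.assoc)
      then show ?thesis unfolding P_def using a(1) by blast
    next
      case False
      then obtain i where i: "i \<in> kys u" by (metis ex_in_conv keys_eq_empty)
      define v where "v = u - sgl i 1"
      have u: "u = v + sgl i 1"
        using i by (intro poly_mapping_eqI) (auto simp: v_def lookup_add lookup_minus
          lookup_single when_def in_keys_iff)
      have vW: "kys v \<subseteq> W"
        using add i by (auto simp: v_def in_keys_iff lookup_minus subset_iff)
      have iW: "i \<in> W" using add i by auto
      define a' where "a' = a(i := a i + sgl v c)"
      have "(\<Sum>j\<in>W. a' j * var j) = (\<Sum>j\<in>W. a j * var j + (if j = i then sgl v c * var i else 0))"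
        by (intro sum.cong) (auto simp: a'_def algebra_simps)
      also have "\<dots> = (\<Sum>j\<in>W. a j * var j) + sgl v c * var i"
        using W iW by (simp add: sum.distrib sum.delta)
      also have "sgl v c * var i = sgl u c" by (simp add: u var_def mpoly_def mult_single)
      finally have "sgl u c + q = const (lk (sgl u c + q) 0) + (\<Sum>j\<in>W. a' j * var j)"
        using a(2) False by (subst a(2)) (simp add: lookup_add lookup_single add_ac)
      moreover have "\<forall>j\<in>W. a' j \<in> polys W" using a(1) vW
        by (auto simp: a'_def intro!: polys_intros polys_single)
      ultimately show ?thesis unfolding P_def by blast
    qed
  qed
  then show ?thesis using p(2) by (auto simp: P_def)
qed

section \<open>Generators of critical ideals and the bound for regular sequences\<close>

text \<open>Generators \<open>f\<^sub>1 \<ell>\<^sub>1, f\<^sub>1 f\<^sub>2 \<ell>\<^sub>2, \<dots>, f\<^sub>1 \<cdots> f\<^sub>s\<close> of a critical ideal, where \<open>\<ell>\<^sub>i\<close> is a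
  linear form used to eliminate one variable from the later stages. The zero ideal, with \<open>s =
  0\<close>, is not included.\<close>

inductive critical_gens :: "nat set \<Rightarrow> 'k::field polyn set \<Rightarrow> nat \<Rightarrow> bool" where
  critical_gens_principal: "f \<noteq> 0 \<Longrightarrow> f \<in> polys V \<Longrightarrow> homog d f \<Longrightarrow> d \<ge> 1 \<Longrightarrow> critical_gens V {f} 1"
| critical_gens_step: "critical_gens (V - {j}) G s \<Longrightarrow> j \<in> V \<Longrightarrow> f \<noteq> 0 \<Longrightarrow> f \<in> polys V \<Longrightarrow> c \<noteq> 0
  \<Longrightarrow> r \<in> polys (V - {j}) \<Longrightarrow> homog 1 r
    \<Longrightarrow> critical_gens V ((*) f ` insert (const c * var j + r) G) (Suc s)"

lemma critical_gens_polys: "critical_gens V G s \<Longrightarrow> G \<subseteq> polys V"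
proof (induction rule: critical_gens.induct)
  case (critical_gens_step V j G s f c r)
  then show ?case using polys_mono[of "V - {j}" V] by (auto intro!: polys_intros)
qed auto

lemma homog_const_term: "homog d p \<Longrightarrow> d \<ge> 1 \<Longrightarrow> lk p 0 = 0"
  by (auto simp: homog_def in_keys_iff dest!: bspec[of _ _ 0])

text \<open>The larger \<open>W\<close> is needed because the generators of the smaller stage are
  considered over all variables. They do not involve \<open>var j\<close>, so the linear form is
  regular modulo them and raises the degree by one; multiplication by \<open>f\<close> keeps
  it.\<close>

lemma critical_gens_koszul_nonzero:
  assumes "critical_gens V G s" "finite W" "V \<subseteq> W"
  shows "koszul_nonzero W G s"
  using assms
proof (induction arbitrary: rule: critical_gens.induct)
  case (critical_gens_principal f V d)
  have fW: "f \<in> polys W" using critical_gens_principal polys_mono by blast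
  obtain a where a: "\<forall>j\<in>W. a j \<in> polys W" "f = (\<Sum>j\<in>W. a j * var j)"
    using const_term_0_decomp[of W f] fW homog_const_term critical_gens_principal by blast
  show ?case
    using koszul_nonzero_regular[OF _ koszul_nonzero_zero _ a(2)] a(1) critical_gens_principal
      by simp
next
  case (critical_gens_step V j G s f c r)
  let ?l = "const c * var j + r"
  have VW: "V - {j} \<subseteq> W - {j}" "V - {j} \<subseteq> W" using critical_gens_step by auto
  have r: "r \<in> polys (W - {j})" "r \<in> polys W"
    using critical_gens_step polys_mono[OF VW(1)] polys_mono[OF VW(2)] by auto
  have fW: "f \<in> polys W" using critical_gens_step polys_mono by blast
  have G: "G \<subseteq> polys (W - {j})" "G \<subseteq> polys W"
    using critical_gens_polys[OF critical_gens_step.hyps(1)] polys_mono[OF VW(1)] polys_mono[OF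
      VW(2)] by auto
  have lW: "?l \<in> polys W" using r critical_gens_step by (auto intro!: polys_intros)
  have "homog (0 + 1) (const c * var j)" by (intro homog_mult homog_const homog_var)
  then have "homog 1 ?l" using critical_gens_step by (intro homog_add) auto
  then obtain a where a: "\<forall>j\<in>W. a j \<in> polys W" "?l = (\<Sum>j\<in>W. a j * var j)"
    using const_term_0_decomp[of W ?l] lW homog_const_term critical_gens_step by blast
  have "koszul_nonzero W (insert ?l G) (Suc s)"
  proof (rule koszul_nonzero_regular[OF _ _ _ a(2)])
    show "koszul_nonzero W G s" using critical_gens_step VW by blast
    fix p assume "p \<in> polys W" "?l * p \<in> gen_ideal W G"
    then show "p \<in> gen_ideal W G"
      using linear_form_regular[OF G(1) _ _ _ r(1)] critical_gens_step by blast
  qed (use a critical_gens_step in auto)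
  then show ?case using critical_gens_step fW lW G by (intro koszul_nonzero_mult) auto
qed

theorem regular_sequence_bound:
  assumes W: "finite W" and K: "koszul_nonzero W G s"
    and th: "\<And>i. i < length ts \<Longrightarrow> ts ! i \<in> polys W" "\<And>i. i < length ts \<Longrightarrow> lk (ts ! i) 0 = 0"
    and reg: "\<And>i p. i < length ts \<Longrightarrow> p \<in> polys W \<Longrightarrow> ts ! i * p \<in> gen_ideal W (G \<union> set (take i ts))
      \<Longrightarrow> p \<in> gen_ideal W (G \<union> set (take i ts))"
  shows "length ts + s \<le> card W"
proof -
  have "koszul_nonzero W (G \<union> set (take k ts)) (k + s)" if "k \<le> length ts" for k
    using that
  proof (induction k)
    case (Suc k)
    have k: "k < length ts" using Suc by auto
    obtain a where a: "\<forall>j\<in>W. a j \<in> polys W" "ts ! k = (\<Sum>j\<in>W. a j * var j)"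
      using const_term_0_decomp[OF W th(1)[OF k] th(2)[OF k]] by blast
    have "koszul_nonzero W (insert (ts ! k) (G \<union> set (take k ts))) (Suc (k + s))"
    proof (rule koszul_nonzero_regular[OF W _ _ a(2)])
      show "koszul_nonzero W (G \<union> set (take k ts)) (k + s)" using Suc by simp
      show "a j \<in> polys W" if "j \<in> W" for j using a(1) that by blast
      show "p \<in> gen_ideal W (G \<union> set (take k ts))"
        if "p \<in> polys W" "ts ! k * p \<in> gen_ideal W (G \<union> set (take k ts))" for p
        using reg[OF k that] .
    qed
    then show ?case using k by (simp add: take_Suc_conv_app_nth)
  qed (use K in simp)
  from koszul_nonzero_le[OF W this[of "length ts"]] show ?thesis by simp
qed

section \<open>Regular sequences of maximal length\<close>

definition substitute :: "nat set \<Rightarrow> (nat \<Rightarrow> 'k::field polyn) \<Rightarrow> 'k polyn \<Rightarrow> 'k polyn" where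
  "substitute U \<phi> = peval const (\<lambda>i. if i \<in> U then \<phi> i else var i)"

definition theta_set :: "nat set \<Rightarrow> (nat \<Rightarrow> 'k::field polyn) \<Rightarrow> 'k polyn set" where
  "theta_set U \<phi> = (\<lambda>v. var v - \<phi> v) ` U"

lemma substitute_simps [simp]:
  "substitute U \<phi> 0 = 0" "substitute U \<phi> (p + q) = substitute U \<phi> p + substitute U \<phi> q"
    "substitute U \<phi> (p * q) = substitute U \<phi> p * substitute U \<phi> q"
  "substitute U \<phi> (p - q) = substitute U \<phi> p - substitute U \<phi> q"
  "substitute U \<phi> (const c) = const c" "substitute U \<phi> (var i) = (if i \<in> U then \<phi> i else var i)"
  "substitute U \<phi> (p ^ k) = substitute U \<phi> p ^ k"
  by (simp_all add: substitute_def const_hom.peval_add const_hom.peval_mult const_hom.peval_diff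
      const_hom.peval_const const_hom.peval_var const_hom.peval_power)

lemma substitute_polys: "p \<in> polys W \<Longrightarrow> (\<And>v. v \<in> U \<Longrightarrow> \<phi> v \<in> polys W) \<Longrightarrow> substitute U \<phi> p \<in> polys W"
  unfolding substitute_def by (rule peval_polys) auto

lemma substitute_id: "p \<in> polys W \<Longrightarrow> W \<inter> U = {} \<Longrightarrow> substitute U \<phi> p = p"
  unfolding substitute_def by (rule peval_id) auto

lemma substitute_comp:
  assumes "\<And>i. i \<in> U \<Longrightarrow> substitute U' \<phi>' (\<phi> i) = substitute U'' \<phi>'' (var i)"
    and "\<And>i. i \<notin> U \<Longrightarrow> substitute U' \<phi>' (var i) = substitute U'' \<phi>'' (var i)"
  shows "substitute U' \<phi>' (substitute U \<phi> p) = substitute U'' \<phi>'' p"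
proof -
  have "substitute U' \<phi>' (substitute U \<phi> p) = peval const (\<lambda>i. substitute U'' \<phi>'' (var i)) p"
    by (rule const_hom.hom_eqI) (auto simp: assms simp del: substitute_simps(6) simp:
      substitute_simps(6)[of U \<phi>])
  then show ?thesis by (simp add: substitute_def const_hom.peval_var)
qed

lemma theta_set_polys: "U \<subseteq> W \<Longrightarrow> (\<And>v. v \<in> U \<Longrightarrow> \<phi> v \<in> polys W) \<Longrightarrow> theta_set U \<phi> \<subseteq> polys W"
  by (auto simp: theta_set_def intro!: polys_diff)

lemma substitute_cong_mod:
  assumes "U \<subseteq> W" "\<And>v. v \<in> U \<Longrightarrow> \<phi> v \<in> polys W" "p \<in> polys W"
  shows "p - substitute U \<phi> p \<in> gen_ideal W (theta_set U \<phi>)"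
proof -
  have "p \<in> polys W \<and> p - substitute U \<phi> p \<in> gen_ideal W (theta_set U \<phi>)"
    using assms(3)
  proof (induction p rule: polys_gen_induct)
    case (var i)
    then show ?case by (auto simp: theta_set_def intro: gen_ideal_base)
  next
    case (add p q)
    have "p + q - substitute U \<phi> (p + q) = (p - substitute U \<phi> p) + (q - substitute U \<phi> q)" by simp
    also have "\<dots> \<in> gen_ideal W (theta_set U \<phi>)" using add by (intro gen_ideal_add) auto
    finally show ?case using add by (auto intro!: polys_add)
  next
    case (mult p q)
    have "p * q - substitute U \<phi> (p * q) = p * (q - substitute U \<phi> q)
      + (p - substitute U \<phi> p) * substitute U \<phi> q"
      by (simp add: algebra_simps)
    also have "\<dots> \<in> gen_ideal W (theta_set U \<phi>)"
      using mult assms by (intro gen_ideal_add gen_ideal_mult gen_ideal_mult2 substitute_polys) auto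
    finally show ?case using mult by (auto intro!: polys_mult)
  qed simp
  then show ?thesis ..
qed

lemma hom_gen_ideal:
  assumes "\<And>g. g \<in> G \<Longrightarrow> substitute U \<phi> g \<in> gen_ideal W H" "\<And>v. v \<in> U \<Longrightarrow> \<phi> v \<in> polys W"
    "p \<in> gen_ideal W G"
  shows "substitute U \<phi> p \<in> gen_ideal W H"
  using assms(3)
  by (induction p rule: gen_ideal.induct) (auto intro!: gen_ideal_add gen_ideal_mult
    substitute_polys assms)

text \<open>As the values avoid \<open>U\<close>, the substitution fixes them and kills each
  difference, while every polynomial is congruent to its image. The ideal is thus the kernel of a
  map into a domain, and in particular prime.\<close>

lemma gen_ideal_theta_set_iff:
  assumes "U \<subseteq> W" "\<And>v. v \<in> U \<Longrightarrow> \<phi> v \<in> polys (W - U)" "p \<in> polys W"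
  shows "p \<in> gen_ideal W (theta_set U \<phi>) \<longleftrightarrow> substitute U \<phi> p = 0"
proof
  have W: "\<phi> v \<in> polys W" if "v \<in> U" for v using assms(2)[OF that] polys_mono[of "W - U" W] by auto
  show "p \<in> gen_ideal W (theta_set U \<phi>)" if "substitute U \<phi> p = 0"
    using substitute_cong_mod[of U W \<phi> p, OF assms(1) W assms(3)] that by simp
  assume "p \<in> gen_ideal W (theta_set U \<phi>)"
  then have "substitute U \<phi> p \<in> gen_ideal W {}"
  proof (rule hom_gen_ideal[rotated 2])
    fix g assume "g \<in> theta_set U \<phi>"
    then obtain v where v: "v \<in> U" "g = var v - \<phi> v" by (auto simp: theta_set_def)
    have "substitute U \<phi> (\<phi> v) = \<phi> v" by (rule substitute_id[OF assms(2)[OF v(1)]]) auto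
    then show "substitute U \<phi> g \<in> gen_ideal W {}" using v by simp
  qed (use W in auto)
  then show "substitute U \<phi> p = 0" by simp
qed

text \<open>\<open>U0\<close> holds all variables that the sequence will kill, and its subsets
  \<open>U\<close> those killed so far. The values avoid all of \<open>U0\<close>, so the
  substitutions for different \<open>U\<close> are compatible in any order.\<close>

locale subst_system =
  fixes W U0 :: "nat set" and \<phi> :: "nat \<Rightarrow> 'k::field polyn"
  assumes U0: "U0 \<subseteq> W" and \<phi>: "v \<in> U0 \<Longrightarrow> \<phi> v \<in> polys (W - U0)"
begin

lemma \<phi>_W: "v \<in> U0 \<Longrightarrow> \<phi> v \<in> polys W"
  using \<phi> polys_mono[of "W - U0" W] by auto

lemma \<phi>_sub: "v \<in> U0 \<Longrightarrow> U \<subseteq> U0 \<Longrightarrow> \<phi> v \<in> polys (W - U)"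
  using \<phi>[of v] polys_mono[of "W - U0" "W - U"] by auto

lemma substitute_\<phi>: "v \<in> U0 \<Longrightarrow> U \<subseteq> U0 \<Longrightarrow> substitute U \<phi> (\<phi> v) = \<phi> v"
  by (rule substitute_id[OF \<phi>[of v]]) auto

lemma substitute_substitute: "U \<subseteq> U' \<Longrightarrow> U' \<subseteq> U0 \<Longrightarrow> substitute U' \<phi> (substitute U \<phi> p)
  = substitute U' \<phi> p"
  by (rule substitute_comp) (auto simp: substitute_\<phi> subset_iff)

lemma kernel: "U \<subseteq> U0 \<Longrightarrow> p \<in> polys W \<Longrightarrow> p \<in> gen_ideal W (theta_set U \<phi>) \<longleftrightarrow> substitute U \<phi> p = 0"
  using U0 \<phi>_sub by (intro gen_ideal_theta_set_iff) auto

lemma cong_mod: "U \<subseteq> U0 \<Longrightarrow> p \<in> polys W \<Longrightarrow> p - substitute U \<phi> p \<in> gen_ideal W (theta_set U \<phi>)"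
  using U0 \<phi>_W by (intro substitute_cong_mod) auto

lemma theta_nonzero: "v \<in> U0 \<Longrightarrow> var v - \<phi> v \<noteq> 0"
proof
  assume v: "v \<in> U0" and "var v - \<phi> v = 0"
  then have "var v = \<phi> v" by simp
  then have "(var v :: 'k polyn) \<in> polys (W - U0)" using \<phi>[OF v] by simp
  then show False using v by simp
qed

lemma theta_fixed: "v \<in> U0 \<Longrightarrow> v \<notin> U \<Longrightarrow> U \<subseteq> U0 \<Longrightarrow> substitute U \<phi> (var v - \<phi> v) = var v - \<phi> v"
  by (simp add: substitute_\<phi>)

lemma theta_polys: "v \<in> U0 \<Longrightarrow> var v - \<phi> v \<in> polys W"
  using U0 \<phi>_W by (auto intro!: polys_diff)

lemma regular_empty:
  assumes "U \<subseteq> U0" "v \<in> U0 - U" "p \<in> polys W" "(var v - \<phi> v) * p \<in> gen_ideal W (theta_set U \<phi>)"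
  shows "p \<in> gen_ideal W (theta_set U \<phi>)"
proof -
  have "(var v - \<phi> v) * p \<in> polys W" using theta_polys assms by (auto intro!: polys_mult)
  then have "substitute U \<phi> ((var v - \<phi> v) * p) = 0" using kernel assms by blast
  then have "(var v - \<phi> v) * substitute U \<phi> p = 0"
    using theta_fixed[of v U] assms by (simp only: substitute_simps(3)) auto
  then have "substitute U \<phi> p = 0" using theta_nonzero[of v] assms by auto
  then show ?thesis using kernel assms by blast
qed

text \<open>After the substitution for \<open>U\<close> the relation reads \<open>t p = b f\<close>
  in a domain. Killing \<open>v\<close> too sends \<open>t\<close> to 0 but not \<open>f\<close>,
  whose image survives even under \<open>U0\<close>; so it sends \<open>b\<close> to 0, hence
  \<open>t\<close> divides \<open>b\<close> and cancels.\<close>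

lemma regular_principal:
  assumes U: "U \<subseteq> U0" "v \<in> U0 - U" and p: "p \<in> polys W" and f: "f \<in> polys W" "substitute U0 \<phi> f \<noteq> 0"
    and tp: "(var v - \<phi> v) * p \<in> gen_ideal W (insert f (theta_set U \<phi>))"
  shows "p \<in> gen_ideal W (insert f (theta_set U \<phi>))"
proof -
  let ?t = "var v - \<phi> v" and ?s = "substitute U \<phi>"
  have v: "v \<in> U0" "v \<notin> U" "{v} \<subseteq> U0" using U by auto
  obtain b t where b: "b \<in> polys W" "t \<in> gen_ideal W (theta_set U \<phi>)" "?t * p = t + b * f"
    using tp unfolding gen_ideal_insert by blast
  have ThW: "theta_set U \<phi> \<subseteq> polys W" using U U0 \<phi>_W by (intro theta_set_polys) auto
  have "?s t = 0" using kernel[OF U(1), of t] b gen_ideal_polys[OF ThW] by auto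
  then have eq: "?t * ?s p = ?s b * ?s f"
    using arg_cong[OF b(3), of ?s] theta_fixed[OF v(1,2) U(1)]
      by (simp only: substitute_simps(2,3)) simp
  have sW: "?s q \<in> polys W" if "q \<in> polys W" for q
    using that U \<phi>_W by (intro substitute_polys) auto
  have "substitute U0 \<phi> (substitute {v} \<phi> (?s f)) = substitute U0 \<phi> f"
    using substitute_substitute[of "{v}" U0] substitute_substitute[of U U0] v U by simp
  then have "substitute {v} \<phi> (?s f) \<noteq> 0" using f by auto
  moreover have "substitute {v} \<phi> ?t = 0" using substitute_\<phi>[OF v(1,3)] by simp
  then have "substitute {v} \<phi> (?s b) * substitute {v} \<phi> (?s f) = 0"
    using arg_cong[OF eq, of "substitute {v} \<phi>"] by (simp only: substitute_simps(3)) simp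
  ultimately have "substitute {v} \<phi> (?s b) = 0" by simp
  then have "?s b \<in> gen_ideal W (theta_set {v} \<phi>)" using kernel[OF v(3) sW[OF b(1)]] by blast
  then obtain a where a: "a \<in> polys W" "?s b = a * ?t"
    by (auto simp: theta_set_def gen_ideal_singleton)
  have "?t * ?s p = ?t * (a * ?s f)" unfolding eq a(2) by (simp only: mult_ac)
  then have sp: "?s p = a * ?s f" using theta_nonzero[OF v(1)] by simp
  have "p - a * f = (p - ?s p) - a * (f - ?s f)" unfolding sp by (simp add: algebra_simps)
  also have "\<dots> \<in> gen_ideal W (theta_set U \<phi>)"
    by (rule gen_ideal_diff[OF cong_mod[OF U(1) p] gen_ideal_mult[OF cong_mod[OF U(1) f(1)] a(1)]])
  finally have "(p - a * f) + a * f \<in> gen_ideal W (insert f (theta_set U \<phi>))"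
    unfolding gen_ideal_insert using a by blast
  then show ?thesis by simp
qed

end

text \<open>The sequence consists of elements \<open>x\<^sub>v - \<phi>\<^sub>v\<close>. Killing some of them is a substitution,
  whose kernel is prime, so that regularity only requires the product \<open>F\<close> of the \<open>f\<^sub>i\<close> to
  survive.\<close>

lemma critical_gens_regular:
  assumes "critical_gens V G s" "finite V"
  shows "\<exists>F V'. F \<noteq> 0 \<and> F \<in> polys V \<and> V' \<subseteq> V \<and> card V' + s = card V + 1 \<and>
    (\<forall>W U0 \<phi> U v p. finite W \<longrightarrow> V \<subseteq> W \<longrightarrow> U0 \<subseteq> V' \<longrightarrow> (\<forall>v\<in>U0. \<phi> v \<in> polys (V' - U0)) \<longrightarrow> substitute U0 \<phi>
      F \<noteq> 0 \<longrightarrow>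
      U \<subseteq> U0 \<longrightarrow> v \<in> U0 - U \<longrightarrow> p \<in> polys W \<longrightarrow> (var v - \<phi> v) * p \<in> gen_ideal W (G \<union> theta_set U \<phi>) \<longrightarrow>
      p \<in> gen_ideal W (G \<union> theta_set U \<phi>))"
  using assms
proof (induction rule: critical_gens.induct)
  case (critical_gens_principal f V d)
  show ?case
  proof (intro exI[of _ f] exI[of _ V] conjI allI impI)
    fix W U0 :: "nat set" and \<phi> :: "nat \<Rightarrow> 'a polyn" and U v p
    assume *: "finite W" "V \<subseteq> W" "U0 \<subseteq> V" "\<forall>v\<in>U0. \<phi> v \<in> polys (V - U0)" "substitute U0 \<phi> f \<noteq> 0"
      "U \<subseteq> U0" "v \<in> U0 - U"
      "p \<in> polys W" "(var v - \<phi> v) * p \<in> gen_ideal W ({f} \<union> theta_set U \<phi>)"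
    interpret subst_system W U0 \<phi>
      by unfold_locales (use * polys_mono[of "V - U0" "W - U0"] in auto)
    show "p \<in> gen_ideal W ({f} \<union> theta_set U \<phi>)"
      using regular_principal[of U v p f] * critical_gens_principal polys_mono[of V W] by auto
  qed (use critical_gens_principal in auto)
next
  case (critical_gens_step V j G s f c r)
  then obtain F V' where F: "F \<noteq> 0" "F \<in> polys (V - {j})" "V' \<subseteq> V - {j}" "card V' + s
    = card (V - {j}) + 1"
    and reg: "\<And>W U0 \<phi> U v p. \<lbrakk>finite W; V - {j} \<subseteq> W; U0 \<subseteq> V'; \<forall>v\<in>U0. \<phi> v
      \<in> polys (V' - U0); substitute U0 \<phi> F \<noteq> 0;
      U \<subseteq> U0; v \<in> U0 - U; p \<in> polys W; (var v - \<phi> v) * p \<in> gen_ideal W (G \<union> theta_set U \<phi>)\<rbrakk> \<Longrightarrow>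
      p \<in> gen_ideal W (G \<union> theta_set U \<phi>)" by auto
  let ?l = "const c * var j + r"
  have VV: "polys (V - {j}) \<subseteq> polys V" by (rule polys_mono) auto
  have GV: "G \<subseteq> polys (V - {j})" by (rule critical_gens_polys[OF critical_gens_step.hyps(1)])
  \<comment> \<open>\<open>F\<close> accumulates the product of all divisors \<open>f\<close>.
    \<open>V'\<close> leaves out every eliminated \<open>j\<close>, so that the later substitutions
    never touch these variables; each elimination after the principal stage costs one element of
    \<open>V'\<close>.\<close>
  show ?case
  proof (intro exI[of _ "f * F"] exI[of _ V'] conjI allI impI)
    show "f * F \<noteq> 0" "f * F \<in> polys V" "V' \<subseteq> V" using critical_gens_step F VV
      by (auto intro: polys_mult)
    have "Suc (card (V - {j})) = card V" using critical_gens_step by (intro card_Suc_Diff1) auto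
    then show "card V' + Suc s = card V + 1" using F by simp
    fix W U0 :: "nat set" and \<phi> :: "nat \<Rightarrow> 'a polyn" and U v p
    assume *: "finite W" "V \<subseteq> W" "U0 \<subseteq> V'" "\<forall>v\<in>U0. \<phi> v \<in> polys (V' - U0)"
      "substitute U0 \<phi> (f * F) \<noteq> 0"
      "U \<subseteq> U0" "v \<in> U0 - U" "p \<in> polys W"
      "(var v - \<phi> v) * p \<in> gen_ideal W ((*) f ` insert ?l G \<union> theta_set U \<phi>)"
    have "V' - U0 \<subseteq> W - U0" using * F by auto
    then interpret subst_system W U0 \<phi>
      by unfold_locales (use * F polys_mono[of "V' - U0" "W - U0"] in auto)
    have v: "v \<in> U0" "v \<notin> U" using * by auto
    let ?t = "var v - \<phi> v"
    have VW: "polys V \<subseteq> polys W" using * by (intro polys_mono)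
    have fW: "f \<in> polys W" and lW: "?l \<in> polys W" and GW: "G \<subseteq> polys W"
      using critical_gens_step VV VW GV * by (auto intro!: polys_intros)
    have HW: "insert ?l G \<subseteq> polys W" using lW GW by auto
    have ThW: "theta_set U \<phi> \<subseteq> polys W" using * U0 \<phi>_W by (intro theta_set_polys) auto
    have sub: "gen_ideal W ((*) f ` insert ?l G \<union> theta_set U \<phi>)
      \<subseteq> gen_ideal W (insert f (theta_set U \<phi>))"
    proof (rule gen_ideal_subset)
      fix g assume "g \<in> (*) f ` insert ?l G \<union> theta_set U \<phi>"
      then show "g \<in> gen_ideal W (insert f (theta_set U \<phi>))"
        using HW by (auto intro!: gen_ideal_mult2 gen_ideal_base[of f] intro: gen_ideal_base)
    qed
    \<comment> \<open>Every generator lies in the ideal of \<open>f\<close> and the killed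
      differences, so the principal case gives \<open>p = t + b * f\<close>. It remains to place
      \<open>b\<close> in the ideal of the linear form, \<open>G\<close> and the
      differences.\<close>
    have "p \<in> gen_ideal W (insert f (theta_set U \<phi>))"
      using regular_principal[OF *(6-8) fW] * sub by auto
    then obtain b t where b: "b \<in> polys W" "t \<in> gen_ideal W (theta_set U \<phi>)" "p = t + b * f"
      unfolding gen_ideal_insert by blast
    obtain h t' where h: "h \<in> gen_ideal W (insert ?l G)" "t' \<in> gen_ideal W (theta_set U \<phi>)"
      "?t * p = f * h + t'"
      using *(9) unfolding gen_ideal_Un gen_ideal_image_mult by blast
    have hW: "h \<in> polys W" using h gen_ideal_polys[OF HW] by auto
    have tW: "?t \<in> polys W" using theta_polys v by simp
    \<comment> \<open>The kernel of the substitution is prime and does not contain \<open>f\<close>,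
      so \<open>f\<close> can be cancelled modulo the differences.\<close>
    have "f * (?t * b - h) = t' - ?t * t"
      using h(3) unfolding b(3) by (simp add: algebra_simps)
    also have "\<dots> \<in> gen_ideal W (theta_set U \<phi>)" using h b tW
      by (intro gen_ideal_diff gen_ideal_mult)
    finally have "substitute U \<phi> f * substitute U \<phi> (?t * b - h) = 0"
      using kernel[OF *(6), of "f * (?t * b - h)"] fW tW b hW
        by (auto simp only: substitute_simps(3) intro!: polys_intros)
    moreover have "substitute U \<phi> f \<noteq> 0"
    proof
      assume "substitute U \<phi> f = 0"
      then have "substitute U0 \<phi> f = 0" using substitute_substitute[OF *(6) order_refl, of f]
        by simp
      then show False using * by simp
    qed
    ultimately have "substitute U \<phi> (?t * b - h) = 0" by auto
    then have "?t * b - h \<in> gen_ideal W (theta_set U \<phi>)"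
      using kernel[OF *(6), of "?t * b - h"] tW b hW by (auto intro!: polys_intros)
    then have tb: "?t * b \<in> gen_ideal W (insert ?l G \<union> theta_set U \<phi>)"
      unfolding gen_ideal_Un using h(1) by (intro bexI[of _ h] bexI[of _ "?t * b - h"]) auto
    \<comment> \<open>This solves the linear form for \<open>var j\<close>. It fixes
      \<open>G\<close> and the differences, which avoid \<open>var j\<close>, so the induction
      hypothesis applies to the image of \<open>b\<close>; \<open>b\<close> itself differs from it
      by a multiple of the linear form.\<close>
    define \<psi> where "\<psi> = (\<lambda>_::nat. - (const (inverse c) * r))"
    have \<psi>: "\<psi> u \<in> polys (W - {j})" for u
      unfolding \<psi>_def using critical_gens_step * polys_mono[of "V - {j}" "W - {j}"]
        by (auto intro!: polys_intros)
    have \<psi>W: "\<psi> u \<in> polys W" for u using \<psi>[of u] polys_mono[of "W - {j}" W] by auto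
    have cc: "const c * const (inverse c) = 1" using critical_gens_step const_inverse by blast
    have fixd: "substitute {j} \<psi> q = q" if "q \<in> polys (V - {j})" for q
      using that by (rule substitute_id) auto
    have jV': "j \<notin> V'" "V' \<subseteq> V - {j}" using F by auto
    have tV: "var u - \<phi> u \<in> polys (V - {j})" if "u \<in> U0" for u
    proof (rule polys_diff)
      have "V' - U0 \<subseteq> V - {j}" using jV' by auto
      then show "\<phi> u \<in> polys (V - {j})" using polys_mono[of "V' - U0" "V - {j}"] *(4) that by blast
      show "var u \<in> polys (V - {j})" using *(3) that jV' by auto
    qed
    have sl: "substitute {j} \<psi> ?l = 0"
      using fixd[of r] critical_gens_step cc by (simp add: \<psi>_def flip: mult.assoc)
    have "substitute {j} \<psi> (?t * b) \<in> gen_ideal W (G \<union> theta_set U \<phi>)"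
    proof (rule hom_gen_ideal[OF _ \<psi>W tb])
      fix g assume g: "g \<in> insert ?l G \<union> theta_set U \<phi>"
      show "substitute {j} \<psi> g \<in> gen_ideal W (G \<union> theta_set U \<phi>)"
      proof (cases "g = ?l")
        case False
        then have "g \<in> G \<union> theta_set U \<phi>" using g by auto
        moreover have "g \<in> polys (V - {j})" using calculation GV tV * by (auto simp: theta_set_def)
        ultimately show ?thesis using fixd gen_ideal_base by metis
      qed (simp only: sl gen_ideal_0)
    qed
    then have "?t * substitute {j} \<psi> b \<in> gen_ideal W (G \<union> theta_set U \<phi>)"
      using fixd[OF tV[OF v(1)]] by (simp only: substitute_simps(3))
    moreover have "substitute U0 \<phi> F \<noteq> 0" using * by auto
    moreover have "V - {j} \<subseteq> W" using * by auto
    moreover have "substitute {j} \<psi> b \<in> polys W" using b(1) \<psi>W by (rule substitute_polys)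
    ultimately have 1: "substitute {j} \<psi> b \<in> gen_ideal W (G \<union> theta_set U \<phi>)"
      using reg[OF *(1) _ *(3,4) _ *(6,7)] by blast
    have "b - substitute {j} \<psi> b \<in> gen_ideal W (theta_set {j} \<psi>)"
      using \<psi>W b critical_gens_step * by (intro substitute_cong_mod) auto
    also have "gen_ideal W (theta_set {j} \<psi>) \<subseteq> gen_ideal W {?l}"
    proof (rule gen_ideal_subset)
      fix g assume "g \<in> theta_set {j} \<psi>"
      then have "g = var j + const (inverse c) * r" by (simp add: theta_set_def \<psi>_def)
      moreover have "const (inverse c) * ?l
        = (const c * const (inverse c)) * var j + const (inverse c) * r"
        by (simp only: distrib_left mult_ac)
      ultimately have "g = const (inverse c) * ?l" unfolding cc by simp
      then show "g \<in> gen_ideal W {?l}" by (auto intro: gen_ideal_mult gen_ideal_base)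
    qed
    finally have "(b - substitute {j} \<psi> b) + substitute {j} \<psi> b
      \<in> gen_ideal W (insert ?l G \<union> theta_set U \<phi>)"
      using 1 gen_ideal_mono[of "{?l}" "insert ?l G \<union> theta_set U \<phi>" W] gen_ideal_mono[of
        "G \<union> theta_set U \<phi>" "insert ?l G \<union> theta_set U \<phi>" W]
      by (intro gen_ideal_add) auto
    then obtain h' t'' where b': "h' \<in> gen_ideal W (insert ?l G)"
      "t'' \<in> gen_ideal W (theta_set U \<phi>)" "b = h' + t''"
      unfolding gen_ideal_Un by auto
    have "p = f * h' + (t + f * t'')" unfolding b(3) b'(3) by (simp add: algebra_simps)
    moreover have "t + f * t'' \<in> gen_ideal W (theta_set U \<phi>)" using b b' fW
      by (intro gen_ideal_add gen_ideal_mult)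
    ultimately show "p \<in> gen_ideal W ((*) f ` insert ?l G \<union> theta_set U \<phi>)"
      unfolding gen_ideal_Un gen_ideal_image_mult using b' by blast
  qed
qed

text \<open>Powers of a variable in place of linear forms: the field may be finite.\<close>

lemma ex_subst_nonzero:
  assumes "finite E" "w \<notin> E" "F \<noteq> 0"
  shows "\<exists>e::nat \<Rightarrow> nat. (\<forall>v. e v \<ge> 1) \<and> substitute E (\<lambda>v. var w ^ e v) F \<noteq> 0"
  using assms
proof (induction E)
  case empty
  then show ?case by (intro exI[of _ "\<lambda>_. 1"]) (auto simp: substitute_def)
next
  case (insert v E)
  then obtain e :: "nat \<Rightarrow> nat" where e: "\<forall>v. e v \<ge> 1" "substitute E (\<lambda>v. var w ^ e v) F \<noteq> 0" by auto
  let ?F = "substitute E (\<lambda>v. var w ^ e v) F"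
  \<comment> \<open>As a polynomial in \<open>v\<close> over a domain, \<open>?F\<close> has only
    finitely many roots, whereas the powers of \<open>var w\<close> are pairwise distinct.\<close>
  have "finite {x. poly (as_univ v ?F) x = 0}" using e(2) by (intro poly_roots_finite) simp
  moreover have "inj (\<lambda>k. var w ^ Suc k :: 'a polyn)"
  proof (rule injI)
    fix k l assume "(var w ^ Suc k :: 'a polyn) = var w ^ Suc l"
    then have "as_univ w (var w ^ Suc k :: 'a polyn) = as_univ w (var w ^ Suc l)" by simp
    then have "degree ([:0, 1:] ^ Suc k :: 'a polyn poly)
      = degree ([:0, 1:] ^ Suc l :: 'a polyn poly)"
      by (simp del: power_Suc)
    then show "k = l" by (simp add: degree_power_eq del: power_Suc)
  qed
  then have "infinite (range (\<lambda>k. var w ^ Suc k :: 'a polyn))" by (simp add: range_inj_infinite)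
  ultimately have "\<not> range (\<lambda>k. var w ^ Suc k :: 'a polyn) \<subseteq> {x. poly (as_univ v ?F) x = 0}"
    using finite_subset by blast
  then obtain k where k: "poly (as_univ v ?F) (var w ^ Suc k) \<noteq> 0" by auto
  have "poly (as_univ v ?F) (var w ^ Suc k) = substitute {v} (\<lambda>_. var w ^ Suc k) ?F"
    by (simp add: poly_as_univ_subst substitute_def fun_upd_def cong: if_cong del: power_Suc)
  also have "\<dots> = substitute (insert v E) (\<lambda>u. var w ^ (e(v := Suc k)) u) F"
    using insert by (intro substitute_comp) auto
  finally show ?case using e k by (intro exI[of _ "e(v := Suc k)"]) auto
qed

lemma theta_set_take: "i < length vs \<Longrightarrow> set (take i (map (\<lambda>v. var v - \<phi> v) vs))
  = theta_set (set (take i vs)) \<phi>"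
  by (simp add: theta_set_def take_map)

lemma distinct_nth_notin_take: "distinct vs \<Longrightarrow> i < length vs \<Longrightarrow> vs ! i \<notin> set (take i vs)"
  by (auto simp: in_set_conv_nth nth_eq_iff_index_eq)

lemma const_term_var [simp]: "lk (var v) 0 = 0"
proof -
  have "sgl v (1::nat) \<noteq> 0" by (metis keys_single keys_zero insert_not_empty one_neq_zero)
  then show ?thesis by (simp add: var_def mpoly_def lookup_single when_def)
qed

theorem critical_gens_regular_sequence:
  assumes "critical_gens W G s" "finite W"
  shows "\<exists>ts. length ts + s = card W \<and> (\<forall>i<length ts. ts ! i \<in> polys W \<and> lk (ts ! i) 0 = 0 \<and>
    (\<forall>p\<in>polys W. ts ! i * p \<in> gen_ideal W (G \<union> set (take i ts)) \<longrightarrow> p \<in> gen_ideal W (G \<union> set (take i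
      ts))))"
proof -
  obtain F V' where F: "F \<noteq> 0" "F \<in> polys W" "V' \<subseteq> W" "card V' + s = card W + 1"
    and reg: "\<And>U0 \<phi> U v p. \<lbrakk>U0 \<subseteq> V'; \<forall>v\<in>U0. \<phi> v \<in> polys (V' - U0); substitute U0 \<phi> F \<noteq> 0;
      U \<subseteq> U0; v \<in> U0 - U; p \<in> polys W; (var v - \<phi> v) * p \<in> gen_ideal W (G \<union> theta_set U \<phi>)\<rbrakk> \<Longrightarrow>
      p \<in> gen_ideal W (G \<union> theta_set U \<phi>)" using critical_gens_regular[OF assms] assms(2) by auto
  \<comment> \<open>Nonvanishing homology in degree \<open>s\<close> bounds \<open>s\<close> by the
    number of variables, which leaves at least one element in \<open>V'\<close>.\<close>
  have "s \<le> card W" using koszul_nonzero_le[OF assms(2) critical_gens_koszul_nonzero[OF assms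
    order_refl]] .
  then have "V' \<noteq> {}" using F by auto
  then obtain w where w: "w \<in> V'" by blast
  have finV': "finite V'" using F assms finite_subset by blast
  \<comment> \<open>One element \<open>w\<close> of \<open>V'\<close> is kept as the target of the
    substitution. The other \<open>card V' - 1 = card W - s\<close> variables give the
    sequence.\<close>
  obtain e :: "nat \<Rightarrow> nat" where e: "\<forall>v. e v \<ge> 1" "substitute (V' - {w}) (\<lambda>v. var w ^ e v) F \<noteq> 0"
    using ex_subst_nonzero[of "V' - {w}" w F] F finV' by auto
  let ?\<phi> = "\<lambda>v. var w ^ e v :: 'a polyn"
  define vs where "vs = sorted_list_of_set (V' - {w})"
  have vs: "set vs = V' - {w}" "distinct vs" "length vs = card (V' - {w})"
    using finV' by (auto simp: vs_def)
  have "Suc (card (V' - {w})) = card V'" using finV' w by (intro card_Suc_Diff1)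
  then have len: "length vs + s = card W" using F vs by simp
  show ?thesis
  proof (intro exI[of _ "map (\<lambda>v. var v - ?\<phi> v) vs"] conjI allI impI ballI)
    fix i assume "i < length (map (\<lambda>v. var v - ?\<phi> v) vs)"
    then have i: "i < length vs" by simp
    have vi: "vs ! i \<in> V' - {w}" "vs ! i \<notin> set (take i vs)"
      using nth_mem[OF i] vs(1) distinct_nth_notin_take[OF vs(2) i] by blast+
    show "map (\<lambda>v. var v - ?\<phi> v) vs ! i \<in> polys W"
      using i vi F w by (auto intro!: polys_intros)
    \<comment> \<open>Exponents at least 1 keep the sequence inside the maximal ideal.\<close>
    have "lk (?\<phi> (vs ! i)) 0 = 0"
    proof -
      have "mpoly (sgl w (e (vs ! i))) = ?\<phi> (vs ! i)" by (rule mpoly_single)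
      moreover have "sgl w (e (vs ! i)) \<noteq> 0" using e(1)
        by (metis mdeg_0 mdeg_single not_one_le_zero)
      ultimately show ?thesis by (metis lookup_single_not_eq mpoly_def)
    qed
    then show "lk (map (\<lambda>v. var v - ?\<phi> v) vs ! i) 0 = 0" using i by (simp add: lookup_minus)
    fix p assume p: "p \<in> polys W" "map (\<lambda>v. var v - ?\<phi> v) vs ! i * p
      \<in> gen_ideal W (G \<union> set (take i (map (\<lambda>v. var v - ?\<phi> v) vs)))"
    have take: "set (take i vs) \<subseteq> V' - {w}" using set_take_subset[of i vs] vs(1) by simp
    have \<phi>V: "\<forall>v\<in>V' - {w}. ?\<phi> v \<in> polys (V' - (V' - {w}))" using w by (auto intro!: polys_power)
    have "(var (vs ! i) - ?\<phi> (vs ! i)) * p \<in> gen_ideal W (G \<union> theta_set (set (take i vs)) ?\<phi>)"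
      using p(2) unfolding theta_set_take[OF i, of ?\<phi>] using i by simp
    from reg[OF _ \<phi>V e(2) take _ p(1) this] vi
    show "p \<in> gen_ideal W (G \<union> set (take i (map (\<lambda>v. var v - ?\<phi> v) vs)))"
      unfolding theta_set_take[OF i, of ?\<phi>] by blast
  qed (use len in simp)
qed

text \<open>The zero ideal is the case \<open>s = 0\<close>, outside \<open>critical_gens\<close>.
  With all values equal to 0 the sequence consists of the variables themselves.\<close>

theorem zero_regular_sequence:
  assumes "finite W"
  shows "\<exists>ts :: 'k::field polyn list. length ts
    = card W \<and> (\<forall>i<length ts. ts ! i \<in> polys W \<and> lk (ts ! i) 0 = 0 \<and>
    (\<forall>p\<in>polys W. ts ! i * p \<in> gen_ideal W (set (take i ts)) \<longrightarrow> p \<in> gen_ideal W (set (take i ts))))"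
proof -
  let ?\<phi> = "\<lambda>v::nat. 0 :: 'k polyn"
  interpret subst_system W W ?\<phi> by unfold_locales auto
  define vs where "vs = sorted_list_of_set W"
  have vs: "set vs = W" "distinct vs" "length vs = card W" using assms by (auto simp: vs_def)
  show ?thesis
  proof (intro exI[of _ "map (\<lambda>v. var v - ?\<phi> v) vs"] conjI allI impI ballI)
    fix i assume "i < length (map (\<lambda>v. var v - ?\<phi> v) vs)"
    then have i: "i < length vs" by simp
    have vi: "vs ! i \<in> W" "vs ! i \<notin> set (take i vs)"
      using nth_mem[OF i] vs(1) distinct_nth_notin_take[OF vs(2) i] by blast+
    show "map (\<lambda>v. var v - ?\<phi> v) vs ! i \<in> polys W" "lk (map (\<lambda>v. var v - ?\<phi> v) vs ! i) 0 = 0"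
      using i vi by auto
    fix p assume p: "p \<in> polys W" "map (\<lambda>v. var v - ?\<phi> v) vs ! i * p
      \<in> gen_ideal W (set (take i (map (\<lambda>v. var v - ?\<phi> v) vs)))"
    have take: "set (take i vs) \<subseteq> W" using set_take_subset[of i vs] vs(1) by simp
    have "(var (vs ! i) - ?\<phi> (vs ! i)) * p \<in> gen_ideal W (theta_set (set (take i vs)) ?\<phi>)"
      using p(2) unfolding theta_set_take[OF i, of ?\<phi>] using i by simp
    from regular_empty[OF take _ p(1) this] vi
    show "p \<in> gen_ideal W (set (take i (map (\<lambda>v. var v - ?\<phi> v) vs)))"
      unfolding theta_set_take[OF i, of ?\<phi>] by blast
  qed (use vs in simp)
qed

section \<open>Dimensions of homogeneous components\<close>

definition scalar_mult :: "'k::field \<Rightarrow> 'k polyn \<Rightarrow> 'k polyn" where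
  "scalar_mult c p = const c * p"

interpretation vs: vector_space scalar_mult
  by unfold_locales (simp_all add: scalar_mult_def const_add const_mult algebra_simps)

text \<open>The space of all polynomials has infinite dimension; finite dimension of a subset is
  expressed by a finite set \<open>A\<close> whose span contains it.\<close>

lemma fd_basis:
  fixes S :: "'k::field polyn set"
  assumes "finite A" "S \<subseteq> vs.span A"
  obtains B where "B \<subseteq> S" "finite B" "vs.independent B" "S \<subseteq> vs.span B" "card B = vs.dim S"
proof -
  obtain B where B: "B \<subseteq> S" "vs.independent B" "S \<subseteq> vs.span B" "card B = vs.dim S"
    by (rule vs.basis_exists)
  moreover have "finite B" using vs.independent_span_bound[OF assms(1) B(2)] B assms by auto
  ultimately show ?thesis using that by blast
qed

lemma fd_dim_mono:
  fixes S :: "'k::field polyn set"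
  assumes "finite A" "T \<subseteq> vs.span A" "S \<subseteq> T"
  shows "vs.dim S \<le> vs.dim T"
proof -
  obtain B where "finite B" "T \<subseteq> vs.span B" "card B = vs.dim T" using fd_basis[OF assms(1,2)]
    by metis
  then show ?thesis using vs.dim_le_card[of S B] assms by auto
qed

lemma fd_dim_equal:
  fixes S :: "'k::field polyn set"
  assumes "finite A" "T \<subseteq> vs.span A" "S \<subseteq> T" "vs.subspace S" "vs.dim S = vs.dim T"
  shows "S = T"
proof (rule ccontr)
  assume "S \<noteq> T"
  then obtain x where x: "x \<in> T" "x \<notin> S" using assms by auto
  have "S \<subseteq> vs.span A" using assms by auto
  then obtain B where B: "B \<subseteq> S" "finite B" "vs.independent B" "S \<subseteq> vs.span B" "card B = vs.dim S"
    using fd_basis[OF assms(1)] by metis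
  obtain C where C: "finite C" "T \<subseteq> vs.span C" "card C = vs.dim T" using fd_basis[OF assms(1,2)]
    by metis
  have "vs.span B \<subseteq> S" using B assms vs.span_minimal by blast
  then have "x \<notin> vs.span B" using x by auto
  then have "vs.independent (insert x B)" using B vs.independent_insertI by blast
  then have "card (insert x B) \<le> card C"
    using vs.independent_span_bound[OF C(1)] B C x assms by blast
  moreover have "x \<notin> B" using x B by auto
  ultimately show False using B C assms by simp
qed

lemma fd_complement:
  fixes U :: "'k::field polyn set"
  assumes "finite A" "T \<subseteq> vs.span A" "U \<subseteq> T" "vs.subspace U" "vs.subspace T"
  obtains S where "finite S" "S \<subseteq> T" "card S + vs.dim U = vs.dim T" "T \<subseteq> vs.span (U \<union> S)"
    "vs.independent S" "U \<inter> vs.span S = {0}"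
proof -
  have "U \<subseteq> vs.span A" using assms by auto
  then obtain B where B: "B \<subseteq> U" "finite B" "vs.independent B" "U \<subseteq> vs.span B" "card B = vs.dim U"
    using fd_basis[OF assms(1)] by metis
  have BT: "B \<subseteq> T" using B assms by auto
  obtain C where C: "B \<subseteq> C" "C \<subseteq> T" "vs.independent C" "T \<subseteq> vs.span C"
    using vs.maximal_independent_subset_extend[OF BT B(3)] by metis
  have finC: "finite C" using vs.independent_span_bound[OF assms(1) C(3)] C assms by auto
  have cardC: "card C = vs.dim T" using C by (intro vs.basis_card_eq_dim)
  show ?thesis
  proof
    show "finite (C - B)" "C - B \<subseteq> T" using finC C by auto
    show "vs.independent (C - B)" using C vs.independent_mono by (metis Diff_subset)
    show "card (C - B) + vs.dim U = vs.dim T"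
      using B C finC cardC card_Diff_subset[of B C] card_mono[of C B] by auto
    have "vs.span C \<subseteq> vs.span (U \<union> (C - B))" using B by (intro vs.span_mono) auto
    then show "T \<subseteq> vs.span (U \<union> (C - B))" using C by auto
    have "x = 0" if x: "x \<in> vs.span B" "x \<in> vs.span (C - B)" for x
    proof -
      obtain f where f: "(\<Sum>b\<in>B. scalar_mult (f b) b) = x" using x(1)
        unfolding vs.span_finite[OF B(2)] by auto
      obtain g where g: "(\<Sum>b\<in>C - B. scalar_mult (g b) b) = x"
        using x(2) unfolding vs.span_finite[OF finite_Diff[OF finC]] by auto
      define h where "h b = (if b \<in> B then f b else - g b)" for b
      have "(\<Sum>b\<in>C. scalar_mult (h b) b) = (\<Sum>b\<in>B. scalar_mult (h b) b)
        + (\<Sum>b\<in>C - B. scalar_mult (h b) b)"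
        using sum.subset_diff[OF C(1) finC, of "\<lambda>b. scalar_mult (h b) b"] by (simp add: add.commute)
      also have "(\<Sum>b\<in>B. scalar_mult (h b) b) = x" unfolding f[symmetric]
        by (intro sum.cong) (auto simp: h_def)
      also have "(\<Sum>b\<in>C - B. scalar_mult (h b) b) = - x"
        unfolding g[symmetric] sum_negf[symmetric] by (intro sum.cong) (auto simp: h_def)
      finally have "(\<Sum>b\<in>C. scalar_mult (h b) b) = 0" by simp
      then have "\<forall>b\<in>C. h b = 0" using C(3) finC unfolding vs.dependent_finite[OF finC] by blast
      then have "\<forall>b\<in>B. f b = 0" using C by (force simp: h_def)
      then show "x = 0" unfolding f[symmetric] by simp
    qed
    then have "U \<inter> vs.span (C - B) \<subseteq> {0}" using B(4) by blast
    moreover have "0 \<in> U" using assms(4) by (rule vs.subspace_0)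
    ultimately show "U \<inter> vs.span (C - B) = {0}" using vs.span_zero by blast
  qed
qed

lemma independent_mult_image:
  fixes B :: "'k::field polyn set"
  assumes "a \<noteq> 0" "finite B" "vs.independent B"
  shows "vs.independent ((*) a ` B)" "card ((*) a ` B) = card B"
proof -
  have inj: "inj_on ((*) a) B" using assms by (auto simp: inj_on_def)
  show "card ((*) a ` B) = card B" using inj by (rule card_image)
  show "vs.independent ((*) a ` B)"
    unfolding vs.dependent_finite[OF finite_imageI[OF assms(2)]]
  proof (intro notI, elim exE conjE)
    fix u assume u: "\<exists>v\<in>(*) a ` B. u v \<noteq> 0" "(\<Sum>v\<in>(*) a ` B. scalar_mult (u v) v) = 0"
    have "(\<Sum>v\<in>(*) a ` B. scalar_mult (u v) v) = a * (\<Sum>v\<in>B. scalar_mult (u (a * v)) v)"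
      by (simp add: sum.reindex[OF inj] sum_distrib_left scalar_mult_def mult.left_commute)
    then have "(\<Sum>v\<in>B. scalar_mult (u (a * v)) v) = 0" using u assms by simp
    then have "\<forall>v\<in>B. u (a * v) = 0"
      using assms(3) unfolding vs.dependent_finite[OF assms(2)]
        by (auto dest!: spec[of _ "\<lambda>v. u (a * v)"])
    then show False using u by auto
  qed
qed

lemma span_mult_image: "vs.span ((*) a ` B) = (*) a ` vs.span (B :: 'k::field polyn set)"
proof -
  have "module_hom scalar_mult scalar_mult ((*) a)"
    by unfold_locales (simp_all add: scalar_mult_def algebra_simps)
  then show ?thesis using module_hom.span_image by blast
qed

lemma dim_mult_image:
  fixes S :: "'k::field polyn set"
  assumes "a \<noteq> 0" "finite A" "S \<subseteq> vs.span A"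
  shows "vs.dim ((*) a ` S) = vs.dim S"
proof -
  obtain B where B: "B \<subseteq> S" "finite B" "vs.independent B" "S \<subseteq> vs.span B" "card B = vs.dim S"
    using fd_basis[OF assms(2,3)] by metis
  have "card ((*) a ` B) = vs.dim ((*) a ` S)"
    using B independent_mult_image[OF assms(1) B(2,3)]
    by (intro vs.basis_card_eq_dim) (auto simp: span_mult_image)
  then show ?thesis using independent_mult_image[OF assms(1) B(2,3)] B by simp
qed

lemma independent_Un:
  fixes S T :: "'k::field polyn set"
  assumes "finite S" "finite T" "vs.independent S" "vs.independent T" "vs.span S \<inter> vs.span T = {0}"
  shows "vs.independent (S \<union> T)" "S \<inter> T = {}"
proof -
  have S0: "0 \<notin> S" using assms(3) vs.dependent_zero by blast
  show disj: "S \<inter> T = {}"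
  proof (rule ccontr)
    assume "S \<inter> T \<noteq> {}"
    then obtain x where x: "x \<in> S" "x \<in> T" by blast
    then have "x \<in> vs.span S \<inter> vs.span T" by (simp add: vs.span_base)
    then have "x = 0" unfolding assms(5) by simp
    then show False using x S0 by simp
  qed
  show "vs.independent (S \<union> T)"
    unfolding vs.dependent_finite[OF finite_UnI[OF assms(1,2)]]
  proof (intro notI, elim exE conjE)
    fix u assume u: "\<exists>v\<in>S \<union> T. u v \<noteq> 0" "(\<Sum>v\<in>S \<union> T. scalar_mult (u v) v) = 0"
    let ?s = "\<Sum>v\<in>S. scalar_mult (u v) v" and ?t = "\<Sum>v\<in>T. scalar_mult (u v) v"
    have st: "?s + ?t = 0" using u assms disj by (simp add: sum.union_disjoint)
    have "?s \<in> vs.span S" by (intro vs.span_sum vs.span_scale vs.span_base)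
    moreover have "?t \<in> vs.span T" by (intro vs.span_sum vs.span_scale vs.span_base)
    then have "- ?t \<in> vs.span T" by (rule vs.span_neg)
    moreover have "?s = - ?t" using st by (simp add: eq_neg_iff_add_eq_0)
    ultimately have "?s \<in> vs.span S \<inter> vs.span T" by simp
    then have s0: "?s = 0" unfolding assms(5) by simp
    then have t0: "?t = 0" using st by simp
    have "\<forall>v\<in>S. u v = 0"
      using s0 assms(3) unfolding vs.dependent_finite[OF assms(1)] by blast
    moreover have "\<forall>v\<in>T. u v = 0"
      using t0 assms(4) unfolding vs.dependent_finite[OF assms(2)] by blast
    ultimately show False using u(1) by blast
  qed
qed

lemma dim_direct_sum:
  fixes S T :: "'k::field polyn set"
  assumes "finite A" "S \<subseteq> vs.span A" "T \<subseteq> vs.span A" "vs.subspace S" "vs.subspace T" "S \<inter> T = {0}"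
  shows "vs.dim {s + t | s t. s \<in> S \<and> t \<in> T} = vs.dim S + vs.dim T"
proof -
  obtain B where B: "B \<subseteq> S" "finite B" "vs.independent B" "S \<subseteq> vs.span B" "card B = vs.dim S"
    using fd_basis[OF assms(1,2)] by metis
  obtain C where C: "C \<subseteq> T" "finite C" "vs.independent C" "T \<subseteq> vs.span C" "card C = vs.dim T"
    using fd_basis[OF assms(1,3)] by metis
  have sp: "vs.span B = S" "vs.span C = T"
    using vs.span_minimal[OF B(1) assms(4)] vs.span_minimal[OF C(1) assms(5)] B(4) C(4) by auto
  have ind: "vs.independent (B \<union> C)" "B \<inter> C = {}"
    using independent_Un[of B C] B C assms sp by auto
  have "card (B \<union> C) = vs.dim {s + t | s t. s \<in> S \<and> t \<in> T}"
  proof (rule vs.basis_card_eq_dim[OF _ _ ind(1)])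
    have "0 \<in> S" "0 \<in> T" using assms vs.subspace_0 by auto
    show "B \<union> C \<subseteq> {s + t | s t. s \<in> S \<and> t \<in> T}"
    proof
      fix x assume "x \<in> B \<union> C"
      then consider "x \<in> S" | "x \<in> T" using B C by blast
      then show "x \<in> {s + t | s t. s \<in> S \<and> t \<in> T}"
      proof cases
        case 1
        then show ?thesis using \<open>0 \<in> T\<close> by (intro CollectI exI[of _ x] exI[of _ 0]) simp
      next
        case 2
        then show ?thesis using \<open>0 \<in> S\<close> by (intro CollectI exI[of _ 0] exI[of _ x]) simp
      qed
    qed
    show "{s + t | s t. s \<in> S \<and> t \<in> T} \<subseteq> vs.span (B \<union> C)"
      unfolding vs.span_Un sp by auto
  qed
  then show ?thesis using B C ind by (simp add: card_Un_disjoint)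
qed

lemma dim_le_add_card:
  fixes U :: "'k::field polyn set"
  assumes "finite A" "U \<subseteq> vs.span A" "finite S" "T \<subseteq> vs.span (U \<union> S)"
  shows "vs.dim T \<le> vs.dim U + card S"
proof -
  obtain B where B: "finite B" "U \<subseteq> vs.span B" "card B = vs.dim U"
    using fd_basis[OF assms(1,2)] by metis
  have "vs.span (U \<union> S) \<subseteq> vs.span (B \<union> S)"
  proof (intro vs.span_minimal vs.subspace_span Un_least)
    show "U \<subseteq> vs.span (B \<union> S)" using B(2) vs.span_mono[of B "B \<union> S"] by auto
    show "S \<subseteq> vs.span (B \<union> S)" using vs.span_superset[of "B \<union> S"] by auto
  qed
  then have "vs.dim T \<le> card (B \<union> S)" using assms B by (intro vs.dim_le_card) auto
  also have "\<dots> \<le> card B + card S" by (rule card_Un_le)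
  finally show ?thesis using B by simp
qed

section \<open>Counting monomials and forms\<close>

definition monoms_deg :: "nat set \<Rightarrow> nat \<Rightarrow> monom set" where
  "monoms_deg V q = {u. kys u \<subseteq> V \<and> mdeg u = q}"

definition forms :: "nat set \<Rightarrow> nat \<Rightarrow> 'k::field polyn set" where
  "forms V q = {p \<in> polys V. homog q p}"

text \<open>The number of monomials of degree \<open>q\<close> in \<open>m\<close> variables. The truncated subtraction gives
  the right value \<open>1\<close> for \<open>m = q = 0\<close>.\<close>

definition hilb :: "nat \<Rightarrow> nat \<Rightarrow> nat" where
  "hilb m q = (q + m - 1) choose q"

lemma hilb_0 [simp]: "hilb m 0 = 1" and hilb_0_Suc [simp]: "hilb 0 (Suc q) = 0"
  and hilb_1 [simp]: "hilb (Suc 0) q = 1"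
  by (simp_all add: hilb_def)

lemma hilb_Suc_Suc: "hilb (Suc m) (Suc q) = hilb (Suc m) q + hilb m (Suc q)"
  by (simp add: hilb_def)

lemma monoms_deg_0: "monoms_deg V 0 = {0}"
  by (auto simp: monoms_deg_def mdeg_eq_0_iff)

lemma monoms_deg_empty_Suc: "monoms_deg {} (Suc q) = {}"
  by (auto simp: monoms_deg_def)

lemma monoms_deg_insert_Suc:
  assumes "x \<notin> V"
  shows "monoms_deg (insert x V) (Suc q) = monoms_deg V (Suc q) \<union> (\<lambda>u. u
    + sgl x 1) ` monoms_deg (insert x V) q"
    "monoms_deg V (Suc q) \<inter> (\<lambda>u. u + sgl x 1) ` monoms_deg (insert x V) q = {}"
proof -
  have *: "u \<in> (\<lambda>u. u + sgl x 1) ` monoms_deg (insert x V) q"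
    if u: "u \<in> monoms_deg (insert x V) (Suc q)" "x \<in> kys u" for u
  proof -
    define v where "v = u - sgl x 1"
    have uv: "u = v + sgl x 1"
      using u by (intro poly_mapping_eqI) (auto simp: v_def lookup_add lookup_minus lookup_single
        when_def in_keys_iff)
    have "mdeg v = q" using u uv by (simp add: monoms_deg_def mdeg_add)
    moreover have "kys v \<subseteq> insert x V"
      using u by (auto simp: v_def monoms_deg_def in_keys_iff lookup_minus subset_iff)
    ultimately show ?thesis using uv by (auto simp: monoms_deg_def)
  qed
  have x: "lk (v + sgl x 1) x \<noteq> 0" for v :: monom by (simp add: lookup_add)
  show "monoms_deg (insert x V) (Suc q) = monoms_deg V (Suc q) \<union> (\<lambda>u. u
    + sgl x 1) ` monoms_deg (insert x V) q"
  proof (intro equalityI subsetI)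
    fix u assume "u \<in> monoms_deg (insert x V) (Suc q)"
    then show "u \<in> monoms_deg V (Suc q) \<union> (\<lambda>u. u + sgl x 1) ` monoms_deg (insert x V) q"
      using * by (cases "x \<in> kys u") (auto simp: monoms_deg_def)
  next
    fix u assume "u \<in> monoms_deg V (Suc q) \<union> (\<lambda>u. u + sgl x 1) ` monoms_deg (insert x V) q"
    then show "u \<in> monoms_deg (insert x V) (Suc q)"
      using keys_add by (fastforce simp: monoms_deg_def mdeg_add split: if_splits)
  qed
  show "monoms_deg V (Suc q) \<inter> (\<lambda>u. u + sgl x 1) ` monoms_deg (insert x V) q = {}"
    using x assms by (fastforce simp: monoms_deg_def in_keys_iff subset_iff)
qed

lemma finite_card_monoms_deg:
  assumes "finite V"
  shows "finite (monoms_deg V q) \<and> card (monoms_deg V q) = hilb (card V) q"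
  using assms
proof (induction V arbitrary: q)
  case empty
  then show ?case by (cases q) (simp_all add: monoms_deg_0 monoms_deg_empty_Suc)
next
  case (insert x V)
  show ?case
  proof (induction q)
    case 0
    then show ?case by (simp add: monoms_deg_0)
  next
    case (Suc q)
    have "inj (\<lambda>u :: monom. u + sgl x 1)" by (auto simp: inj_def)
    then have "card ((\<lambda>u. u + sgl x 1) ` monoms_deg (insert x V) q)
      = card (monoms_deg (insert x V) q)"
      by (intro card_image) (auto intro: inj_on_subset)
    then show ?case
      using Suc insert.IH[of "Suc q"] insert.hyps monoms_deg_insert_Suc[OF insert.hyps(2), of q]
      by (simp add: card_Un_disjoint hilb_Suc_Suc)
  qed
qed

lemmas finite_monoms_deg = finite_card_monoms_deg[THEN conjunct1]
lemmas card_monoms_deg = finite_card_monoms_deg[THEN conjunct2]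

lemma mpoly_inj: "inj (mpoly :: monom \<Rightarrow> 'k::field polyn)"
  by (auto simp: inj_def mpoly_def dest!: arg_cong[of _ _ kys])

lemma lookup_sum_single:
  assumes "finite XS" "p = (\<Sum>u\<in>XS. sgl u (f u))"
  shows "lk p v = (if v \<in> XS then f v else 0)"
  using assms(1) unfolding assms(2) by (simp add: lookup_sum lookup_single when_def)

lemma scalar_mult_mpoly: "scalar_mult c (mpoly u) = sgl u c"
  by (simp add: scalar_mult_def single_eq)

lemma span_mpoly:
  assumes "finite XS"
  shows "vs.span (mpoly ` XS) = {p. kys p \<subseteq> XS}"
proof (intro equalityI subsetI)
  fix p :: "'a polyn" assume "p \<in> vs.span (mpoly ` XS)"
  then obtain f where "(\<Sum>v\<in>mpoly ` XS. scalar_mult (f v) v) = p"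
    unfolding vs.span_finite[OF finite_imageI[OF assms]] by auto
  moreover have "inj_on (mpoly :: monom \<Rightarrow> 'a polyn) XS" by (rule inj_on_subset[OF mpoly_inj]) simp
  ultimately have "p = (\<Sum>u\<in>XS. sgl u (f (mpoly u)))" by (simp add: sum.reindex scalar_mult_mpoly)
  from lookup_sum_single[OF assms this] show "p \<in> {p. kys p \<subseteq> XS}"
    by (auto simp: in_keys_iff split: if_splits)
next
  fix p :: "'a polyn" assume "p \<in> {p. kys p \<subseteq> XS}"
  then have "p = (\<Sum>u\<in>XS. sgl u (lk p u))"
    using lookup_sum_single[OF assms refl, of "lk p"]
    by (intro poly_mapping_eqI) (auto simp: in_keys_iff subset_iff)
  also have "\<dots> \<in> vs.span (mpoly ` XS)"
    unfolding scalar_mult_mpoly[symmetric] by (intro vs.span_sum vs.span_scale vs.span_base imageI)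
  finally show "p \<in> vs.span (mpoly ` XS)" .
qed

lemma independent_mpoly:
  assumes "finite XS"
  shows "vs.independent (mpoly ` XS :: 'k::field polyn set)"
  unfolding vs.dependent_finite[OF finite_imageI[OF assms]]
proof (intro notI, elim exE conjE)
  fix f assume f: "\<exists>v\<in>mpoly ` XS. f v \<noteq> 0" "(\<Sum>v\<in>mpoly ` XS. scalar_mult (f v) v :: 'k polyn) = 0"
  have "inj_on (mpoly :: monom \<Rightarrow> 'k polyn) XS" by (rule inj_on_subset[OF mpoly_inj]) simp
  then have "0 = (\<Sum>u\<in>XS. sgl u (f (mpoly u)))" using f by (simp add: sum.reindex scalar_mult_mpoly)
  from lookup_sum_single[OF assms this] have "f (mpoly u) = 0" if "u \<in> XS" for u
    using that by (metis lookup_zero)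
  then show False using f by auto
qed

lemma dim_span_mpoly:
  assumes "finite XS" "S = {p. kys p \<subseteq> XS}"
  shows "vs.dim (S :: 'k::field polyn set) = card XS"
proof -
  have "vs.dim S = card (mpoly ` XS :: 'k polyn set)"
    unfolding assms(2) span_mpoly[OF assms(1), symmetric] vs.dim_span
    using independent_mpoly[OF assms(1)] by (rule vs.dim_eq_card_independent)
  moreover have "inj_on (mpoly :: monom \<Rightarrow> 'k polyn) XS" by (rule inj_on_subset[OF mpoly_inj]) simp
  ultimately show ?thesis by (simp add: card_image)
qed

lemma forms_eq: "forms V q = {p. kys p \<subseteq> monoms_deg V q}"
  by (auto simp: forms_def monoms_deg_def polys_def homog_def)

lemma forms_span: "finite V \<Longrightarrow> forms V q \<subseteq> vs.span (mpoly ` monoms_deg V q)"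
  by (simp add: forms_eq span_mpoly finite_monoms_deg)

lemma dim_forms: "finite V \<Longrightarrow> vs.dim (forms V q :: 'k::field polyn set) = hilb (card V) q"
  by (simp add: dim_span_mpoly[OF finite_monoms_deg forms_eq] card_monoms_deg)

lemma subspace_forms: "vs.subspace (forms V q)"
  unfolding vs.subspace_def forms_def scalar_mult_def
  using homog_mult[of 0 "const _" q] by (auto intro: polys_intros homog_add)

definition graded_part :: "'k::field polyn set \<Rightarrow> nat \<Rightarrow> 'k polyn set" where
  "graded_part J q = {p \<in> J. homog q p}"

lemma graded_part_forms: "is_ideal V J \<Longrightarrow> graded_part J q \<subseteq> forms V q"
  by (auto simp: graded_part_def forms_def is_ideal_def)

lemma subspace_graded_part: "is_ideal V J \<Longrightarrow> vs.subspace (graded_part J q)"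
  unfolding vs.subspace_def graded_part_def scalar_mult_def is_ideal_def
  using homog_mult[of 0 "const _" q] by (auto intro: homog_add)

lemma graded_part_span: "finite V \<Longrightarrow> is_ideal V J
  \<Longrightarrow> graded_part J q \<subseteq> vs.span (mpoly ` monoms_deg V q)"
  using graded_part_forms forms_span by blast

text \<open>Degree 0 is left out because of the one drop, from \<open>hilb 0 0 = 1\<close> to
  \<open>hilb 0 1 = 0\<close>.\<close>

lemma hilb_mono: "1 \<le> q \<Longrightarrow> q \<le> r \<Longrightarrow> hilb m q \<le> hilb m r"
proof (induction "r - q" arbitrary: r)
  case (Suc d)
  then obtain r' where r': "r = Suc r'" by (cases r) auto
  have "hilb m r' \<le> hilb m r" unfolding r'
    using Suc r' by (cases m; cases r') (auto simp: hilb_Suc_Suc)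
  moreover have "hilb m q \<le> hilb m r'" using Suc r' by auto
  ultimately show ?case by simp
qed simp

text \<open>The difference is a sum of \<open>e\<close> first differences
  \<open>hilb k (q - i)\<close>, each at most \<open>hilb k q\<close>; the bound on \<open>e\<close>
  keeps their degrees positive.\<close>

lemma hilb_diff_le: "Suc e \<le> q \<Longrightarrow> hilb (Suc k) q \<le> hilb (Suc k) (q - e) + e * hilb k q"
proof (induction e)
  case (Suc e)
  then obtain r where r: "q - e = Suc r" by (cases "q - e") auto
  have "hilb (Suc k) (q - e) = hilb (Suc k) (q - Suc e) + hilb k (q - e)"
    using r by (metis hilb_Suc_Suc Suc_diff_Suc Suc.prems Suc_le_eq Suc_lessD diff_Suc_Suc
      nat.inject)
  moreover have "hilb k (q - e) \<le> hilb k q" using Suc by (intro hilb_mono) auto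
  ultimately show ?case using Suc by auto
qed simp

text \<open>The alternating sum is the Hilbert function of a complete intersection of degrees
  \<open>d\<close> and \<open>e\<close>, written without subtraction. It is a sum of
  \<open>d * e\<close> mixed second differences, each at most \<open>hilb k q\<close>.\<close>

lemma hilb_diff2_le:
  "Suc (d + e) \<le> q \<Longrightarrow> hilb (Suc (Suc k)) q + hilb (Suc (Suc k)) (q - e - d)
    \<le> hilb (Suc (Suc k)) (q - d) + hilb (Suc (Suc k)) (q - e) + d * e * hilb k q"
proof (induction d)
  case (Suc d)
  have step: "hilb (Suc (Suc k)) r = hilb (Suc (Suc k)) (r - 1) + hilb (Suc k) r" if "r \<ge> 1" for r
    using that by (cases r) (auto simp: hilb_Suc_Suc)
  have 1: "hilb (Suc (Suc k)) (q - d) = hilb (Suc (Suc k)) (q - Suc d) + hilb (Suc k) (q - d)"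
    using step[of "q - d"] Suc.prems by simp
  have 2: "hilb (Suc (Suc k)) (q - e - d)
    = hilb (Suc (Suc k)) (q - e - Suc d) + hilb (Suc k) (q - e - d)"
    using step[of "q - e - d"] Suc.prems by simp
  have "hilb (Suc k) (q - d) \<le> hilb (Suc k) (q - e - d) + e * hilb k (q - d)"
    using Suc.prems hilb_diff_le[of e "q - d" k] by (simp add: add.commute)
  moreover have "hilb k (q - d) \<le> hilb k q" using Suc by (intro hilb_mono) auto
  then have "e * hilb k (q - d) \<le> e * hilb k q" by (rule mult_le_mono2)
  moreover have "Suc d * e * hilb k q = d * e * hilb k q + e * hilb k q"
    by (simp add: algebra_simps)
  moreover note Suc.IH[OF Suc_leD[OF Suc.prems[unfolded add_Suc]]] 1 2
  moreover have "\<lbrakk>a \<le> b + c; c \<le> z; s = dz + z; x + m1 \<le> n1 + y + dz; n1 = n2 + a; m1 = m2 + b\<rbrakk>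
    \<Longrightarrow> x + m2 \<le> n2 + y + s" for a b c z s dz x y m1 m2 n1 n2 :: nat by simp
  ultimately show ?case by blast
qed simp

lemma hilb_growth: "\<exists>q\<ge>q0. C * hilb k q < hilb (Suc k) q"
proof (cases k)
  case 0
  then show ?thesis by (intro exI[of _ "Suc q0"]) auto
next
  case (Suc l)
  \<comment> \<open>By the absorption identity the quotient of the two counts is
    \<open>(q + k) / k\<close>, which exceeds \<open>C\<close> once
    \<open>q \<ge> C * k\<close>.\<close>
  define q where "q = C * k + q0"
  have eq: "(q + k) * hilb k q = k * hilb (Suc k) q"
    using binomial_absorb_comp[of "q + k" q] Suc by (simp add: hilb_def)
  have "hilb k q > 0" using Suc by (simp add: hilb_def)
  moreover have "C * k < q + k" using Suc by (simp add: q_def)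
  ultimately have "C * k * hilb k q < (q + k) * hilb k q" by (intro mult_less_mono1)
  then have "k * (C * hilb k q) < k * hilb (Suc k) q" unfolding eq by (simp only: mult_ac)
  then have "C * hilb k q < hilb (Suc k) q" by simp
  then show ?thesis by (intro exI[of _ q]) (auto simp: q_def)
qed

section \<open>The structure of ideals with a critical Hilbert function\<close>

definition homog_ideal :: "nat set \<Rightarrow> 'k::field polyn set \<Rightarrow> bool" where
  "homog_ideal V J \<longleftrightarrow> is_ideal V J \<and> (\<forall>p\<in>J. \<forall>q. homog_part q p \<in> J)"

lemma isidD:
  assumes "is_ideal V J"
  shows "J \<subseteq> polys V" "0 \<in> J" "p \<in> J \<Longrightarrow> q \<in> J \<Longrightarrow> p + q \<in> J" "a \<in> polys V \<Longrightarrow> p \<in> J \<Longrightarrow> a * p \<in> J"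
  using assms by (auto simp: is_ideal_def)

lemma is_ideal_diff: "is_ideal V J \<Longrightarrow> p \<in> J \<Longrightarrow> q \<in> J \<Longrightarrow> p - q \<in> J"
  using gen_ideal_diff[of p V J q] gen_ideal_is_ideal[of V J] by simp

lemma is_ideal_sum: "is_ideal V J \<Longrightarrow> (\<And>i. i \<in> S \<Longrightarrow> f i \<in> J) \<Longrightarrow> sum f S \<in> J"
  using gen_ideal_sum[of S f V J] gen_ideal_is_ideal[of V J] by simp

lemma homog_part_sum: "homog_part q (sum f S) = (\<Sum>i\<in>S. homog_part q (f i))"
  by (induction S rule: infinite_finite_induct) (simp_all add: homog_part_add)

lemma homog_ideal_gen_ideal:
  assumes G: "G \<subseteq> polys V" "\<And>g q. g \<in> G \<Longrightarrow> homog_part q g \<in> gen_ideal V G"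
  shows "homog_ideal V (gen_ideal V G)"
  unfolding homog_ideal_def
proof (intro conjI ballI allI is_ideal_gen_ideal G(1))
  fix p q assume "p \<in> gen_ideal V G"
  then show "homog_part q p \<in> gen_ideal V G"
  proof (induction p rule: gen_ideal.induct)
    case (gen_ideal_step p a g)
    have "a * g = (\<Sum>i\<le>tot_deg a. homog_part i a * g)"
      by (simp add: sum_homog_part flip: sum_distrib_right)
    then have "homog_part q (a * g) = (\<Sum>i\<le>tot_deg a. homog_part q (homog_part i a * g))"
      by (simp only: homog_part_sum)
    also have "\<dots> = (\<Sum>i\<le>tot_deg a. if i \<le> q then homog_part i a * homog_part (q - i) g else 0)"
      by (intro sum.cong refl homog_part_mult_homog' homog_homog_part)
    also have "\<dots> \<in> gen_ideal V G"
      using gen_ideal_step G by (intro gen_ideal_sum) (auto intro!: gen_ideal_mult homog_part_polys)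
    finally show ?case using gen_ideal_step by (simp add: homog_part_add gen_ideal_add)
  qed simp
qed

lemma homog_ideal_gen_ideal_insert:
  assumes "homog_ideal V J" "f \<in> polys V" "homog d f"
  shows "homog_ideal V (gen_ideal V (insert f J))"
proof (rule homog_ideal_gen_ideal)
  show "insert f J \<subseteq> polys V" using assms by (auto simp: homog_ideal_def is_ideal_def)
  fix g q assume "g \<in> insert f J"
  then have "g = f \<or> g \<in> J" by blast
  then show "homog_part q g \<in> gen_ideal V (insert f J)"
    using assms by (auto simp: homog_part_homog homog_ideal_def intro: gen_ideal_base)
qed

lemma graded_part_gen_ideal_insert:
  assumes J: "homog_ideal V J" and f: "homog d f" and x:
    "x \<in> graded_part (gen_ideal V (insert f J)) q" and q: "d \<le> q"
  obtains r a where "r \<in> graded_part J q" "a \<in> forms V (q - d)" "x = r + f * a"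
proof -
  obtain r a where ra: "r \<in> J" "a \<in> polys V" "x = r + f * a"
    using x gen_ideal_is_ideal[of V J] J unfolding graded_part_def gen_ideal_insert
      homog_ideal_def by (auto simp: mult.commute)
  have "x = homog_part q x" using x homog_part_homog[of q x q] by (auto simp: graded_part_def)
  also have "\<dots> = homog_part q r + f * homog_part (q - d) a" using q
    by (simp add: ra(3) homog_part_add homog_part_mult_homog'[OF f])
  finally show ?thesis using ra J that[of "homog_part q r" "homog_part (q - d) a"]
    by (auto simp: graded_part_def forms_def homog_ideal_def homog_part_polys)
qed

lemma graded_part_polys_UNIV: "graded_part (polys V) q = forms V q"
  by (auto simp: graded_part_def forms_def)

lemma graded_part_mult_forms:
  assumes f: "f \<in> polys V" "homog d f" "f \<noteq> 0"
  shows "graded_part (gen_ideal V {f}) (d + q) = (*) f ` forms V q"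
proof (intro equalityI subsetI)
  fix x assume x: "x \<in> graded_part (gen_ideal V {f}) (d + q)"
  then obtain a where a: "x = f * a" "a \<in> polys V"
    by (auto simp: graded_part_def gen_ideal_singleton mult.commute)
  have "x = homog_part (d + q) x" using x homog_part_homog[of "d + q" x "d + q"]
    by (auto simp: graded_part_def)
  also have "\<dots> = f * homog_part q a" by (simp add: a homog_part_mult_homog[OF f(2)])
  finally show "x \<in> (*) f ` forms V q" using a by (auto simp: forms_def homog_part_polys)
next
  fix x assume "x \<in> (*) f ` forms V q"
  then show "x \<in> graded_part (gen_ideal V {f}) (d + q)"
    using homog_mult[OF f(2)] by (auto simp: graded_part_def forms_def gen_ideal_singleton
      mult.commute)
qed

section \<open>Codimension of ideals without a common divisor\<close>

context
  fixes V :: "nat set" and k :: nat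
  assumes V: "finite V" "card V = Suc (Suc k)"
begin

text \<open>As \<open>p\<close> is prime and does not divide \<open>g\<close>, multiplication by
  \<open>g\<close> is injective modulo \<open>p\<close>. It carries a complement of
  \<open>(p)\<close> in degree \<open>q - e\<close> to a space meeting \<open>(p)\<close> in degree
  \<open>q\<close> only in 0, and the count is that of a complete intersection.\<close>

lemma codim_prime_pair:
  fixes p g :: "'k::field polyn"
  assumes p: "irred p" "p \<in> polys V" "homog d p" and g: "g \<in> polys V" "homog e g" "\<not> p dvd g"
    and q: "Suc (d + e) \<le> q"
  shows "hilb (card V) q \<le> vs.dim (graded_part (gen_ideal V {p, g}) q) + d * e * hilb k q"
proof -
  have p0: "p \<noteq> 0" using p irred_nonzero by auto
  have g0: "g \<noteq> 0" using g by auto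
  have fin: "finite (mpoly ` monoms_deg V r :: 'k polyn set)" for r
    using finite_monoms_deg[OF V(1)] by simp
  let ?P = "\<lambda>r. graded_part (gen_ideal V {p}) r"
  have isP: "is_ideal V (gen_ideal V {p})" using p by (intro is_ideal_gen_ideal) auto
  have dimP: "vs.dim (?P r) = hilb (card V) (r - d)" if "d \<le> r" for r
    using graded_part_mult_forms[OF p(2,3) p0, of "r - d"] that
      dim_mult_image[OF p0 fin forms_span[OF V(1)], of "r - d"] dim_forms[OF V(1), of "r - d"]
        by simp
  obtain S where S: "finite S" "S \<subseteq> forms V (q - e)" "card S + vs.dim (?P (q - e))
    = vs.dim (forms V (q - e) :: 'k polyn set)"
    "vs.independent S" "?P (q - e) \<inter> vs.span S = {0}"
    using fd_complement[OF fin forms_span[OF V(1)] graded_part_forms[OF isP]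
      subspace_graded_part[OF isP] subspace_forms] by metis
  have cS: "card S + hilb (card V) (q - e - d) = hilb (card V) (q - e)"
    using S(3) dimP[of "q - e"] q dim_forms[OF V(1), of "q - e", where ?'k='k] by simp
  have spS: "vs.span S \<subseteq> forms V (q - e)" using S subspace_forms by (intro vs.span_minimal)
  let ?T = "vs.span ((*) g ` S)"
  have gS: "vs.independent ((*) g ` S)" "card ((*) g ` S) = card S"
    using independent_mult_image[OF g0 S(1,4)] by auto
  have dimT: "vs.dim ?T = card S" using vs.dim_span_eq_card_independent[OF gS(1)] gS(2)
    by (simp only:)
  have T: "?T = (*) g ` vs.span S" by (rule span_mult_image)
  have gs: "g * s \<in> forms V q" if "s \<in> forms V (q - e)" for s
    using that g homog_mult[of e g "q - e" s] q by (auto simp: forms_def intro: polys_mult)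
  have TH: "?T \<subseteq> forms V q" unfolding T using gs spS by auto
  have int: "?P q \<inter> ?T = {0}"
  proof -
    have "x = 0" if x: "x \<in> ?P q" "x \<in> ?T" for x
    proof -
      obtain s where s: "s \<in> vs.span S" "x = g * s" using x T by auto
      have "p dvd g * s" using x s by (auto simp: graded_part_def gen_ideal_singleton)
      moreover have sV: "s \<in> polys V" "homog (q - e) s" using s spS by (auto simp: forms_def)
      ultimately have "p dvd s" using irred_prime_on[OF V(1) p(2,1)] g by (auto simp: prime_on_def)
      then obtain b where b: "s = p * b" ..
      have "s \<in> gen_ideal V {p}"
      proof (cases "s = 0")
        case False
        then have "b \<in> polys V" using polys_factor2[of p b V] b sV by simp
        then show ?thesis using b by (auto simp: gen_ideal_singleton mult.commute)
      qed simp
      then have "s \<in> ?P (q - e) \<inter> vs.span S" using s sV by (simp add: graded_part_def)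
      then show "x = 0" using S(5) s by simp
    qed
    moreover have "0 \<in> ?P q" by (simp add: graded_part_def)
    ultimately show ?thesis using vs.span_zero by blast
  qed
  have "vs.dim {s + t | s t. s \<in> ?P q \<and> t \<in> ?T} = vs.dim (?P q) + vs.dim ?T"
    using dim_direct_sum[OF fin graded_part_span[OF V(1) isP] _ subspace_graded_part[OF isP]
      vs.subspace_span int]
      TH forms_span[OF V(1), of q] by blast
  moreover have is2: "is_ideal V (gen_ideal V {p, g})" using p g by (intro is_ideal_gen_ideal) auto
  have "{s + t | s t. s \<in> ?P q \<and> t \<in> ?T} \<subseteq> graded_part (gen_ideal V {p, g}) q"
  proof
    fix x assume "x \<in> {s + t | s t. s \<in> ?P q \<and> t \<in> ?T}"
    then obtain s t where st: "x = s + t" "s \<in> ?P q" "t \<in> ?T" by blast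
    obtain b where b: "b \<in> vs.span S" "t = g * b" using st T by auto
    have bV: "b \<in> polys V" using b spS by (auto simp: forms_def)
    have "s \<in> gen_ideal V {p, g}" using st gen_ideal_mono[of "{p}" "{p, g}" V]
      by (auto simp: graded_part_def)
    moreover have "t \<in> gen_ideal V {p, g}" unfolding b(2)
      by (rule gen_ideal_mult2[OF gen_ideal_base bV]) simp
    moreover have "homog q s" "homog q t" using st TH by (auto simp: graded_part_def forms_def)
    ultimately show "x \<in> graded_part (gen_ideal V {p, g}) q" using st
      by (auto simp: graded_part_def intro: gen_ideal_add homog_add)
  qed
  then have "vs.dim {s + t | s t. s \<in> ?P q \<and> t \<in> ?T} \<le> vs.dim (graded_part (gen_ideal V {p, g}) q)"
    by (rule fd_dim_mono[OF fin graded_part_span[OF V(1) is2]])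
  ultimately have "hilb (card V) (q - d) + card S \<le> vs.dim (graded_part (gen_ideal V {p, g}) q)"
    using dimP[of q] dimT q by simp
  moreover have "hilb (card V) q + hilb (card V) (q - e - d) \<le> hilb (card V) (q - d)
    + hilb (card V) (q - e) + d * e * hilb k q"
    using hilb_diff2_le[OF q, of k] V by simp
  ultimately show ?thesis using cS by linarith
qed

text \<open>Multiplication by \<open>p\<close> maps the quotient by \<open>(J, f)\<close>, shifted
  by \<open>d\<close>, onto \<open>(J, p) / (J, p f)\<close>. The inequality compares the dimensions
  of the two, with subtractions moved across.\<close>

lemma codim_filtration:
  fixes p f :: "'k::field polyn"
  assumes J: "homog_ideal V J" and p: "p \<in> polys V" "homog d p" and f: "f \<in> polys V" "homog e f"
    and q: "d \<le> q"
  shows "vs.dim (graded_part (gen_ideal V (insert p J)) q)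
    + vs.dim (graded_part (gen_ideal V (insert f J)) (q - d))
      \<le> vs.dim (graded_part (gen_ideal V (insert (p * f) J)) q) + hilb (card V) (q - d)"
proof -
  have fin: "finite (mpoly ` monoms_deg V r :: 'k polyn set)" for r
    using finite_monoms_deg[OF V(1)] by simp
  have pf: "p * f \<in> polys V" "homog (d + e) (p * f)" using p f
    by (auto intro: polys_mult homog_mult)
  have h1: "homog_ideal V (gen_ideal V (insert p J))" and h2:
    "homog_ideal V (gen_ideal V (insert f J))" and h3:
      "homog_ideal V (gen_ideal V (insert (p * f) J))"
    using homog_ideal_gen_ideal_insert[OF J] p f pf by blast+
  then have i1: "is_ideal V (gen_ideal V (insert p J))" and i2:
    "is_ideal V (gen_ideal V (insert f J))"
    and i3: "is_ideal V (gen_ideal V (insert (p * f) J))" by (auto simp: homog_ideal_def)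
  let ?U1 = "graded_part (gen_ideal V (insert p J)) q" and ?U2 =
    "graded_part (gen_ideal V (insert f J)) (q - d)"
    and ?U = "graded_part (gen_ideal V (insert (p * f) J)) q"
  obtain S where S: "finite S" "S \<subseteq> forms V (q - d)" "card S + vs.dim ?U2
    = vs.dim (forms V (q - d) :: 'k polyn set)"
    "forms V (q - d) \<subseteq> vs.span (?U2 \<union> S)"
    using fd_complement[OF fin forms_span[OF V(1)] graded_part_forms[OF i2]
      subspace_graded_part[OF i2] subspace_forms] by metis
  have pU2: "p * u \<in> ?U" if u: "u \<in> ?U2" for u
  proof -
    obtain r a where ra: "r \<in> J" "a \<in> polys V" "u = r + a * f"
      using u gen_ideal_is_ideal[of V J] J
        unfolding graded_part_def gen_ideal_insert homog_ideal_def by auto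
    have "p * u = p * r + a * (p * f)" by (simp add: ra algebra_simps)
    moreover have "p * r \<in> J" using J p ra by (auto simp: homog_ideal_def is_ideal_def)
    ultimately have "p * u \<in> gen_ideal V (insert (p * f) J)"
      using ra gen_ideal_is_ideal[of V J] J unfolding gen_ideal_insert homog_ideal_def by auto
    moreover have "homog q (p * u)" using homog_mult[OF p(2), of "q - d" u] u q
      by (simp add: graded_part_def)
    ultimately show ?thesis by (simp add: graded_part_def)
  qed
  have "?U1 \<subseteq> vs.span (?U \<union> (*) p ` S)"
  proof
    fix x assume "x \<in> ?U1"
    then obtain r a where ra: "r \<in> graded_part J q" "a \<in> forms V (q - d)" "x = r + p * a"
      using graded_part_gen_ideal_insert[OF J p(2) _ q] by metis
    have "r \<in> ?U" using ra gen_ideal_base[of r "insert (p * f) J" V] by (auto simp: graded_part_def)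
    then have 1: "r \<in> vs.span (?U \<union> (*) p ` S)" by (intro vs.span_base) simp
    have "p * a \<in> (*) p ` vs.span (?U2 \<union> S)" using ra S by blast
    also have "\<dots> = vs.span ((*) p ` ?U2 \<union> (*) p ` S)"
      by (simp only: span_mult_image[symmetric] image_Un)
    also have "\<dots> \<subseteq> vs.span (?U \<union> (*) p ` S)" using pU2 by (intro vs.span_mono) blast
    finally show "x \<in> vs.span (?U \<union> (*) p ` S)" unfolding ra(3) using 1 by (intro vs.span_add)
  qed
  then have "vs.dim ?U1 \<le> vs.dim ?U + card ((*) p ` S)"
    using S(1) by (intro dim_le_add_card[OF fin graded_part_span[OF V(1) i3]]) auto
  also have "card ((*) p ` S) \<le> card S" using S(1) by (rule card_image_le)
  finally show "vs.dim ?U1 + vs.dim ?U2 \<le> vs.dim ?U + hilb (card V) (q - d)"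
    using S(3) dim_forms[OF V(1), of "q - d", where ?'k='k] by simp
qed

text \<open>An ideal without common prime divisor has codimension at least two. Filtering by the prime
  factors of \<open>f\<close> reduces the count to the complete intersections \<open>(p, g)\<close>.\<close>

lemma codim_bound:
  fixes f :: "'k::field polyn"
  assumes J: "homog_ideal V J" and coprime: "\<And>p. irred p \<Longrightarrow> p \<in> polys V \<Longrightarrow> \<exists>g\<in>J. \<not> p dvd g"
    and f: "f \<in> polys V" "homog (tot_deg f) f" "f \<noteq> 0"
  shows "\<exists>C q0. \<forall>q\<ge>q0. hilb (card V) q \<le> vs.dim (graded_part (gen_ideal V (insert f J)) q)
    + C * hilb k q"
  using f
proof (induction "tot_deg f" arbitrary: f rule: less_induct)
  case less
  show ?case
  proof (cases "tot_deg f = 0")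
    case True
    then obtain c where c: "f = const c" using tot_deg_0_const by blast
    then have c0: "c \<noteq> 0" using less by auto
    have "p \<in> gen_ideal V (insert f J)" if "p \<in> polys V" for p
    proof -
      have "(p * const (inverse c)) * f \<in> gen_ideal V (insert f J)"
        using that by (intro gen_ideal_mult gen_ideal_base polys_mult) auto
      moreover have "(p * const (inverse c)) * f = p * (const c * const (inverse c))"
        by (simp only: c mult_ac)
      ultimately show ?thesis using const_inverse[OF c0] by simp
    qed
    moreover have "insert f J \<subseteq> polys V" using less J by (auto simp: homog_ideal_def is_ideal_def)
    ultimately have "gen_ideal V (insert f J) = polys V" using gen_ideal_polys by blast
    then show ?thesis using dim_forms[OF V(1), where ?'k='k] by (simp add: graded_part_polys_UNIV)
  next
    case False
    then obtain p where p: "irred p" "p dvd f" using ex_irred_dvd by auto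
    then obtain f' where f': "f = p * f'" by blast
    have pf0: "p * f' \<noteq> 0" "p \<noteq> 0" "f' \<noteq> 0" using f' less by auto
    have pV: "p \<in> polys V" "f' \<in> polys V" using polys_factor polys_factor2 f' less.prems pf0
      by blast+
    define d where "d = tot_deg p"
    have hom: "homog d p" "homog (tot_deg f') f'"
      using homog_factor homog_factor2 less.prems(2) pf0 unfolding f' d_def by blast+
    have tl: "tot_deg f' < tot_deg f" using tot_deg_mult[of p f'] pf0 p f' by (auto simp: irred_def)
    obtain C q0 where C: "\<And>q. q \<ge> q0 \<Longrightarrow> hilb (card V) q
      \<le> vs.dim (graded_part (gen_ideal V (insert f' J)) q) + C * hilb k q"
      using less.hyps[OF tl pV(2) hom(2) pf0(3)] by blast
    obtain g0 where g0: "g0 \<in> J" "\<not> p dvd g0" using coprime p(1) pV(1) by blast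
    \<comment> \<open>Passing to a homogeneous component that \<open>p\<close> does not divide makes
      the pair homogeneous; the component stays in \<open>J\<close>.\<close>
    have "\<exists>i. \<not> p dvd homog_part i g0"
    proof (rule ccontr)
      assume "\<nexists>i. \<not> p dvd homog_part i g0"
      then have "p dvd (\<Sum>i\<le>tot_deg g0. homog_part i g0)" by (intro dvd_sum) auto
      then show False using g0 by (simp add: sum_homog_part)
    qed
    then obtain e where e: "\<not> p dvd homog_part e g0" by blast
    define g where "g = homog_part e g0"
    have g: "g \<in> J" "g \<in> polys V" "homog e g" "\<not> p dvd g"
      using g0 e J by (auto simp: g_def homog_ideal_def is_ideal_def)
    have hip: "homog_ideal V (gen_ideal V (insert p J))"
      using homog_ideal_gen_ideal_insert[OF J pV(1) hom(1)] .
    then have ip: "is_ideal V (gen_ideal V (insert p J))" by (simp add: homog_ideal_def)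
    \<comment> \<open>The prime \<open>p\<close> contributes \<open>d * e\<close> from its complete
      intersection with \<open>g\<close>, and \<open>f'\<close> contributes \<open>C\<close>. The
      bound for \<open>f'\<close> is used in degree \<open>q - d\<close>, hence the shifted
      threshold.\<close>
    show ?thesis
    proof (rule exI[of _ "d * e + C"], rule exI[of _ "Suc (d + e + q0)"], intro allI impI)
      fix q assume q: "Suc (d + e + q0) \<le> q"
      have "graded_part (gen_ideal V {p, g}) q \<subseteq> graded_part (gen_ideal V (insert p J)) q"
        using gen_ideal_mono[of "{p, g}" "insert p J" V] g by (auto simp: graded_part_def)
      then have 1: "vs.dim (graded_part (gen_ideal V {p, g}) q)
        \<le> vs.dim (graded_part (gen_ideal V (insert p J)) q)"
        by (rule fd_dim_mono[OF finite_imageI[OF finite_monoms_deg[OF V(1)]] graded_part_span[OF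
          V(1) ip]])
      have 2: "hilb (card V) q \<le> vs.dim (graded_part (gen_ideal V {p, g}) q) + d * e * hilb k q"
        using q by (intro codim_prime_pair[OF p(1) pV(1) hom(1) g(2-4)]) auto
      have 3: "hilb (card V) (q - d) \<le> vs.dim (graded_part (gen_ideal V (insert f' J)) (q - d))
        + C * hilb k (q - d)"
        using q by (intro C) auto
      have "hilb k (q - d) \<le> hilb k q" using q by (intro hilb_mono) auto
      then have 4: "C * hilb k (q - d) \<le> C * hilb k q" by (rule mult_le_mono2)
      have 5: "vs.dim (graded_part (gen_ideal V (insert p J)) q)
        + vs.dim (graded_part (gen_ideal V (insert f' J)) (q - d))
        \<le> vs.dim (graded_part (gen_ideal V (insert f J)) q) + hilb (card V) (q - d)"
        unfolding f' using codim_filtration[OF J pV(1) hom(1) pV(2) hom(2)] q by simp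
      have 6: "(d * e + C) * hilb k q = d * e * hilb k q + C * hilb k q"
        by (simp add: algebra_simps)
      show "hilb (card V) q \<le> vs.dim (graded_part (gen_ideal V (insert f J)) q) + (d * e
        + C) * hilb k q"
        unfolding 6 using 1 2 3 4 5 by linarith
    qed
  qed
qed

end

section \<open>Hilbert functions of universal lexsegment ideals\<close>

text \<open>The dimensions \<open>c q\<close> of the homogeneous components of the universal lexsegment ideals \<open>L =
  x\<^sub>1\<^sup>a (x\<^sub>1, L')\<close> in \<open>m\<close> variables, where \<open>L'\<close> is such an ideal in one variable less, and \<open>s\<close>
  is the number of generators. The step distinguishes degrees in order to avoid truncated
  subtraction.\<close>

inductive lex_hilbert :: "nat \<Rightarrow> (nat \<Rightarrow> nat) \<Rightarrow> nat \<Rightarrow> bool" where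
  lex_hilbert_zero: "(\<And>q. c q = 0) \<Longrightarrow> lex_hilbert m c 0"
| lex_hilbert_step: "lex_hilbert m c s \<Longrightarrow> (\<And>q. q < a \<Longrightarrow> c' q = 0) \<Longrightarrow> c' a = c 0 \<Longrightarrow>
    (\<And>q. c' (Suc (a + q)) = hilb (Suc m) q + c (Suc q)) \<Longrightarrow> lex_hilbert (Suc m) c' (Suc s)"

text \<open>These ideals are proper. In \<open>lex_hilbert_step\<close> it follows that the first
  nonzero component is in degree \<open>a + 1\<close>.\<close>

lemma lex_hilbert_0: "lex_hilbert m c s \<Longrightarrow> c 0 = 0"
proof (induction rule: lex_hilbert.induct)
  case (lex_hilbert_step m c s a c')
  then show ?case by (cases a) auto
qed auto

lemma hilb_pos: "hilb (Suc m) q > 0"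
  by (simp add: hilb_def)

lemma lex_hilbert_pos: "lex_hilbert m c s \<Longrightarrow> s > 0 \<Longrightarrow> \<exists>q. c (Suc q) > 0"
proof (induction rule: lex_hilbert.induct)
  case (lex_hilbert_step m c s a c')
  then have "c' (Suc a) > 0" using lex_hilbert_step.hyps(4)[of 0] by simp
  then show ?case by blast
qed simp

lemma hilb_mono_all: "q \<le> r \<Longrightarrow> hilb (Suc m) q \<le> hilb (Suc m) r"
  using hilb_mono[of q r "Suc m"] hilb_pos[of m r] by (cases q) auto

lemma lex_hilbert_le: "lex_hilbert m c s \<Longrightarrow> c q \<le> hilb m q"
proof (induction arbitrary: q rule: lex_hilbert.induct)
  case (lex_hilbert_step m c s a c')
  show ?case
  proof (cases "q \<le> a")
    case True
    then show ?thesis using lex_hilbert_step lex_hilbert_0[OF lex_hilbert_step.hyps(1)]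
      by (cases "q = a") auto
  next
    case False
    then obtain r where r: "q = Suc (a + r)" using less_iff_Suc_add by (auto simp: not_le)
    have "c' q \<le> hilb (Suc m) r + hilb m (Suc r)" using lex_hilbert_step by (simp add: r)
    also have "\<dots> = hilb (Suc m) (Suc r)" by (simp add: hilb_Suc_Suc)
    also have "\<dots> \<le> hilb (Suc m) q" by (rule hilb_mono_all) (simp add: r)
    finally show ?thesis .
  qed
qed auto

lemma homog_ideal_eq_0:
  assumes "finite V" "homog_ideal V J" "\<And>q. vs.dim (graded_part J q) = 0"
  shows "J = {0}"
proof -
  have i: "is_ideal V J" using assms by (simp add: homog_ideal_def)
  have z: "graded_part J q = {0}" for q
  proof -
    obtain B where B: "finite B" "graded_part J q \<subseteq> vs.span B" "card B = vs.dim (graded_part J q)"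
      using fd_basis[OF finite_imageI[OF finite_monoms_deg[OF assms(1)]] graded_part_span[OF
        assms(1) i]] by metis
    then have "graded_part J q \<subseteq> {0}" using assms(3) by auto
    then show ?thesis using i by (auto simp: graded_part_def is_ideal_def)
  qed
  have "p = 0" if "p \<in> J" for p
  proof -
    have "homog_part q p \<in> graded_part J q" for q using that assms
      by (auto simp: graded_part_def homog_ideal_def)
    then have "homog_part q p = 0" for q using z by blast
    then show ?thesis using sum_homog_part[of p] by simp
  qed
  then show ?thesis using i by (auto simp: is_ideal_def)
qed

lemma homog_ideal_subset_eq:
  assumes V: "finite V" and I: "homog_ideal V I" and J: "homog_ideal V J" and sub: "J \<subseteq> I"
    and dim: "\<And>q. vs.dim (graded_part I q) = vs.dim (graded_part J q)"
  shows "J = I"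
proof -
  have iI: "is_ideal V I" and iJ: "is_ideal V J" using I J by (auto simp: homog_ideal_def)
  have eq: "graded_part J q = graded_part I q" for q
    using fd_dim_equal[OF finite_imageI[OF finite_monoms_deg[OF V]] graded_part_span[OF V iI] _
      subspace_graded_part[OF iJ]] sub dim
    by (simp add: graded_part_def Collect_mono subset_iff)
  have "p \<in> J" if "p \<in> I" for p
  proof -
    have "homog_part q p \<in> graded_part I q" for q using that I
      by (auto simp: graded_part_def homog_ideal_def)
    then have "homog_part q p \<in> graded_part J q" for q unfolding eq .
    then have "homog_part q p \<in> J" for q unfolding graded_part_def by blast
    then have "(\<Sum>q\<le>tot_deg p. homog_part q p) \<in> J" by (intro is_ideal_sum[OF iJ])
    then show ?thesis by (simp add: sum_homog_part)
  qed
  then show ?thesis using sub by auto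
qed

lemma dim_pos_ex:
  assumes "vs.dim S > 0"
  shows "\<exists>p\<in>S. p \<noteq> 0"
proof (rule ccontr)
  assume "\<not> ?thesis"
  then have "S \<subseteq> vs.span {}" by auto
  then show False using vs.dim_le_card[of S "{}"] assms by simp
qed

lemma dim_graded_part_pos_ex: "vs.dim (graded_part J q) > 0 \<Longrightarrow> \<exists>p. p \<in> J \<and> homog q p \<and> p \<noteq> 0"
  using dim_pos_ex[of "graded_part J q"] unfolding graded_part_def by blast

lemma mdeg_1: "mdeg u = 1 \<Longrightarrow> \<exists>i. u = sgl i 1"
proof -
  assume u: "mdeg u = 1"
  then obtain i where i: "i \<in> kys u" by (metis ex_in_conv keys_eq_empty mdeg_0 zero_neq_one)
  define v where "v = u - sgl i 1"
  have uv: "u = v + sgl i 1"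
    using i by (intro poly_mapping_eqI) (auto simp: v_def lookup_add lookup_minus lookup_single
      when_def in_keys_iff)
  then have "mdeg v = 0" using u by (simp add: mdeg_add)
  then show ?thesis using uv by (auto simp: mdeg_eq_0_iff)
qed

lemma linear_form_split:
  assumes l: "l \<in> polys V" "homog 1 l" "l \<noteq> 0"
  obtains j c r where "j \<in> V" "c \<noteq> 0" "r \<in> polys (V - {j})" "homog 1 r" "l = const c * var j + r"
proof -
  obtain u where u: "u \<in> kys l" using l(3) by (metis ex_in_conv keys_eq_empty)
  then obtain j where j: "u = sgl j 1" using l(2) mdeg_1 by (auto simp: homog_def)
  define c where "c = lk l u"
  define r where "r = l - const c * var j"
  have cv: "const c * var j = sgl u c" by (simp add: j var_def single_eq)
  have kr: "v \<in> kys l \<and> v \<noteq> u" if "v \<in> kys r" for v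
    using that unfolding r_def cv by (auto simp: in_keys_iff lookup_minus lookup_single when_def
      c_def split: if_splits)
  show ?thesis
  proof
    show "j \<in> V" using u j l(1) by (auto simp: polys_def)
    show "c \<noteq> 0" using u by (simp add: c_def in_keys_iff)
    show "l = const c * var j + r" by (simp add: r_def)
    show "homog 1 r" using kr l(2) by (auto simp: homog_def)
    have "kys v \<subseteq> V - {j}" if "v \<in> kys r" for v
    proof -
      have "mdeg v = 1" "kys v \<subseteq> V" using kr[OF that] l by (auto simp: homog_def polys_def)
      then obtain i where "v = sgl i 1" using mdeg_1 by blast
      then show ?thesis using \<open>kys v \<subseteq> V\<close> kr[OF that] j by auto
    qed
    then show "r \<in> polys (V - {j})" by (auto simp: polys_def)
  qed
qed

text \<open>Division by the linear form is the substitution that solves it for \<open>var j\<close>;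
  the substituted polynomial is the remainder.\<close>

lemma linear_form_reduce:
  assumes j: "j \<in> V" and c: "c \<noteq> 0" and r: "r \<in> polys (V - {j})" and p: "p \<in> polys V"
  obtains s b where "s \<in> polys (V - {j})" "b \<in> polys V" "p = s + b * (const c * var j + r)"
proof -
  let ?l = "const c * var j + r"
  define \<psi> where "\<psi> = (\<lambda>_::nat. - (const (inverse c) * r))"
  have \<psi>: "\<psi> u \<in> polys (V - {j})" for u unfolding \<psi>_def using r by (auto intro!: polys_intros)
  have \<psi>V: "\<psi> u \<in> polys V" for u using \<psi>[of u] polys_mono[of "V - {j}" V] by auto
  have cc: "const c * const (inverse c) = 1" using c const_inverse by blast
  have "p - substitute {j} \<psi> p \<in> gen_ideal V (theta_set {j} \<psi>)"
    using \<psi>V p j by (intro substitute_cong_mod) auto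
  also have "gen_ideal V (theta_set {j} \<psi>) \<subseteq> gen_ideal V {?l}"
  proof (rule gen_ideal_subset)
    fix g assume "g \<in> theta_set {j} \<psi>"
    then have "g = var j + const (inverse c) * r" by (simp add: theta_set_def \<psi>_def)
    moreover have "const (inverse c) * ?l
      = (const c * const (inverse c)) * var j + const (inverse c) * r"
      by (simp only: distrib_left mult_ac)
    ultimately have "g = const (inverse c) * ?l" unfolding cc by simp
    then show "g \<in> gen_ideal V {?l}" by (auto intro: gen_ideal_mult gen_ideal_base)
  qed
  finally obtain b where b: "b \<in> polys V" "p - substitute {j} \<psi> p = b * ?l"
    by (auto simp: gen_ideal_singleton)
  have "substitute {j} \<psi> p \<in> polys (V - {j})"
    unfolding substitute_def by (rule peval_polys[OF p]) (use \<psi> in auto)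
  then show ?thesis using b that[of "substitute {j} \<psi> p" b] by (simp add: diff_eq_eq add.commute)
qed

text \<open>A greatest common divisor \<open>f\<close> of \<open>I\<close> is split off. Its degree is forced to be \<open>a\<close> by the
  growth of the Hilbert function, and then the cofactor contains a linear form.\<close>

theorem critical_structure:
  fixes I :: "'k::field polyn set"
  assumes "lex_hilbert m c s" "finite V" "card V = m" "homog_ideal V I"
    "\<And>q. vs.dim (graded_part I q) = c q"
  shows "if s = 0 then I = {0} else \<exists>G. critical_gens V G s \<and> gen_ideal V G = I"
  using assms
proof (induction arbitrary: V I rule: lex_hilbert.induct)
  case (lex_hilbert_zero c m)
  then show ?case using homog_ideal_eq_0 by auto
next
  case (lex_hilbert_step m c s a c')
  note V = lex_hilbert_step.prems(1,2) and I = lex_hilbert_step.prems(3)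
    and dimI = lex_hilbert_step.prems(4)
  have fin: "finite (mpoly ` monoms_deg V r :: 'k polyn set)" for r
    using finite_monoms_deg[OF V(1)] by simp
  have iI: "is_ideal V I" using I by (simp add: homog_ideal_def)
  \<comment> \<open>An element of degree \<open>a + 1\<close> bounds the degree of every common
    divisor of \<open>I\<close>.\<close>
  have "vs.dim (graded_part I (Suc a)) > 0" using dimI lex_hilbert_step.hyps(4)[of 0] by simp
  then obtain F where F: "F \<in> I" "homog (Suc a) F" "F \<noteq> 0" using dim_graded_part_pos_ex by blast
  have FV: "F \<in> polys V" using F iI by (auto simp: is_ideal_def)
  show ?case
  proof (cases "s = 0")
    case True
    \<comment> \<open>Here \<open>L' = 0\<close>, and the Hilbert function is that of the principal
      ideal of \<open>F\<close>, which therefore fills \<open>I\<close>.\<close>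
    then have c0: "c q = 0" for q using lex_hilbert_step.hyps(1) by (auto elim: lex_hilbert.cases)
    have hF: "homog_ideal V (gen_ideal V {F})" using FV F
      by (intro homog_ideal_gen_ideal) (auto simp: homog_part_homog intro: gen_ideal_base)
    then have iF: "is_ideal V (gen_ideal V {F})" by (simp add: homog_ideal_def)
    have sub: "gen_ideal V {F} \<subseteq> I" using F iI by (intro gen_ideal_least) auto
    have "gen_ideal V {F} = I"
    proof (rule homog_ideal_subset_eq[OF V(1) I hF sub])
      fix q
      show "vs.dim (graded_part I q) = vs.dim (graded_part (gen_ideal V {F}) q)"
      proof (cases "q \<le> a")
        case True
        then have "vs.dim (graded_part I q) = 0" using dimI lex_hilbert_step.hyps(2,3) c0
          by (cases "q = a") auto
        moreover have "vs.dim (graded_part (gen_ideal V {F}) q) \<le> vs.dim (graded_part I q)"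
          using sub by (intro fd_dim_mono[OF fin graded_part_span[OF V(1) iI]]) (auto simp:
            graded_part_def)
        ultimately show ?thesis by simp
      next
        case False
        then obtain t where t: "q = Suc a + t" using less_iff_Suc_add by (auto simp: not_le)
        have "vs.dim (graded_part (gen_ideal V {F}) q) = hilb (card V) t"
          unfolding t graded_part_mult_forms[OF FV F(2,3)] dim_mult_image[OF F(3) fin
            forms_span[OF V(1)]]
          using dim_forms[OF V(1)] .
        then show ?thesis using dimI lex_hilbert_step.hyps(4)[of t] c0 V t by simp
      qed
    qed
    moreover have "critical_gens V {F} 1" using F FV by (intro critical_gens_principal) auto
    ultimately show ?thesis using True by auto
  next
    case False
    then have s: "s > 0" by simp
    have m: "m > 0" using lex_hilbert_step.hyps(1) s by (auto elim: lex_hilbert.cases)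
    \<comment> \<open>The common divisors of \<open>I\<close>. Their degrees are bounded by that of
      \<open>F\<close>, and one of greatest degree leaves a cofactor ideal without common prime
      divisor.\<close>
    define Q where "Q f \<longleftrightarrow> f \<in> polys V \<and> (\<forall>p\<in>I. f dvd p)" for f :: "'k polyn"
    have Q1: "Q 1" by (simp add: Q_def)
    have Qb: "tot_deg f < Suc (Suc a)" if "Q f" for f
    proof -
      have "f dvd F" using that F(1) by (simp add: Q_def)
      then obtain k where k: "F = f * k" ..
      then have "tot_deg F = tot_deg f + tot_deg k" using F tot_deg_mult[of f k] by auto
      then show ?thesis using tot_deg_homog[OF F(2,3)] by simp
    qed
    obtain f where f: "Q f" and fmax: "\<And>g. Q g \<Longrightarrow> tot_deg g \<le> tot_deg f"
      using ex_has_greatest_nat[of Q 1 tot_deg "Suc (Suc a)"] Q1 Qb by (metis less_imp_le)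
    have "f dvd F" using f F(1) by (simp add: Q_def)
    then obtain k where k: "F = f * k" ..
    have f0: "f \<noteq> 0" using k F by auto
    have k0: "k \<noteq> 0" using k F by auto
    define b where "b = tot_deg f"
    have fh: "homog b f" unfolding b_def by (rule homog_factor[of "Suc a" f k]) (use F k in auto)
    have kV: "k \<in> polys V" using polys_factor2[of f k V] k F FV by auto
    have fV: "f \<in> polys V" using f by (simp add: Q_def)
    define J where "J = {p \<in> polys V. f * p \<in> I}"
    have iJ: "is_ideal V J"
      unfolding is_ideal_def
    proof (intro conjI ballI)
      fix p q assume "p \<in> J" "q \<in> J"
      then show "p + q \<in> J" using isidD(3)[OF iI]
        by (auto simp: J_def distrib_left intro: polys_add)
    next
      fix p q :: "'k polyn" assume "p \<in> polys V" "q \<in> J"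
      then show "p * q \<in> J" using isidD(4)[OF iI, of p "f * q"]
        by (auto simp: J_def mult.left_commute intro: polys_mult)
    qed (auto simp: J_def isidD(2)[OF iI])
    have hJ: "homog_ideal V J"
      unfolding homog_ideal_def
    proof (intro conjI ballI allI iJ)
      fix p q assume p: "p \<in> J"
      have "f * homog_part q p = homog_part (b + q) (f * p)" using homog_part_mult_homog[OF fh]
        by simp
      also have "\<dots> \<in> I" using p I by (auto simp: J_def homog_ideal_def)
      finally show "homog_part q p \<in> J" using p by (auto simp: J_def homog_part_polys)
    qed
    have IJ: "I = (*) f ` J"
    proof (intro equalityI subsetI)
      fix p assume p: "p \<in> I"
      then obtain g where g: "p = f * g" using f by (auto simp: Q_def)
      show "p \<in> (*) f ` J"
      proof (cases "p = 0")
        case True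
        then show ?thesis using isidD(2)[OF iJ] by (intro image_eqI[of _ _ 0]) auto
      next
        case False
        then have "g \<in> polys V" using polys_factor2[of f g V] g p iI by (auto simp: is_ideal_def)
        then show ?thesis using g p by (auto simp: J_def)
      qed
    qed (auto simp: J_def)
    have hpIJ: "graded_part I (b + q) = (*) f ` graded_part J q" for q
    proof (intro equalityI subsetI)
      fix x assume x: "x \<in> graded_part I (b + q)"
      then obtain y where y: "y \<in> J" "x = f * y" unfolding graded_part_def IJ by auto
      have "x = homog_part (b + q) x" using x homog_part_homog[of "b + q" x "b + q"]
        by (auto simp: graded_part_def)
      also have "\<dots> = f * homog_part q y" by (simp add: y homog_part_mult_homog[OF fh])
      finally show "x \<in> (*) f ` graded_part J q" using y hJ
        by (auto simp: homog_ideal_def graded_part_def)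
    next
      fix x assume "x \<in> (*) f ` graded_part J q"
      then show "x \<in> graded_part I (b + q)" using homog_mult[OF fh] unfolding graded_part_def IJ
        by auto
    qed
    have dimJ: "vs.dim (graded_part J q) = c' (b + q)" for q
      using dimI[of "b + q"] dim_mult_image[OF f0 fin graded_part_span[OF V(1) iJ], of q]
        unfolding hpIJ by simp
    have kJ: "k \<in> J" using F kV k by (simp add: J_def)
    have "tot_deg F = b + tot_deg k" using F tot_deg_mult[of f k] k f0 k0 by (simp add: b_def)
    then have bk: "Suc a = b + tot_deg k" using tot_deg_homog[OF F(2,3)] by simp
    have kh: "homog (tot_deg k) k" by (rule homog_factor2[of "Suc a" f k]) (use F k in auto)
    have coprime: "\<exists>g\<in>J. \<not> p dvd g" if p: "irred p" "p \<in> polys V" for p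
    proof (rule ccontr)
      assume "\<not> ?thesis"
      then have "Q (f * p)" unfolding Q_def IJ using fV p by (auto intro: polys_mult mult_dvd_mono)
      then have "tot_deg (f * p) \<le> tot_deg f" by (rule fmax)
      moreover have "p \<noteq> 0" using p irred_nonzero by auto
      ultimately show False using tot_deg_mult[OF f0] p by (simp add: irred_def)
    qed
    \<comment> \<open>Otherwise the cofactor of \<open>F\<close> is a constant, \<open>J\<close> is
      the whole ring, and nothing is left over for the Hilbert function \<open>c\<close>, which is
      nonzero for \<open>s > 0\<close>.\<close>
    have "b \<noteq> Suc a"
    proof
      assume b: "b = Suc a"
      then have "tot_deg k = 0" using bk by simp
      then obtain e where e: "k = const e" using tot_deg_0_const by blast
      have "p \<in> J" if "p \<in> polys V" for p
      proof -
        have "(p * const (inverse e)) * k \<in> J" using that kJ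
          by (intro isidD(4)[OF iJ] polys_mult) auto
        moreover have "(p * const (inverse e)) * k = p * (const e * const (inverse e))"
          by (simp only: e mult_ac)
        moreover have "const e * const (inverse e) = 1" using const_inverse e k0 by auto
        ultimately show ?thesis by (simp only: mult_1_right)
      qed
      then have "J = polys V" using iJ by (auto simp: is_ideal_def)
      then have "vs.dim (graded_part J q) = hilb (card V) q" for q using dim_forms[OF V(1)]
        by (simp add: graded_part_polys_UNIV)
      then have "c (Suc q) = 0" for q using dimJ[of q] lex_hilbert_step.hyps(4)[of q] V b by simp
      then show False using lex_hilbert_pos[OF lex_hilbert_step.hyps(1) s] by auto
    qed
    \<comment> \<open>The shift by \<open>b < a\<close> bounds the part of \<open>J\<close> in
      degree \<open>q\<close> by \<open>hilb (Suc m) (q - 1)\<close>. The deficit is at least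
      \<open>hilb m q\<close>, and this outgrows the bound \<open>C * hilb (m - 1) q\<close> for
      ideals without common divisor.\<close>
    moreover have "\<not> b < a"
    proof
      assume b: "b < a"
      obtain l where l: "m = Suc l" using m by (cases m) auto
      have cV: "card V = Suc (Suc l)" using V l by simp
      obtain C q0 where C: "\<And>q. q \<ge> q0 \<Longrightarrow> hilb (card V) q
        \<le> vs.dim (graded_part (gen_ideal V (insert k J)) q) + C * hilb l q"
        using codim_bound[OF V(1) cV hJ coprime kV kh k0] by blast
      have gk: "gen_ideal V (insert k J) = J" using gen_ideal_is_ideal[OF iJ] kJ
        by (simp add: insert_absorb)
      obtain q where q: "q \<ge> q0 + Suc a" "C * hilb l q < hilb (Suc l) q" using hilb_growth by blast
      then obtain q' where q': "q = Suc q'" using b by (cases q) auto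
      have "b + q > a" using q b by simp
      then obtain t where t: "b + q = Suc (a + t)" using less_iff_Suc_add by auto
      have "vs.dim (graded_part J q) = hilb (Suc m) t + c (Suc t)"
        using dimJ[of q] lex_hilbert_step.hyps(4)[of t] t by simp
      also have "\<dots> \<le> hilb (Suc m) t + hilb m (Suc t)"
        using lex_hilbert_le[OF lex_hilbert_step.hyps(1)] by simp
      also have "\<dots> = hilb (Suc m) (Suc t)" by (simp add: hilb_Suc_Suc)
      also have "\<dots> \<le> hilb (Suc m) q'" using t b q' by (intro hilb_mono_all) simp
      finally have "vs.dim (graded_part J q) \<le> hilb (Suc m) q'" .
      moreover have "hilb (Suc m) q \<le> vs.dim (graded_part J q) + C * hilb l q"
        using C[of q] q gk V by simp
      moreover have "hilb (Suc m) q = hilb (Suc m) q' + hilb (Suc l) q"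
        unfolding q' hilb_Suc_Suc l ..
      ultimately show False using q by linarith
    qed
    ultimately have ba: "b = a" using bk by linarith
    have "vs.dim (graded_part J 1) > 0" using dimJ[of 1] lex_hilbert_step.hyps(4)[of 0] ba by simp
    then obtain l where l: "l \<in> J" "homog 1 l" "l \<noteq> 0" using dim_graded_part_pos_ex by blast
    have lV: "l \<in> polys V" using l iJ by (auto simp: is_ideal_def)
    obtain j e r where j: "j \<in> V" "e \<noteq> 0" "r \<in> polys (V - {j})" "homog 1 r" "l
      = const e * var j + r"
      using linear_form_split[OF lV l(2,3)] by metis
    define V' where "V' = V - {j}"
    have V': "finite V'" "card V' = m" "polys V' \<subseteq> polys V" "V' \<subseteq> V"
      using V j polys_mono[of V' V] by (auto simp: V'_def)
    \<comment> \<open>Modulo \<open>l\<close> the variable \<open>j\<close> is eliminated, and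
      \<open>J\<close> is the direct sum of the multiples of \<open>l\<close> and this part;
      subtracting dimensions leaves \<open>c\<close>.\<close>
    define J' where "J' = J \<inter> polys V'"
    have iJ': "is_ideal V' J'" using iJ V' unfolding is_ideal_def J'_def
      by (auto intro: polys_intros)
    have hJ': "homog_ideal V' J'" using hJ iJ'
      by (auto simp: homog_ideal_def J'_def homog_part_polys)
    have reduce: "\<exists>s\<in>J'. \<exists>b\<in>polys V. p = s + b * l" if p: "p \<in> J" for p
    proof -
      have "p \<in> polys V" using p iJ by (auto simp: is_ideal_def)
      then obtain s b where sb: "s \<in> polys V'" "b \<in> polys V" "p = s + b * l"
        using linear_form_reduce[OF j(1-3)] unfolding V'_def j(5) by metis
      have "s = p - b * l" using sb by simp
      then have "s \<in> J" using is_ideal_diff[OF iJ p] isidD(4)[OF iJ sb(2) l(1)] by simp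
      then show ?thesis using sb by (auto simp: J'_def)
    qed
    have lV': "l \<notin> polys V'"
    proof
      assume "l \<in> polys V'"
      then have "const e * var j \<in> polys V'" using j(3) polys_diff[of l V' r]
        by (simp add: j(5) V'_def)
      then have "var j \<in> polys V'" using polys_factor2[of "const e" "var j" V'] j(2) by simp
      then show False by (simp add: V'_def)
    qed
    have dimJ': "vs.dim (graded_part J' q) = c q" for q
    proof (cases q)
      case 0
      have "graded_part J 0 = graded_part J' 0" using homog_0_const
        by (fastforce simp: graded_part_def J'_def)
      then show ?thesis using dimJ[of 0] lex_hilbert_step.hyps(3) ba 0 by simp
    next
      case (Suc t)
      have gl: "is_ideal V (gen_ideal V {l})" using lV by (intro is_ideal_gen_ideal) auto
      let ?L = "graded_part (gen_ideal V {l}) q"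
      have L: "?L = (*) l ` forms V t" using graded_part_mult_forms[OF lV l(2,3), of t] Suc by simp
      have "vs.dim ?L = hilb (card V) t"
        unfolding L dim_mult_image[OF l(3) fin forms_span[OF V(1)]] using dim_forms[OF V(1)] .
      have sub: "vs.subspace (graded_part J' q)"
        "graded_part J' q \<subseteq> vs.span (mpoly ` monoms_deg V q)"
        using subspace_graded_part[OF iJ'] graded_part_span[OF V(1) iJ, of q]
          by (auto simp: graded_part_def J'_def)
      have int: "?L \<inter> graded_part J' q = {0}"
      proof -
        have "x = 0" if x: "x \<in> ?L" "x \<in> graded_part J' q" for x
        proof (rule ccontr)
          assume "x \<noteq> 0"
          obtain y where "x = l * y" using x L by auto
          then show False using polys_factor[of l y V'] x lV' \<open>x \<noteq> 0\<close>
            by (auto simp: graded_part_def J'_def)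
        qed
        then show ?thesis using isidD(2)[OF iJ'] by (auto simp: graded_part_def)
      qed
      have "graded_part J q = {s + t | s t. s \<in> ?L \<and> t \<in> graded_part J' q}"
      proof (intro equalityI subsetI)
        fix x assume x: "x \<in> graded_part J q"
        then obtain s b where sb: "s \<in> J'" "b \<in> polys V" "x = s + l * b"
          using reduce[of x] by (auto simp: graded_part_def mult.commute)
        have "x = homog_part q x" using x homog_part_homog[of q x q] by (auto simp: graded_part_def)
        also have "\<dots> = l * homog_part t b + homog_part q s"
          using homog_part_mult_homog[OF l(2), of t b] Suc
            by (simp add: sb(3) homog_part_add add.commute)
        finally have "x = l * homog_part t b + homog_part q s" .
        moreover have "l * homog_part t b \<in> ?L" unfolding L using sb
          by (auto simp: forms_def homog_part_polys)
        moreover have "homog_part q s \<in> graded_part J' q" using sb hJ'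
          by (auto simp: graded_part_def homog_ideal_def)
        ultimately show "x \<in> {s + t | s t. s \<in> ?L \<and> t \<in> graded_part J' q}" by blast
      next
        fix x assume "x \<in> {s + t | s t. s \<in> ?L \<and> t \<in> graded_part J' q}"
        then obtain y z where yz: "x = y + z" "y \<in> ?L" "z \<in> graded_part J' q" by blast
        have "gen_ideal V {l} \<subseteq> J" using l iJ by (intro gen_ideal_least) auto
        then show "x \<in> graded_part J q" using yz isidD(3)[OF iJ]
          by (auto simp: graded_part_def J'_def intro: homog_add)
      qed
      then have "vs.dim (graded_part J q) = vs.dim ?L + vs.dim (graded_part J' q)"
        using dim_direct_sum[OF fin graded_part_span[OF V(1) gl] sub(2) subspace_graded_part[OF
          gl] sub(1) int] by simp
      then show ?thesis using \<open>vs.dim ?L = _\<close> dimJ[of q] lex_hilbert_step.hyps(4)[of t] ba V Suc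
        by simp
    qed
    obtain G where G: "critical_gens V' G s" "gen_ideal V' G = J'"
      using lex_hilbert_step.IH[OF V'(1,2) hJ' dimJ'] s by auto
    have "critical_gens V ((*) f ` insert l G) (Suc s)"
      unfolding j(5) using G(1) j f0 fV by (intro critical_gens_step) (auto simp: V'_def)
    moreover have "gen_ideal V (insert l G) = J"
    proof (intro equalityI subsetI)
      fix p assume "p \<in> gen_ideal V (insert l G)"
      moreover have "G \<subseteq> J" using G(2) gen_ideal_base[of _ G V'] by (auto simp: J'_def)
      ultimately show "p \<in> J" using gen_ideal_least[OF iJ, of "insert l G"] l by blast
    next
      fix p assume "p \<in> J"
      then obtain s b where "s \<in> J'" "b \<in> polys V" "p = s + b * l" using reduce by blast
      then show "p \<in> gen_ideal V (insert l G)"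
        unfolding gen_ideal_insert using gen_ideal_mono_vars[OF V'(4), of G] G(2) by blast
    qed
    ultimately have "critical_gens V ((*) f ` insert l G) (Suc s)
      \<and> gen_ideal V ((*) f ` insert l G) = I"
      unfolding gen_ideal_image_mult IJ by simp
    then show ?thesis by auto
  qed
qed

section \<open>Universal lexsegment ideals\<close>

definition monomials_in :: "nat set \<Rightarrow> monom set" where
  "monomials_in V = {u. kys u \<subseteq> V}"

text \<open>A single further variable \<open>z\<close>, smaller than all others in the lexicographic order,
  suffices.\<close>

definition univ_lex :: "nat \<Rightarrow> nat set \<Rightarrow> monom set \<Rightarrow> bool" where
  "univ_lex z V S \<longleftrightarrow> S \<subseteq> monomials_in V \<and> (\<forall>u\<in>S. \<forall>v\<in>monomials_in V. u + v \<in> S) \<and>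
    (\<forall>u\<in>S. \<forall>v\<in>monomials_in (insert z V). mdeg v = mdeg u \<and> v > u \<longrightarrow> (\<exists>w\<in>S. \<exists>t. v = w + t))"

lemma less_monom_iff: "u < v \<longleftrightarrow> (\<exists>k. lk u k < lk v k \<and> (\<forall>j<k. lk u j = lk v j))" for u v :: monom
  by (simp add: less_poly_mapping.rep_eq less_fun_def)

lemma keys_add_monom: "kys (u + v) = kys u \<union> kys v" for u v :: monom
  by (auto simp: in_keys_iff lookup_add)

lemma monomials_in_add [simp]: "u + v \<in> monomials_in V \<longleftrightarrow> u \<in> monomials_in V \<and> v \<in> monomials_in V"
  by (auto simp: monomials_in_def keys_add_monom)

lemma monomials_in_single: "i \<in> V \<Longrightarrow> sgl i k \<in> monomials_in V"
  by (auto simp: monomials_in_def)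

lemma monomials_in_0 [simp]: "0 \<in> monomials_in V"
  by (simp add: monomials_in_def)

lemma lookup_le_mdeg: "lk u x \<le> mdeg u"
proof (cases "x \<in> kys u")
  case True
  then show ?thesis unfolding mdeg_def by (intro member_le_sum) auto
qed (simp add: in_keys_iff)

lemma monom_split:
  fixes u :: monom
  assumes "k \<le> lk u x"
  obtains v where "u = v + sgl x k" "lk v x = lk u x - k"
proof -
  define v where "v = u - sgl x k"
  have "u = v + sgl x k"
    using assms by (intro poly_mapping_eqI) (auto simp: v_def lookup_add lookup_minus
      lookup_single when_def)
  moreover have "lk v x = lk u x - k" by (simp add: v_def lookup_minus)
  ultimately show ?thesis using that by blast
qed

lemma eq_single_if_mdeg: "mdeg u = lk u x \<Longrightarrow> u = sgl x (lk u x)"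
proof -
  assume u: "mdeg u = lk u x"
  obtain v where v: "u = v + sgl x (lk u x)" using monom_split[of "lk u x" u x] by blast
  then have "mdeg u = mdeg v + lk u x" by (metis mdeg_add mdeg_single)
  then have "v = 0" using u by (simp add: mdeg_eq_0_iff)
  then show ?thesis using v by simp
qed

lemma card_deg_shift:
  "card {u \<in> (\<lambda>u. u + t) ` M. mdeg u = mdeg t + q} = card {u \<in> M. mdeg u = q}" for t :: monom
proof -
  have "{u \<in> (\<lambda>u. u + t) ` M. mdeg u = mdeg t + q} = (\<lambda>u. u + t) ` {u \<in> M. mdeg u = q}"
    by (auto simp: mdeg_add)
  moreover have "inj_on (\<lambda>u. u + t) {u \<in> M. mdeg u = q}" by (auto simp: inj_on_def)
  ultimately show ?thesis by (simp add: card_image)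
qed

text \<open>Let \<open>x\<close> be the largest variable and \<open>x^(a + 1)\<close> its least
  power in \<open>S\<close>. Comparison with monomials in \<open>x\<close> and \<open>z\<close>
  shows that \<open>x^a\<close> divides all of \<open>S\<close>. After division the set contains
  \<open>x\<close>, so it consists of the multiples of \<open>x\<close> and of a set in the
  remaining variables to which the induction applies.\<close>

lemma univ_lex_lex_hilbert:
  assumes "finite V" "card V = m" "univ_lex z V S" "0 \<notin> S" "\<And>v. v \<in> V \<Longrightarrow> v < z"
  shows "\<exists>s. lex_hilbert m (\<lambda>q. card {u \<in> S. mdeg u = q}) s"
  using assms
proof (induction m arbitrary: V S)
  case 0
  then have "S \<subseteq> {0}" by (auto simp: univ_lex_def monomials_in_def)
  then have "S = {}" using 0 by auto
  then show ?case by (intro exI[of _ 0] lex_hilbert_zero) simp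
next
  case (Suc m)
  note ul = Suc.prems(3)
  have SV: "S \<subseteq> monomials_in V" and up: "\<And>u v. u \<in> S \<Longrightarrow> v \<in> monomials_in V \<Longrightarrow> u + v \<in> S"
    and lex: "\<And>u v. u \<in> S \<Longrightarrow> v \<in> monomials_in (insert z V) \<Longrightarrow> mdeg v = mdeg u \<Longrightarrow> v > u \<Longrightarrow> \<exists>w\<in>S. \<exists>t. v
      = w + t"
    using ul unfolding univ_lex_def by blast+
  show ?case
  proof (cases "S = {}")
    case True
    then show ?thesis by (intro exI[of _ 0] lex_hilbert_zero) simp
  next
    case False
    define x where "x = Min V"
    have V0: "V \<noteq> {}" using Suc.prems(2) by auto
    have x: "x \<in> V" using Suc.prems(1) V0 by (simp add: x_def)
    have xmin: "x \<le> y" if "y \<in> V" for y using Suc.prems(1) that by (simp add: x_def)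
    have xz: "x < z" using Suc.prems(5) x .
    have gr: "u < v" if "u \<in> monomials_in V" "lk u x < lk v x" "v \<in> monomials_in (insert z V)"
      for u v
    proof -
      have "lk u j = 0" "lk v j = 0" if "j < x" for j
      proof -
        have "j \<notin> insert z V" using xmin[of j] xz that by auto
        then show "lk u j = 0" "lk v j = 0"
          using \<open>u \<in> monomials_in V\<close> \<open>v \<in> monomials_in (insert z V)\<close>
            unfolding monomials_in_def in_keys_iff[symmetric]
          by (metis (lifting) insertCI in_keys_iff mem_Collect_eq subsetD)+
      qed
      then show ?thesis unfolding less_monom_iff using that(2) by (intro exI[of _ x]) auto
    qed
    \<comment> \<open>A power of \<open>x\<close> is the greatest monomial of its degree. Some
      member of \<open>S\<close> divides it, and the quotient involves no variable outside
      \<open>V\<close>.\<close>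
    have xpow: "sgl x (mdeg u) \<in> S" if u: "u \<in> S" for u
    proof (cases "lk u x = mdeg u")
      case True
      then have "u = sgl x (mdeg u)" using eq_single_if_mdeg[of u x] by simp
      then show ?thesis using u by simp
    next
      case False
      then have "lk u x < lk (sgl x (mdeg u)) x" using lookup_le_mdeg[of u x] by simp
      then have "u < sgl x (mdeg u)"
        using u SV x by (intro gr) (auto intro: monomials_in_single)
      then obtain w t where w: "w \<in> S" "sgl x (mdeg u) = w + t"
        using lex[OF u, of "sgl x (mdeg u)"] x by (auto intro: monomials_in_single)
      have "w + t \<in> monomials_in V" using w x monomials_in_single[of x V] by metis
      then show ?thesis using up[OF w(1), of t] w by simp
    qed
    define p where "p = (LEAST k. sgl x k \<in> S)"
    obtain u0 where "u0 \<in> S" using False by blast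
    then have pS: "sgl x p \<in> S" unfolding p_def by (rule LeastI[of "\<lambda>k. sgl x k \<in> S", OF xpow])
    have pmin: "sgl x k \<notin> S" if "k < p" for k using that not_less_Least unfolding p_def by blast
    have "p \<noteq> 0" using pS Suc.prems(4) single_zero by metis
    then obtain a where a: "p = Suc a" by (cases p) auto
    have ge: "a \<le> lk u x" if u: "u \<in> S" for u
    proof (rule ccontr)
      assume "\<not> a \<le> lk u x"
      then have b: "Suc (lk u x) < p" using a by simp
      show False
      proof (cases "mdeg u = lk u x")
        case True
        then have "u = sgl x (lk u x)" by (rule eq_single_if_mdeg)
        then show False using pmin[of "lk u x"] u b by simp
      next
        case False
        then have d: "Suc (lk u x) \<le> mdeg u" using lookup_le_mdeg[of u x] by simp
        \<comment> \<open>This exceeds \<open>u\<close>, its exponent of \<open>x\<close> being one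
          larger, and \<open>z\<close> fills up the degree. A member of \<open>S\<close> dividing it
          cannot contain \<open>z\<close>, hence is a power of \<open>x\<close> with exponent below
          \<open>p\<close>, against the choice of \<open>p\<close>.\<close>
        define v where "v = sgl x (Suc (lk u x)) + sgl z (mdeg u - Suc (lk u x))"
        have "mdeg v = mdeg u" using d by (simp add: v_def mdeg_add)
        moreover have vz: "v \<in> monomials_in (insert z V)" unfolding v_def using x
          by (auto intro: monomials_in_single)
        moreover have "u < v" using u SV vz
          by (intro gr) (auto simp: v_def lookup_add lookup_single)
        ultimately obtain w t where w: "w \<in> S" "v = w + t" using lex[OF u] by blast
        have wV: "w \<in> monomials_in V" using w SV by auto
        have "lk w i = 0" if "i \<noteq> x" for i
        proof (cases "i = z")
          case True
          then show ?thesis using wV Suc.prems(5)[of z]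
            by (auto simp: monomials_in_def in_keys_iff subset_iff)
        next
          case False
          then have "lk v i = 0" using that by (simp add: v_def lookup_add lookup_single when_def)
          then show ?thesis by (simp add: w lookup_add)
        qed
        then have ws: "w = sgl x (lk w x)"
          by (intro poly_mapping_eqI) (auto simp: lookup_single when_def)
        have "lk v x = Suc (lk u x)" using xz by (simp add: v_def lookup_add lookup_single when_def)
        then have "lk w x \<le> Suc (lk u x)" by (simp add: w lookup_add)
        then have "lk w x < p" using b by simp
        then show False using pmin ws w by metis
      qed
    qed
    define M where "M = {u \<in> monomials_in V. u + sgl x a \<in> S}"
    define V' where "V' = V - {x}"
    define S' where "S' = M \<inter> monomials_in V'"
    have V'V: "monomials_in V' \<subseteq> monomials_in V" by (auto simp: monomials_in_def V'_def)
    have SM: "S = (\<lambda>u. u + sgl x a) ` M"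
    proof (intro equalityI subsetI)
      fix u assume u: "u \<in> S"
      obtain v where "u = v + sgl x a" using monom_split[OF ge[OF u]] by metis
      then show "u \<in> (\<lambda>u. u + sgl x a) ` M" using u SV by (auto simp: M_def)
    qed (auto simp: M_def)
    have upM: "u + v \<in> M" if "u \<in> M" "v \<in> monomials_in V" for u v
      using that up[of "u + sgl x a" v] by (simp add: M_def add_ac)
    have x1: "sgl x 1 \<in> M"
      using pS x a by (simp add: M_def monomials_in_single flip: single_add)
    have M0: "0 \<notin> M" using pmin[of a] a by (simp add: M_def)
    have ul': "univ_lex z V' S'"
      unfolding univ_lex_def
    proof (intro conjI ballI impI)
      show "S' \<subseteq> monomials_in V'" by (simp add: S'_def)
      show "u + v \<in> S'" if "u \<in> S'" "v \<in> monomials_in V'" for u v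
        using that upM V'V by (auto simp: S'_def)
      fix u v assume u: "u \<in> S'" and v: "v \<in> monomials_in (insert z V')" and d: "mdeg v
        = mdeg u \<and> u < v"
      have "u + sgl x a \<in> S" using u by (simp add: S'_def M_def)
      moreover have "v + sgl x a \<in> monomials_in (insert z V)"
        using v x by (auto simp: monomials_in_def V'_def keys_add_monom split: if_splits)
      moreover have "u + sgl x a < v + sgl x a" using d by simp
      moreover have "mdeg (v + sgl x a) = mdeg (u + sgl x a)" using d by (simp add: mdeg_add)
      ultimately obtain w t where w: "w \<in> S" "v + sgl x a = w + t" using lex by blast
      obtain w' where w': "w' \<in> M" "w = w' + sgl x a" using w SM by auto
      have vw: "v = w' + t"
      proof -
        have "v + sgl x a = (w' + t) + sgl x a" using w w' by (simp add: add_ac)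
        then show ?thesis by (simp only: add_right_cancel)
      qed
      have "x \<notin> kys v" using v xz by (auto simp: monomials_in_def V'_def)
      then have "x \<notin> kys w'" by (simp add: vw keys_add_monom)
      then have "w' \<in> S'" using w' by (auto simp: S'_def M_def monomials_in_def V'_def)
      then show "\<exists>w\<in>S'. \<exists>t. v = w + t" using vw by blast
    qed
    have V': "finite V'" "card V' = m" "V = insert x V'" "x \<notin> V'"
      using Suc.prems(1,2) x by (auto simp: V'_def)
    have "0 \<notin> S'" using M0 by (simp add: S'_def)
    then obtain s where s: "lex_hilbert m (\<lambda>q. card {u \<in> S'. mdeg u = q}) s"
      using Suc.IH[OF V'(1,2) ul'] Suc.prems(5) by (auto simp: V'_def)
    have cardS: "card {u \<in> S. mdeg u = a + q} = card {u \<in> M. mdeg u = q}" for q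
      using card_deg_shift[of "sgl x a" M q] by (simp add: SM)
    have "lex_hilbert (Suc m) (\<lambda>q. card {u \<in> S. mdeg u = q}) (Suc s)"
    proof (rule lex_hilbert_step[OF s])
      fix q assume q: "q < a"
      have "mdeg u \<noteq> q" if "u \<in> S" for u using ge[OF that] lookup_le_mdeg[of u x] q by linarith
      then have "{u \<in> S. mdeg u = q} = {}" by blast
      then show "card {u \<in> S. mdeg u = q} = 0" by (simp only: card.empty)
    next
      have "{u \<in> M. mdeg u = 0} = {u \<in> S'. mdeg u = 0}"
        using M0 by (auto simp: mdeg_eq_0_iff S'_def)
      then show "card {u \<in> S. mdeg u = a} = card {u \<in> S'. mdeg u = 0}" using cardS[of 0]
        by (simp only: add_0_right)
    next
      fix q
      let ?i = "\<lambda>u. u + sgl x 1"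
      \<comment> \<open>Monomials of \<open>M\<close> divisible by \<open>x\<close> are all
        multiples of \<open>x\<close>, because \<open>x\<close> itself lies in \<open>M\<close>; the
        others form \<open>S'\<close>.\<close>
      have eq: "{u \<in> M. mdeg u = Suc q} = {u \<in> S'. mdeg u = Suc q} \<union> ?i ` monoms_deg V q"
      proof (intro equalityI subsetI)
        fix u assume u: "u \<in> {u \<in> M. mdeg u = Suc q}"
        show "u \<in> {u \<in> S'. mdeg u = Suc q} \<union> ?i ` monoms_deg V q"
        proof (cases "x \<in> kys u")
          case False
          then show ?thesis using u by (auto simp: S'_def M_def monomials_in_def V'_def)
        next
          case True
          then have "1 \<le> lk u x" by (simp add: in_keys_iff)
          then obtain v where v: "u = v + sgl x 1" using monom_split by metis
          then have "v \<in> monoms_deg V q" using u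
            by (auto simp: M_def monoms_deg_def mdeg_add monomials_in_def keys_add_monom)
          then show ?thesis using v by blast
        qed
      next
        fix u assume "u \<in> {u \<in> S'. mdeg u = Suc q} \<union> ?i ` monoms_deg V q"
        then show "u \<in> {u \<in> M. mdeg u = Suc q}"
          using upM[OF x1] by (auto simp: S'_def monoms_deg_def monomials_in_def mdeg_add
            add.commute)
      qed
      have fin: "finite (monoms_deg V q)" "finite {u \<in> S'. mdeg u = Suc q}"
        using finite_monoms_deg[OF Suc.prems(1)] finite_subset[OF _ finite_monoms_deg[OF V'(1), of
          "Suc q"], of "{u \<in> S'. mdeg u = Suc q}"]
        by (auto simp: S'_def monoms_deg_def monomials_in_def)
      have disj: "{u \<in> S'. mdeg u = Suc q} \<inter> ?i ` monoms_deg V q = {}"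
        using V'(4) by (auto simp: S'_def monomials_in_def keys_add_monom)
      have inj: "inj_on ?i (monoms_deg V q)" by (auto simp: inj_on_def)
      show "card {u \<in> S. mdeg u = Suc (a + q)} = hilb (Suc m) q + card {u \<in> S'. mdeg u = Suc q}"
        using cardS[of "Suc q"] card_Un_disjoint[OF fin(2) finite_imageI[OF fin(1)] disj]
          card_image[OF inj]
          card_monoms_deg[OF Suc.prems(1), of q] Suc.prems(2) by (simp add: eq)
    qed
    then show ?thesis by blast
  qed
qed

lemma keys_mpoly: "kys (mpoly u) = {u}"
  by (simp add: mpoly_def)

lemma gen_ideal_mpoly_iff:
  assumes "S \<subseteq> monomials_in V"
  shows "p \<in> gen_ideal V (mpoly ` S) \<longleftrightarrow> p \<in> polys V \<and> (\<forall>u\<in>kys p. \<exists>w\<in>S. \<exists>t. u = w + t)"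
proof
  assume p: "p \<in> gen_ideal V (mpoly ` S)"
  have "mpoly ` S \<subseteq> polys V" using assms by (auto simp: monomials_in_def)
  then have "p \<in> polys V" using gen_ideal_polys p by blast
  moreover from p have "\<forall>u\<in>kys p. \<exists>w\<in>S. \<exists>t. u = w + t"
  proof (induction p rule: gen_ideal.induct)
    case (gen_ideal_step p a g)
    then obtain w where w: "w \<in> S" "g = mpoly w" by blast
    show ?case
    proof
      fix u assume "u \<in> kys (p + a * g)"
      then have "u \<in> kys p \<or> u \<in> kys (a * g)" using keys_add[of p "a * g"] by blast
      then show "\<exists>w\<in>S. \<exists>t. u = w + t"
      proof
        assume "u \<in> kys (a * g)"
        then obtain t v where "u = t + v" "v \<in> kys g" using keys_mult[of a g] by blast
        then have "u = w + t" using w by (simp add: mpoly_def add.commute)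
        then show ?thesis using w by blast
      qed (use gen_ideal_step in blast)
    qed
  qed simp
  ultimately show "p \<in> polys V \<and> (\<forall>u\<in>kys p. \<exists>w\<in>S. \<exists>t. u = w + t)" ..
next
  assume p: "p \<in> polys V \<and> (\<forall>u\<in>kys p. \<exists>w\<in>S. \<exists>t. u = w + t)"
  have "sgl u (lk p u) \<in> gen_ideal V (mpoly ` S)" if u: "u \<in> kys p" for u
  proof -
    obtain w t where w: "w \<in> S" "u = w + t" using bspec[OF conjunct2[OF p] u] by (elim bexE exE)
    have "kys u \<subseteq> V" using p u by (simp add: polys_def)
    then have "kys t \<subseteq> V" by (simp add: w(2) keys_add_monom)
    then have "sgl t (lk p u) * mpoly w \<in> gen_ideal V (mpoly ` S)"
      using w by (intro gen_ideal_mult gen_ideal_base polys_single) auto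
    moreover have "sgl t (lk p u) * mpoly w = sgl u (lk p u)"
      by (simp add: mpoly_def mult_single w add.commute)
    ultimately show ?thesis by simp
  qed
  then have "(\<Sum>u\<in>kys p. sgl u (lk p u)) \<in> gen_ideal V (mpoly ` S)" by (intro gen_ideal_sum)
  then show "p \<in> gen_ideal V (mpoly ` S)" by (simp add: single_sum_eq)
qed

theorem universal_lex_lex_hilbert:
  fixes L :: "'k::field polyn set"
  assumes V: "finite V" "\<And>v. v \<in> V \<Longrightarrow> v < z" and S: "S \<subseteq> monomials_in V" and L: "L
    = gen_ideal V (mpoly ` S)" "1 \<notin> L"
    and lex: "\<And>u v. u \<in> monomials_in (insert z V) \<Longrightarrow> v \<in> monomials_in (insert z V)
      \<Longrightarrow> mpoly u \<in> gen_ideal (insert z V) L \<Longrightarrow>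
      mdeg v = mdeg u \<Longrightarrow> v > u \<Longrightarrow> mpoly v \<in> gen_ideal (insert z V) L"
  shows "\<exists>s. lex_hilbert (card V) (\<lambda>q. vs.dim (graded_part L q)) s"
proof -
  \<comment> \<open>All monomials of \<open>L\<close> in place of the generators \<open>S\<close>,
    because \<open>univ_lex\<close> requires closure under multiples and the dimensions count all
    monomials.\<close>
  define T where "T = {u \<in> monomials_in V. (mpoly u :: 'k polyn) \<in> L}"
  have T: "u \<in> T \<longleftrightarrow> u \<in> monomials_in V \<and> (\<exists>w\<in>S. \<exists>t. u = w + t)" for u
    unfolding T_def L(1) mem_Collect_eq gen_ideal_mpoly_iff[OF S]
      by (simp add: monomials_in_def keys_mpoly)
  have ST: "S \<subseteq> T"
  proof
    fix u assume u: "u \<in> S"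
    then have "\<exists>w\<in>S. \<exists>t. u = w + t" by (intro bexI[of _ u] exI[of _ 0]) simp_all
    then show "u \<in> T" using T S u by blast
  qed
  have SZ: "S \<subseteq> monomials_in (insert z V)" using S by (auto simp: monomials_in_def)
  have LV: "L \<subseteq> polys V" unfolding L(1) using S
    by (intro gen_ideal_polys) (auto simp: monomials_in_def)
  have gZ: "gen_ideal (insert z V) L = gen_ideal (insert z V) (mpoly ` S)"
  proof
    show "gen_ideal (insert z V) L \<subseteq> gen_ideal (insert z V) (mpoly ` S)"
      using gen_ideal_mono_vars[of V "insert z V" "mpoly ` S"]
        by (intro gen_ideal_subset) (auto simp: L(1))
    show "gen_ideal (insert z V) (mpoly ` S) \<subseteq> gen_ideal (insert z V) L"
      by (rule gen_ideal_mono) (auto simp: L(1) intro: gen_ideal_base)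
  qed
  have mZ: "(mpoly u :: 'k polyn) \<in> gen_ideal (insert z V) L
    \<longleftrightarrow> u \<in> monomials_in (insert z V) \<and> (\<exists>w\<in>S. \<exists>t. u = w + t)" for u
    unfolding gZ gen_ideal_mpoly_iff[OF SZ] by (simp add: monomials_in_def keys_mpoly)
  have "univ_lex z V T"
    unfolding univ_lex_def
  proof (intro conjI ballI impI)
    show "T \<subseteq> monomials_in V" by (auto simp: T_def)
    fix u v assume u: "u \<in> T" and v: "v \<in> monomials_in V"
    obtain w t where w: "w \<in> S" "u = w + t" using iffD1[OF T u] by (elim conjE bexE exE)
    have "u + v = w + (t + v)" unfolding w(2) by (rule add.assoc)
    then have ex: "\<exists>w\<in>S. \<exists>t. u + v = w + t" using w(1) by (intro bexI[of _ w] exI[of _ "t + v"])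
    have "u + v \<in> monomials_in V" using v conjunct1[OF iffD1[OF T u]]
      by (simp only: monomials_in_add simp_thms)
    then show "u + v \<in> T" by (rule iffD2[OF T conjI[OF _ ex]])
  next
    fix u v assume u: "u \<in> T" and v: "v \<in> monomials_in (insert z V)" and d: "mdeg v
      = mdeg u \<and> u < v"
    have uZ: "u \<in> monomials_in (insert z V)" using u by (auto simp: T_def monomials_in_def)
    then have "(mpoly u :: 'k polyn) \<in> gen_ideal (insert z V) L"
      by (rule iffD2[OF mZ conjI[OF _ conjunct2[OF iffD1[OF T u]]]])
    then have "(mpoly v :: 'k polyn) \<in> gen_ideal (insert z V) L"
      by (rule lex[OF uZ v _ conjunct1[OF d] conjunct2[OF d]])
    from conjunct2[OF iffD1[OF mZ this]] ST show "\<exists>w\<in>T. \<exists>t. v = w + t"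
      by (elim bexE) (rule bexI, assumption, erule (1) subsetD)
  qed
  moreover have "0 \<notin> T" using L(2) by (simp add: T_def)
  ultimately obtain s where s: "lex_hilbert (card V) (\<lambda>q. card {u \<in> T. mdeg u = q}) s"
    using univ_lex_lex_hilbert[OF V(1) refl _ _ V(2)] by blast
  have "vs.dim (graded_part L q) = card {u \<in> T. mdeg u = q}" for q
  proof (rule dim_span_mpoly)
    have "{u \<in> T. mdeg u = q} \<subseteq> monoms_deg V q"
      by (auto simp: T_def monomials_in_def monoms_deg_def)
    then show "finite {u \<in> T. mdeg u = q}" using finite_monoms_deg[OF V(1)] finite_subset by blast
    show "graded_part L q = {p. kys p \<subseteq> {u \<in> T. mdeg u = q}}"
      unfolding graded_part_def L(1) gen_ideal_mpoly_iff[OF S] homog_def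
        by (auto simp: T polys_def monomials_in_def)
  qed
  then show ?thesis using s by (intro exI[of _ s]) simp
qed

section \<open>Quotient rings, Hilbert functions and depth\<close>

lemma PR_simps [simp]:
  "carrier (PR n) = polys {1..n}" "monoid.mult (PR n) = (*)" "one (PR n) = 1" "ring.zero (PR n)
    = 0" "ring.add (PR n) = (+)"
  by (auto simp: PR_def polys_def monoms_def)

lemma PR_cring: "cring (PR n :: 'k::field polyn ring)"
proof (rule cringI)
  show "abelian_group (PR n :: 'k polyn ring)"
  proof (rule abelian_groupI)
    fix x :: "'k polyn" assume "x \<in> carrier (PR n)"
    then show "\<exists>y\<in>carrier (PR n). y \<oplus>\<^bsub>PR n\<^esub> x = \<zero>\<^bsub>PR n\<^esub>"
      by (intro bexI[of _ "- x"]) (auto intro: polys_uminus)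
  qed (auto intro: polys_add simp: add_ac)
  show "comm_monoid (PR n :: 'k polyn ring)"
    by (rule comm_monoidI) (auto intro: polys_mult simp: mult_ac)
qed (auto simp: distrib_right)

lemma PR_ring: "ring (PR n :: 'k::field polyn ring)"
  using PR_cring by (rule cring.axioms)

lemma PR_uminus: "x \<in> polys {1..n} \<Longrightarrow> \<ominus>\<^bsub>PR n\<^esub> x = - x"
  using PR_ring[of n] by (intro abelian_group.minus_equality[of
    "PR n"]) (auto simp: ring_def intro: polys_uminus)

lemma ideal_PR_iff: "ideal I (PR n) \<longleftrightarrow> is_ideal {1..n} (I :: 'k::field polyn set)"
proof
  assume "ideal I (PR n)"
  then interpret ideal I "PR n :: 'k polyn ring" .
  show "is_ideal {1..n} I"
    unfolding is_ideal_def
    using a_subset additive_subgroup.zero_closed[OF is_additive_subgroup]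
      additive_subgroup.a_closed[OF is_additive_subgroup] I_l_closed by auto
next
  assume I: "is_ideal {1..n} I"
  show "ideal I (PR n)"
  proof (rule idealI[OF PR_ring])
    show "subgroup I (add_monoid (PR n))"
    proof (rule group.subgroupI)
      show "group (add_monoid (PR n :: 'k polyn ring))"
        by (rule abelian_group.a_group[OF ring.is_abelian_group[OF PR_ring]])
      fix a assume a: "a \<in> I"
      then have aV: "a \<in> polys {1..n}" using isidD[OF I] by blast
      have "- a \<in> I" using is_ideal_diff[OF I isidD(2)[OF I] a] by simp
      then have "\<ominus>\<^bsub>PR n\<^esub> a \<in> I" by (simp add: PR_uminus[OF aV])
      then show "inv\<^bsub>add_monoid (PR n)\<^esub> a \<in> I" by (simp add: a_inv_def)
    qed (use isidD[OF I] in auto)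
    fix a x :: "'k polyn" assume "a \<in> I" "x \<in> carrier (PR n)"
    then have "x * a \<in> I" using isidD(4)[OF I] by simp
    then show "x \<otimes>\<^bsub>PR n\<^esub> a \<in> I" "a \<otimes>\<^bsub>PR n\<^esub> x \<in> I" by (simp_all add: mult.commute)
  qed
qed

lemma Idl_PR_eq: "S \<subseteq> polys {1..n} \<Longrightarrow> Idl\<^bsub>PR n\<^esub> S = gen_ideal {1..n} S"
proof
  assume S: "S \<subseteq> polys {1..n}"
  have "ideal (gen_ideal {1..n} S) (PR n)" unfolding ideal_PR_iff by (rule is_ideal_gen_ideal[OF S])
  then show "Idl\<^bsub>PR n\<^esub> S \<subseteq> gen_ideal {1..n} S"
    unfolding genideal_def using gen_ideal_base by blast
  have "ideal (Idl\<^bsub>PR n\<^esub> S) (PR n)" "S \<subseteq> Idl\<^bsub>PR n\<^esub> S"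
    using ring.genideal_ideal[OF PR_ring, of S n] ring.genideal_self[OF PR_ring, of S n] S by auto
  then show "gen_ideal {1..n} S \<subseteq> Idl\<^bsub>PR n\<^esub> S" unfolding ideal_PR_iff by (rule gen_ideal_least)
qed

lemma hcomp_eq: "hcomp n q = forms {1..n} q"
  by (auto simp: hcomp_def forms_def homog_def)

lemma homogeneous_ideal_homog_ideal:
  assumes "homogeneous_ideal n I"
  shows "homog_ideal {1..n} I"
proof -
  obtain S where S: "S \<subseteq> (\<Union>q. forms {1..n} q)" "I = Idl\<^bsub>PR n\<^esub> S"
    using assms unfolding homogeneous_ideal_def hcomp_eq by blast
  have SV: "S \<subseteq> polys {1..n}" using S by (auto simp: forms_def)
  show ?thesis
    unfolding S(2) Idl_PR_eq[OF SV]
  proof (rule homog_ideal_gen_ideal[OF SV])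
    fix g q assume g: "g \<in> S"
    then obtain d where "homog d g" using S by (auto simp: forms_def)
    then show "homog_part q g \<in> gen_ideal {1..n} S" using g
      by (auto simp: homog_part_homog intro: gen_ideal_base)
  qed
qed

lemma monoms_eq: "monoms n = monomials_in {1..n}"
  by (simp add: monoms_def monomials_in_def)

lemma monomial_ideal_gen_ideal:
  assumes "monomial_ideal n L"
  obtains S where "S \<subseteq> monomials_in {1..n}" "L = gen_ideal {1..n} (mpoly ` S)"
proof -
  obtain S where S: "S \<subseteq> monoms n" "L = Idl\<^bsub>PR n\<^esub> (mpoly ` S)"
    using assms unfolding monomial_ideal_def by blast
  have "mpoly ` S \<subseteq> polys {1..n}" using S by (auto simp: monoms_def)
  then have "L = gen_ideal {1..n} (mpoly ` S)" using S(2) Idl_PR_eq by blast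
  moreover have "S \<subseteq> monomials_in {1..n}" using S(1) by (simp only: monoms_eq)
  ultimately show ?thesis by (rule that[rotated])
qed

lemma monomial_ideal_homog_ideal: "monomial_ideal n L \<Longrightarrow> homog_ideal {1..n} L"
proof -
  assume "monomial_ideal n L"
  then obtain S where S: "S \<subseteq> monomials_in {1..n}" "L = gen_ideal {1..n} (mpoly ` S)"
    by (rule monomial_ideal_gen_ideal)
  show ?thesis
    unfolding S(2)
  proof (rule homog_ideal_gen_ideal)
    show "mpoly ` S \<subseteq> polys {1..n}" using S by (auto simp: monomials_in_def)
    fix g q assume "g \<in> mpoly ` S"
    then obtain u where u: "u \<in> S" "g = mpoly u" by blast
    then have "homog (mdeg u) g" by (simp add: homog_mpoly)
    then show "homog_part q g \<in> gen_ideal {1..n} (mpoly ` S)" using u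
      by (auto simp: homog_part_homog intro: gen_ideal_base)
  qed
qed

section \<open>Ideals and regular sequences of the quotient ring\<close>

context
  fixes n :: nat and I :: "'k::field polyn set"
  assumes I: "is_ideal {1..n} I"
begin


lemma ideal_I: "ideal I (PR n)"
  using I by (simp add: ideal_PR_iff)

lemma Q_ring: "ring (PR n Quot I)"
  by (rule ideal.quotient_is_ring[OF ideal_I])

lemma pr_hom: "ring_hom_ring (PR n) (PR n Quot I) (a_r_coset (PR n) I)"
  by (rule ideal.rcos_ring_hom_ring[OF ideal_I])

lemma pr_eq: "(a_r_coset (PR n) I) p = (\<lambda>h. h + p) ` I"
  by (auto simp: a_r_coset_def')

lemma pr_eq_iff: "(a_r_coset (PR n) I) p = (a_r_coset (PR n) I) q \<longleftrightarrow> p - q \<in> I"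
proof
  assume "(a_r_coset (PR n) I) p = (a_r_coset (PR n) I) q"
  moreover have "p \<in> (a_r_coset (PR n) I) p" unfolding pr_eq using isidD(2)[OF I]
    by (intro image_eqI[of _ _ 0]) auto
  ultimately obtain h where "h \<in> I" "p = h + q" by (auto simp: pr_eq)
  then show "p - q \<in> I" by simp
next
  have *: "(a_r_coset (PR n) I) p \<subseteq> (a_r_coset (PR n) I) q" if "p - q \<in> I" for p q
  proof
    fix x assume "x \<in> (a_r_coset (PR n) I) p"
    then obtain h where "h \<in> I" "x = h + p" by (auto simp: pr_eq)
    then have "x = (h + (p - q)) + q" "h + (p - q) \<in> I" using isidD(3)[OF I] that by auto
    then show "x \<in> (a_r_coset (PR n) I) q" unfolding pr_eq by blast
  qed
  assume "p - q \<in> I"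
  moreover from this have "q - p \<in> I" using is_ideal_diff[OF I isidD(2)[OF I]] by fastforce
  ultimately show "(a_r_coset (PR n) I) p = (a_r_coset (PR n) I) q" using * by blast
qed

lemma Q_carrier: "carrier (PR n Quot I) = (a_r_coset (PR n) I) ` polys {1..n}"
  by (auto simp: FactRing_def A_RCOSETS_def')

lemma Q_ops:
  "p \<in> polys {1..n} \<Longrightarrow> q \<in> polys {1..n} \<Longrightarrow> (a_r_coset (PR n) I) p \<oplus>\<^bsub>(PR n Quot I)\<^esub> (a_r_coset (PR n)
    I) q = (a_r_coset (PR n) I) (p + q)"
  "p \<in> polys {1..n} \<Longrightarrow> q \<in> polys {1..n} \<Longrightarrow> (a_r_coset (PR n) I) p \<otimes>\<^bsub>(PR n Quot I)\<^esub> (a_r_coset (PR n)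
    I) q = (a_r_coset (PR n) I) (p * q)"
  "\<zero>\<^bsub>(PR n Quot I)\<^esub> = (a_r_coset (PR n) I) 0" "\<one>\<^bsub>(PR n Quot I)\<^esub> = (a_r_coset (PR n) I) 1"
proof -
  have h: "(a_r_coset (PR n) I) \<in> ring_hom (PR n) (PR n Quot I)"
    by (rule ring_hom_ring.homh[OF pr_hom])
  show "p \<in> polys {1..n} \<Longrightarrow> q \<in> polys {1..n}
    \<Longrightarrow> (a_r_coset (PR n) I) p \<oplus>\<^bsub>(PR n Quot I)\<^esub> (a_r_coset (PR n) I) q = (a_r_coset (PR n) I) (p + q)"
    "p \<in> polys {1..n} \<Longrightarrow> q \<in> polys {1..n} \<Longrightarrow> (a_r_coset (PR n) I) p \<otimes>\<^bsub>(PR n Quot I)\<^esub> (a_r_coset (PR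
      n) I) q = (a_r_coset (PR n) I) (p * q)"
    using ring_hom_add[OF h, of p q] ring_hom_mult[OF h, of p q] by auto
  show "\<one>\<^bsub>(PR n Quot I)\<^esub> = (a_r_coset (PR n) I) 1" using ring_hom_one[OF h] by simp
  show "\<zero>\<^bsub>(PR n Quot I)\<^esub> = (a_r_coset (PR n) I) 0" by (auto simp: FactRing_def pr_eq)
qed

text \<open>The correspondence of ideals of the quotient with ideals containing \<open>I\<close>:
  one inclusion by taking images, the other by taking preimages.\<close>

lemma Idl_Q:
  assumes T: "T \<subseteq> polys {1..n}"
  shows "Idl\<^bsub>(PR n Quot I)\<^esub> ((a_r_coset (PR n) I) ` T)
    = (a_r_coset (PR n) I) ` gen_ideal {1..n} (I \<union> T)"
proof
  have IT: "I \<union> T \<subseteq> polys {1..n}" using T isidD(1)[OF I] by blast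
  have J: "ideal (gen_ideal {1..n} (I \<union> T)) (PR n)" unfolding ideal_PR_iff
    by (rule is_ideal_gen_ideal[OF IT])
  have "ideal ((a_r_coset (PR n) I) ` gen_ideal {1..n} (I \<union> T)) (PR n Quot I)"
    by (rule ring.ring_ideal_imp_quot_ideal[OF PR_ring ideal_I J])
  then show "Idl\<^bsub>(PR n Quot I)\<^esub> ((a_r_coset (PR n) I) ` T)
    \<subseteq> (a_r_coset (PR n) I) ` gen_ideal {1..n} (I \<union> T)"
    unfolding genideal_def using gen_ideal_base[of _ "I \<union> T" "{1..n}"] by blast
  have TQ: "(a_r_coset (PR n) I) ` T \<subseteq> carrier (PR n Quot I)" using T Q_carrier by blast
  have K: "ideal (Idl\<^bsub>(PR n Quot I)\<^esub> ((a_r_coset (PR n) I) ` T)) (PR n Quot I)"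
    by (rule ring.genideal_ideal[OF Q_ring TQ])
  have TK: "(a_r_coset (PR n) I) ` T \<subseteq> Idl\<^bsub>(PR n Quot I)\<^esub> ((a_r_coset (PR n) I) ` T)"
    by (rule ring.genideal_self[OF Q_ring TQ])
  let ?P = "{r \<in> carrier (PR n). (a_r_coset (PR n) I) r
    \<in> Idl\<^bsub>(PR n Quot I)\<^esub> ((a_r_coset (PR n) I) ` T)}"
  have "ideal ?P (PR n)" by (rule ring_hom_ring.ideal_vimage[OF pr_hom K])
  then have P: "is_ideal {1..n} ?P" by (simp only: ideal_PR_iff)
  have "(a_r_coset (PR n) I) i = (a_r_coset (PR n) I) 0" if "i \<in> I" for i using that
    by (simp add: pr_eq_iff)
  moreover have "(a_r_coset (PR n) I) 0 \<in> Idl\<^bsub>(PR n Quot I)\<^esub> ((a_r_coset (PR n) I) ` T)"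
    using additive_subgroup.zero_closed[OF ideal.axioms(1)[OF K]] by (simp add: Q_ops)
  ultimately have "I \<union> T \<subseteq> ?P" using IT TK by auto
  then have "gen_ideal {1..n} (I \<union> T) \<subseteq> ?P" by (rule gen_ideal_least[OF P])
  then show "(a_r_coset (PR n) I) ` gen_ideal {1..n} (I \<union> T)
    \<subseteq> Idl\<^bsub>(PR n Quot I)\<^esub> ((a_r_coset (PR n) I) ` T)" by blast
qed

lemma pr_mem_Idl:
  assumes T: "T \<subseteq> polys {1..n}" and p: "p \<in> polys {1..n}"
  shows "(a_r_coset (PR n) I) p \<in> Idl\<^bsub>(PR n Quot I)\<^esub> ((a_r_coset (PR n) I) ` T)
    \<longleftrightarrow> p \<in> gen_ideal {1..n} (I \<union> T)"
proof
  assume "(a_r_coset (PR n) I) p \<in> Idl\<^bsub>(PR n Quot I)\<^esub> ((a_r_coset (PR n) I) ` T)"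
  then obtain j where j: "j \<in> gen_ideal {1..n} (I \<union> T)" "(a_r_coset (PR n) I) p
    = (a_r_coset (PR n) I) j" unfolding Idl_Q[OF T] by blast
  then have "p - j \<in> I" using pr_eq_iff by blast
  then have "p - j \<in> gen_ideal {1..n} (I \<union> T)" by (intro gen_ideal_base) simp
  then show "p \<in> gen_ideal {1..n} (I \<union> T)" using gen_ideal_add[OF _ j(1), of "p - j"] by simp
qed (unfold Idl_Q[OF T], rule imageI)

text \<open>Conditions on cosets become conditions on ideal membership of polynomials, the form in
  which the Koszul and the substitution arguments speak of regularity.\<close>

lemma regular_sequence_pr:
  assumes ts: "set ts \<subseteq> polys {1..n}"
  shows "regular_sequence (PR n Quot I) (map (a_r_coset (PR n) I) ts)
    \<longleftrightarrow> gen_ideal {1..n} (I \<union> set ts) \<noteq> polys {1..n} \<and>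
    (\<forall>i<length ts. \<forall>p\<in>polys {1..n}. ts ! i * p \<in> gen_ideal {1..n} (I \<union> set (take i ts)) \<longrightarrow> p \<in>
      gen_ideal {1..n} (I \<union> set (take i ts)))"
proof -
  have tk: "set (take i ts) \<subseteq> polys {1..n}" for i using ts set_take_subset by fast
  have IT: "I \<union> set ts \<subseteq> polys {1..n}" using ts isidD(1)[OF I] by blast
  have 1: "set (map (a_r_coset (PR n) I) ts) \<subseteq> carrier (PR n Quot I)" using ts Q_carrier by auto
  have "Idl\<^bsub>(PR n Quot I)\<^esub> (set (map (a_r_coset (PR n) I) ts)) = carrier (PR n Quot I)
    \<longleftrightarrow> gen_ideal {1..n} (I \<union> set ts) = polys {1..n}"
  proof
    assume *: "Idl\<^bsub>(PR n Quot I)\<^esub> (set (map (a_r_coset (PR n) I) ts)) = carrier (PR n Quot I)"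
    have "p \<in> gen_ideal {1..n} (I \<union> set ts)" if "p \<in> polys {1..n}" for p
      using pr_mem_Idl[OF ts that] * that Q_carrier by simp
    then show "gen_ideal {1..n} (I \<union> set ts) = polys {1..n}" using gen_ideal_polys[OF IT] by blast
  next
    assume "gen_ideal {1..n} (I \<union> set ts) = polys {1..n}"
    then show "Idl\<^bsub>(PR n Quot I)\<^esub> (set (map (a_r_coset (PR n) I) ts)) = carrier (PR n Quot I)"
      using Idl_Q[OF ts] Q_carrier by simp
  qed
  moreover have "(\<forall>r\<in>carrier (PR n Quot I). map (a_r_coset (PR n) I) ts ! i \<otimes>\<^bsub>(PR n Quot I)\<^esub> r
    \<in> Idl\<^bsub>(PR n Quot I)\<^esub> (set (take i (map (a_r_coset (PR n) I) ts)))
      \<longrightarrow> r \<in> Idl\<^bsub>(PR n Quot I)\<^esub> (set (take i (map (a_r_coset (PR n) I) ts)))) \<longleftrightarrow>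
    (\<forall>p\<in>polys {1..n}. ts ! i * p \<in> gen_ideal {1..n} (I \<union> set (take i ts)) \<longrightarrow> p \<in> gen_ideal {1..n}
      (I \<union> set (take i ts)))"
    if i: "i < length ts" for i
  proof -
    have ti: "ts ! i \<in> polys {1..n}" using ts i nth_mem by blast
    have "map (a_r_coset (PR n) I) ts ! i \<otimes>\<^bsub>(PR n Quot I)\<^esub> (a_r_coset (PR n) I) p
      = (a_r_coset (PR n) I) (ts ! i * p)" if "p \<in> polys {1..n}" for p
      using i Q_ops(2)[OF ti that] by simp
    then show ?thesis
      unfolding Q_carrier take_map set_map
      using pr_mem_Idl[OF tk[of i]] polys_mult[OF ti] by auto
  qed
  ultimately show ?thesis unfolding regular_sequence_def using 1 by auto
qed

end

section \<open>The graded maximal ideal and depth\<close>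

lemma is_ideal_const_term_0: "is_ideal V {p \<in> polys V. lk p 0 = 0}"
proof -
  have "lk (a * p) 0 = 0" if "lk p 0 = 0" for a p :: "'a polyn"
  proof (rule ccontr)
    assume "lk (a * p) 0 \<noteq> 0"
    then have "0 \<in> kys (a * p)" by (simp add: in_keys_iff)
    then obtain u v where uv: "0 = u + v" "v \<in> kys p" using keys_mult[of a p] by blast
    then have "v = 0" by (metis mdeg_0 mdeg_add mdeg_eq_0_iff add_is_0)
    then show False using uv that by (simp add: in_keys_iff)
  qed
  then show ?thesis by (auto simp: is_ideal_def lookup_add intro: polys_add polys_mult)
qed

lemma max_ideal_eq: "max_ideal n = {p \<in> polys {1..n}. lk p 0 = 0}"
proof -
  have eq: "(\<lambda>i. mpoly (sgl i 1)) ` {1..n} = var ` {1..n}" by (simp add: var_def)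
  have sub: "var ` {1..n} \<subseteq> {p \<in> polys {1..n}. lk p 0 = (0::'a)}" by auto
  have "max_ideal n = (gen_ideal {1..n} (var ` {1..n}) :: 'a polyn set)"
    unfolding max_ideal_def eq using sub by (intro Idl_PR_eq) blast
  also have "\<dots> = {p \<in> polys {1..n}. lk p 0 = 0}"
  proof
    show "gen_ideal {1..n} (var ` {1..n}) \<subseteq> {p \<in> polys {1..n}. lk p 0 = (0::'a)}"
      by (rule gen_ideal_least[OF is_ideal_const_term_0 sub])
    show "{p \<in> polys {1..n}. lk p 0 = 0} \<subseteq> gen_ideal {1..n} (var ` {1..n} :: 'a polyn set)"
    proof
      fix p :: "'a polyn" assume "p \<in> {p \<in> polys {1..n}. lk p 0 = 0}"
      then obtain a where a: "\<forall>j\<in>{1..n}. a j \<in> polys {1..n}" "p = (\<Sum>j\<in>{1..n}. a j * var j)"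
        using const_term_0_decomp[of "{1..n}" p] by auto
      show "p \<in> gen_ideal {1..n} (var ` {1..n})"
        unfolding a(2)
      proof (rule gen_ideal_sum)
        fix j assume j: "j \<in> {1..n}"
        show "a j * var j \<in> gen_ideal {1..n} (var ` {1..n})"
          by (rule gen_ideal_mult[OF gen_ideal_base[OF imageI[OF j]] bspec[OF a(1) j]])
      qed
    qed
  qed
  finally show ?thesis .
qed

lemma proper_const_term_0:
  assumes "homog_ideal V I" "I \<noteq> polys V"
  shows "I \<subseteq> {p \<in> polys V. lk p 0 = 0}"
proof
  have i: "is_ideal V I" using assms by (simp add: homog_ideal_def)
  fix p assume p: "p \<in> I"
  obtain c where c: "homog_part 0 p = const c" using homog_0_const[OF homog_homog_part] by blast
  have "lk (homog_part 0 p) 0 = lk p 0" by (simp add: lookup_homog_part)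
  then have lk: "lk p 0 = c" by (simp add: c const_def)
  have cI: "const c \<in> I" using assms(1) p c by (metis homog_ideal_def)
  have "c = 0"
  proof (rule ccontr)
    assume c0: "c \<noteq> 0"
    have "q \<in> I" if "q \<in> polys V" for q
    proof -
      have "(q * const (inverse c)) * const c \<in> I" using that cI
        by (intro isidD(4)[OF i] polys_mult) auto
      moreover have "(q * const (inverse c)) * const c = q * (const c * const (inverse c))"
        by (simp only: mult_ac)
      ultimately show ?thesis using const_inverse[OF c0] by (simp only: mult_1_right)
    qed
    then show False using assms(2) isidD(1)[OF i] by blast
  qed
  then show "p \<in> {p \<in> polys V. lk p 0 = 0}" using lk p isidD(1)[OF i] by auto
qed

lemma gen_ideal_gen_ideal_Un: "gen_ideal V (gen_ideal V G \<union> T) = gen_ideal V (G \<union> T)"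
proof
  show "gen_ideal V (gen_ideal V G \<union> T) \<subseteq> gen_ideal V (G \<union> T)"
    using gen_ideal_mono[of G "G \<union> T" V] gen_ideal_base[of _ T V] gen_ideal_mono[of T "G \<union> T" V]
      by (intro gen_ideal_subset) blast
  show "gen_ideal V (G \<union> T) \<subseteq> gen_ideal V (gen_ideal V G \<union> T)"
    by (rule gen_ideal_mono) (auto intro: gen_ideal_base)
qed

theorem depth_quot_eqI:
  fixes I :: "'k::field polyn set"
  assumes I: "homog_ideal {1..n} I" "I \<noteq> polys {1..n}" "I = gen_ideal {1..n} G" and K:
    "koszul_nonzero {1..n} G s"
    and ex: "\<exists>ts. length ts + s = n \<and> (\<forall>i<length ts. ts ! i \<in> polys {1..n} \<and> lk (ts ! i) 0 = 0 \<and>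
    (\<forall>p\<in>polys {1..n}. ts ! i * p \<in> gen_ideal {1..n} (G \<union> set (take i ts)) \<longrightarrow> p \<in> gen_ideal {1..n}
      (G \<union> set (take i ts))))"
  shows "depth_quot n I = enat (n - s)"
proof -
  have i: "is_ideal {1..n} I" using I by (simp add: homog_ideal_def)
  have gI: "gen_ideal {1..n} (I \<union> T) = gen_ideal {1..n} (G \<union> T)" for T unfolding I(3)
    by (rule gen_ideal_gen_ideal_Un)
  let ?pr = "\<lambda>p. I +>\<^bsub>PR n\<^esub> p"
  show ?thesis
    unfolding depth_quot_def
  proof (rule antisym)
    show "(SUP fs\<in>{fs. regular_sequence (PR n Quot I) fs \<and> set fs
      \<subseteq> ?pr ` max_ideal n}. enat (length fs)) \<le> enat (n - s)"
    proof (rule SUP_least)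
      fix fs assume "fs \<in> {fs. regular_sequence (PR n Quot I) fs \<and> set fs \<subseteq> ?pr ` max_ideal n}"
      then have fs: "regular_sequence (PR n Quot I) fs" "set fs \<subseteq> ?pr ` max_ideal n" by auto
      have "\<exists>ts. fs = map ?pr ts \<and> set ts \<subseteq> max_ideal n"
        using fs(2)
      proof (induction fs)
        case (Cons f fs)
        then obtain ts t where "fs = map ?pr ts" "set ts \<subseteq> max_ideal n" "f = ?pr t"
          "t \<in> max_ideal n" by auto
        then show ?case by (intro exI[of _ "t # ts"]) simp
      qed simp
      then obtain ts where ts: "fs = map ?pr ts" "set ts \<subseteq> max_ideal n" by blast
      have tsV: "ts ! j \<in> polys {1..n}" "lk (ts ! j) 0 = 0" if "j < length ts" for j
        using ts(2) nth_mem[OF that] unfolding max_ideal_eq by auto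
      have "set ts \<subseteq> polys {1..n}" using ts(2) unfolding max_ideal_eq by auto
      from fs(1)[unfolded ts(1) regular_sequence_pr[OF i this] gI]
      have reg: "\<And>i p. i < length ts \<Longrightarrow> p \<in> polys {1..n}
        \<Longrightarrow> ts ! i * p \<in> gen_ideal {1..n} (G \<union> set (take i ts))
        \<Longrightarrow> p \<in> gen_ideal {1..n} (G \<union> set (take i ts))" by blast
      have "length ts + s \<le> card {1..n}"
        using regular_sequence_bound[OF _ K tsV reg] by blast
      then show "enat (length fs) \<le> enat (n - s)" using ts(1) by simp
    qed
    obtain ts where ts: "length ts + s = n"
      and tsV: "\<And>i. i < length ts \<Longrightarrow> ts ! i \<in> polys {1..n} \<and> lk (ts ! i) 0 = 0"
      and reg: "\<And>i p. i < length ts \<Longrightarrow> p \<in> polys {1..n}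
        \<Longrightarrow> ts ! i * p \<in> gen_ideal {1..n} (G \<union> set (take i ts))
        \<Longrightarrow> p \<in> gen_ideal {1..n} (G \<union> set (take i ts))" using ex by blast
    have sm: "set ts \<subseteq> {p \<in> polys {1..n}. lk p 0 = 0}" using tsV by (auto simp: set_conv_nth)
    then have sV: "set ts \<subseteq> polys {1..n}" by blast
    \<comment> \<open>The ideal of the sequence is proper: \<open>I\<close> and all members of the
      sequence vanish at the origin.\<close>
    have "I \<union> set ts \<subseteq> {p \<in> polys {1..n}. lk p 0 = 0}" using sm proper_const_term_0[OF I(1,2)]
      by blast
    then have "gen_ideal {1..n} (I \<union> set ts) \<subseteq> {p \<in> polys {1..n}. lk p 0 = 0}"
      by (rule gen_ideal_least[OF is_ideal_const_term_0])
    moreover have "1 \<in> polys {1..n}" "lk (1 :: 'k polyn) 0 \<noteq> 0" by simp_all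
    ultimately have "gen_ideal {1..n} (I \<union> set ts) \<noteq> polys {1..n}" by blast
    then have "regular_sequence (PR n Quot I) (map ?pr ts)"
      unfolding regular_sequence_pr[OF i sV] using reg unfolding gI by blast
    moreover have "set (map ?pr ts) \<subseteq> ?pr ` max_ideal n" using sm unfolding max_ideal_eq by auto
    ultimately have "enat (length (map ?pr ts)) \<le> (SUP fs\<in>{fs. regular_sequence (PR n Quot I) fs
      \<and> set fs \<subseteq> ?pr ` max_ideal n}. enat (length fs))"
      by (intro SUP_upper) simp
    then show "enat (n - s) \<le> (SUP fs\<in>{fs. regular_sequence (PR n Quot I) fs \<and> set fs
      \<subseteq> ?pr ` max_ideal n}. enat (length fs))"
      using ts by auto
  qed
qed

section \<open>The Hilbert function of a quotient\<close>

lemma subfield_const: "subfield (range const) (PR n :: 'k::field polyn ring)"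
proof (rule ring.subfieldI[OF PR_ring])
  interpret R: cring "PR n :: 'k polyn ring" by (rule PR_cring)
  have "subring (range const) (PR n :: 'k polyn ring)"
  proof (rule R.subringI)
    fix h :: "'k polyn" assume "h \<in> range const"
    then obtain c where c: "h = const c" by blast
    have "const c + const (- c) = (0 :: 'k polyn)" by (simp flip: const_add)
    then have "- h = const (- c)" unfolding c by (simp only: minus_unique)
    moreover have "\<ominus>\<^bsub>PR n\<^esub> h = - h" unfolding c by (rule PR_uminus) simp
    ultimately show "\<ominus>\<^bsub>PR n\<^esub> h \<in> range const" by simp
  next
    show "\<one>\<^bsub>PR n\<^esub> \<in> range const" using const_1 by (metis PR_simps(3) rangeI)
  qed (auto simp flip: const_add const_mult)
  then show "subcring (range const) (PR n :: 'k polyn ring)"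
    by (rule R.subcringI')
  show "Units (PR n \<lparr>carrier := range const\<rparr>) = range const - {\<zero>\<^bsub>PR n :: 'k polyn ring\<^esub>}"
  proof (intro equalityI subsetI)
    fix x assume "x \<in> Units (PR n \<lparr>carrier := range const\<rparr> :: 'k polyn ring)"
    then obtain y where "x \<in> range const" "y * x = 1" by (auto simp: Units_def)
    then show "x \<in> range const - {\<zero>\<^bsub>PR n\<^esub>}" by auto
  next
    fix x assume "x \<in> range const - {\<zero>\<^bsub>PR n :: 'k polyn ring\<^esub>}"
    then obtain c where c: "x = const c" "c \<noteq> 0" by auto
    have "const c * const (inverse c) = 1" "const (inverse c) * const c = 1"
      using const_inverse[OF c(2)] by (simp_all add: mult.commute)
    then show "x \<in> Units (PR n \<lparr>carrier := range const\<rparr> :: 'k polyn ring)"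
      unfolding Units_def c by auto
  qed
qed

text \<open>A basis of a complement of the part of \<open>I\<close> in degree \<open>q\<close> maps
  to a basis of the component of the quotient. The equation is additive, which avoids truncated
  subtraction.\<close>

lemma hilbert_fun_eq:
  fixes I :: "'k::field polyn set"
  assumes I: "is_ideal {1..n} I"
  shows "hilbert_fun n I q + vs.dim (graded_part I q) = hilb n q"
proof -
  let ?pr = "\<lambda>p. I +>\<^bsub>PR n\<^esub> p"
  let ?Q = "PR n Quot I"
  let ?K = "(\<lambda>c. ?pr (const c)) ` UNIV"
  note ops = Q_ops[OF I]
  have fin: "finite (mpoly ` monoms_deg {1..n} q :: 'k polyn set)"
    using finite_monoms_deg[of "{1..n}" q] by simp
  interpret Q: ring ?Q by (rule Q_ring[OF I])
  obtain S where S: "finite S" "S \<subseteq> forms {1..n} q" "card S + vs.dim (graded_part I q)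
    = vs.dim (forms {1..n} q :: 'k polyn set)"
    "forms {1..n} q \<subseteq> vs.span (graded_part I q \<union> S)" "vs.independent S"
      "graded_part I q \<inter> vs.span S = {0}"
    using fd_complement[OF fin forms_span graded_part_forms[OF I] subspace_graded_part[OF I]
      subspace_forms] by auto
  have HVV: "forms {1..n} q \<subseteq> (polys {1..n} :: 'k polyn set)" by (auto simp: forms_def)
  have spHV: "vs.span T \<subseteq> forms {1..n} q" if "T \<subseteq> S" for T
    using that S subspace_forms by (intro vs.span_minimal) auto
  \<comment> \<open>The dimension of the library is built by line extensions, so the basis enters
    one vector at a time.\<close>
  have dimT: "ring.dimension ?Q (card T) ?K (?pr ` vs.span T)" if "T \<subseteq> S" for T
    using finite_subset[OF that S(1)] that
  proof (induction T)
    case empty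
    have "?pr ` vs.span {} = {\<zero>\<^bsub>?Q\<^esub>}" by (simp add: ops)
    then show ?case using Q.zero_dim by simp
  next
    case (insert v T)
    have vS: "v \<in> S" "T \<subseteq> S" using insert by auto
    have vV: "v \<in> polys {1..n}" using vS S HVV by blast
    have vT: "v \<notin> vs.span T"
    proof
      assume "v \<in> vs.span T"
      moreover have "vs.span T \<subseteq> vs.span (S - {v})" using insert by (intro vs.span_mono) auto
      ultimately show False using S(5) vS(1) unfolding vs.dependent_def by blast
    qed
    have "?pr v \<notin> ?pr ` vs.span T"
    proof
      assume "?pr v \<in> ?pr ` vs.span T"
      then obtain x where x: "x \<in> vs.span T" "?pr v = ?pr x" by blast
      then have "v - x \<in> I" using pr_eq_iff[OF I] by blast
      moreover have "x \<in> vs.span S" using x vs.span_mono[OF vS(2)] by blast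
      then have vx: "v - x \<in> vs.span S" by (rule vs.span_diff[OF vs.span_base[OF vS(1)]])
      moreover have "homog q (v - x)" using vx spHV[OF order_refl] by (auto simp: forms_def)
      ultimately have "v - x \<in> graded_part I q \<inter> vs.span S" by (simp add: graded_part_def)
      then show False using S(6) x vT by simp
    qed
    moreover have "?pr v \<in> carrier ?Q" using vV Q_carrier[OF I] by blast
    ultimately have "ring.dimension ?Q (Suc (card T)) ?K (ring.line_extension ?Q ?K (?pr v) (?pr `
      vs.span T))"
      using insert.IH[OF vS(2)] by (intro Q.Suc_dim)
    moreover have "ring.line_extension ?Q ?K (?pr v) (?pr ` vs.span T) = ?pr ` vs.span (insert v T)"
    proof -
      have eq: "?pr (const c) \<otimes>\<^bsub>?Q\<^esub> ?pr v \<oplus>\<^bsub>?Q\<^esub> ?pr y = ?pr (scalar_mult c v + y)" if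
        "y \<in> vs.span T" for c y
      proof -
        have "y \<in> polys {1..n}" using that spHV[OF vS(2)] HVV by blast
        then show ?thesis using vV by (simp add: ops polys_mult scalar_mult_def)
      qed
      have le: "u \<in> ring.line_extension ?Q ?K (?pr v) (?pr ` vs.span T) \<longleftrightarrow> (\<exists>c. \<exists>y\<in>vs.span T. u
        = ?pr (scalar_mult c v + y))" for u
        unfolding Q.line_extension_mem_iff using eq by auto
      have sp: "vs.span (insert v T) = {scalar_mult c v + y | c y. y \<in> vs.span T}"
      proof -
        have iff: "x \<in> vs.span (insert v T) \<longleftrightarrow> (\<exists>c. x - scalar_mult c v \<in> vs.span T)" for x
          unfolding vs.span_insert by simp
        show ?thesis
        proof (intro equalityI subsetI)
          fix x assume "x \<in> vs.span (insert v T)"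
          then obtain c where "x - scalar_mult c v \<in> vs.span T" using iff by blast
          then show "x \<in> {scalar_mult c v + y | c y. y \<in> vs.span T}"
            by (intro CollectI exI[of _ c] exI[of _ "x - scalar_mult c v"]) simp
        next
          fix x assume "x \<in> {scalar_mult c v + y | c y. y \<in> vs.span T}"
          then obtain c y where "x = scalar_mult c v + y" "y \<in> vs.span T" by blast
          then show "x \<in> vs.span (insert v T)" unfolding iff by (intro exI[of _ c]) simp
        qed
      qed
      show ?thesis
      proof (rule Set.set_eqI)
        fix u
        show "u \<in> ring.line_extension ?Q ?K (?pr v) (?pr ` vs.span T)
          \<longleftrightarrow> u \<in> ?pr ` vs.span (insert v T)"
          unfolding le sp image_iff by blast
      qed
    qed
    ultimately show ?case using insert by simp
  qed
  have "?pr ` hcomp n q = ?pr ` vs.span S"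
  proof (intro equalityI subsetI)
    fix u assume "u \<in> ?pr ` hcomp n q"
    then obtain x where x: "x \<in> forms {1..n} q" "u = ?pr x" unfolding hcomp_eq by blast
    then have "x \<in> vs.span (graded_part I q \<union> S)" using S by blast
    then obtain a b where ab: "a \<in> vs.span (graded_part I q)" "b \<in> vs.span S" "x = a + b"
      unfolding vs.span_Un by blast
    have "a \<in> graded_part I q" using ab(1) vs.span_minimal[OF order_refl subspace_graded_part[OF
      I]] by blast
    then have "?pr x = ?pr b" using pr_eq_iff[OF I, of x b] ab by (simp add: graded_part_def)
    then show "u \<in> ?pr ` vs.span S" using x ab by blast
  qed (use spHV[OF order_refl] hcomp_eq in blast)
  then have dim: "ring.dimension ?Q (card S) ?K (?pr ` hcomp n q)" using dimT[OF order_refl] by simp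
  have "hilbert_fun n I q = card S"
    unfolding hilbert_fun_def
  proof (rule the_equality)
    show "ring.dimension ?Q (card S) ?K (?pr ` hcomp n q)" by (rule dim)
    fix d assume d: "ring.dimension ?Q d ?K (?pr ` hcomp n q)"
    show "d = card S"
    proof (cases "\<one>\<^bsub>?Q\<^esub> = \<zero>\<^bsub>?Q\<^esub>")
      case False
      have "subfield (?pr ` range const) ?Q"
        using ring_hom_ring.img_is_subfield(2)[OF pr_hom[OF I] subfield_const False] .
      moreover have "?pr ` range const = ?K" by auto
      ultimately have "subfield ?K ?Q" by simp
      then show ?thesis using Q.dimension_is_inj[OF _ d dim] by blast
    next
      case True
      \<comment> \<open>In the zero ring the image of the constants is not a field, so uniqueness of
        the dimension is read off from its inductive definition.\<close>
      have zero: "carrier ?Q = {\<zero>\<^bsub>?Q\<^esub>}" using Q.one_zeroD[OF True] .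
      have "\<zero>\<^bsub>?Q\<^esub> \<in> E \<and> m = 0" if "ring.dimension ?Q m K' E" for m K' E
        using that by (induction rule: Q.dimension.induct) (use zero in auto)
      then show ?thesis using d dim by metis
    qed
  qed
  then show ?thesis using S(3) dim_forms[of "{1..n}" q, where ?'k='k] by simp
qed

theorem depth_quot_of_lex_hilbert:
  fixes I :: "'k::field polyn set"
  assumes lex_hilbert: "lex_hilbert n c s" and I: "homog_ideal {1..n} I" and dim:
    "\<And>q. vs.dim (graded_part I q) = c q"
  shows "depth_quot n I = enat (n - s)"
proof -
  have st: "if s = 0 then I = {0} else \<exists>G. critical_gens {1..n} G s \<and> gen_ideal {1..n} G = I"
    using critical_structure[OF lex_hilbert _ _ I dim] by simp
  have "I \<noteq> polys {1..n}"
  proof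
    assume "I = polys {1..n}"
    then have "vs.dim (graded_part I 0) = hilb n 0" using dim_forms[of "{1..n}" 0, where ?'k='k]
      by (simp add: graded_part_polys_UNIV)
    then show False using dim[of 0] lex_hilbert_0[OF lex_hilbert] by simp
  qed
  show ?thesis
  proof (cases "s = 0")
    case True
    then have "I = gen_ideal {1..n} {}" using st by simp
    from depth_quot_eqI[OF I \<open>I \<noteq> _\<close> this koszul_nonzero_zero] show ?thesis
      using zero_regular_sequence[of "{1..n}", where ?'k='k] True by simp
  next
    case False
    then obtain G where G: "critical_gens {1..n} G s" "I = gen_ideal {1..n} G" using st by auto
    from depth_quot_eqI[OF I \<open>I \<noteq> _\<close> G(2) critical_gens_koszul_nonzero[OF G(1) _ order_refl]] show
      ?thesis
      using critical_gens_regular_sequence[OF G(1)] by simp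
  qed
qed

theorem theorem1p6:
  fixes n :: nat and I L :: "'k::field polyn set"
  assumes "n \<ge> 1"
    and "homogeneous_ideal n I"
    and "I \<noteq> carrier (PR n)"
    and "critical n I"
    and "is_lex_ideal_of n I L"
  shows "depth_quot n I = depth_quot n L"
proof -
  have hI: "homog_ideal {1..n} I" using assms(2) by (rule homogeneous_ideal_homog_ideal)
  \<comment> \<open>This witness of criticality is never identified with \<open>L\<close>:
    \<open>I\<close>, \<open>L\<close> and \<open>L'\<close> are compared only through their common
    Hilbert function.\<close>
  obtain L' where L': "is_lex_ideal_of n I L'" "universal_lexsegment n L'"
    using assms(4) unfolding critical_def by blast
  have same_dim: "homog_ideal {1..n} M" "vs.dim (graded_part M q) = vs.dim (graded_part I q)" if
    "is_lex_ideal_of n I M" for M q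
  proof -
    show hM: "homog_ideal {1..n} M"
      using that unfolding is_lex_ideal_of_def lexsegment_def
        by (blast intro: monomial_ideal_homog_ideal)
    have "is_ideal {1..n} M" "is_ideal {1..n} I" using hM hI by (simp_all add: homog_ideal_def)
    then show "vs.dim (graded_part M q) = vs.dim (graded_part I q)"
      using hilbert_fun_eq[of n M q] hilbert_fun_eq[of n I q] that unfolding is_lex_ideal_of_def
      by (metis add_left_cancel)
  qed
  obtain S where S: "S \<subseteq> monomials_in {1..n}" "L' = gen_ideal {1..n} (mpoly ` S)"
    using L'(2) monomial_ideal_gen_ideal unfolding universal_lexsegment_def lexsegment_def by blast
  \<comment> \<open>Properness passes from \<open>I\<close> to \<open>L'\<close> by comparing the
    dimensions in degree 0.\<close>
  have one: "1 \<notin> L'"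
  proof
    assume "1 \<in> L'"
    have "is_ideal {1..n} L'" using same_dim(1)[OF L'(1)] by (simp add: homog_ideal_def)
    then have "L' = polys {1..n}" using \<open>1 \<in> L'\<close> isidD[of "{1..n}" L'] by force
    then have "vs.dim (graded_part I 0) > 0"
      using same_dim(2)[OF L'(1), of 0] dim_forms[of "{1..n}" 0, where ?'k='k]
        by (simp add: graded_part_polys_UNIV)
    then obtain p where p: "p \<in> I" "homog 0 p" "p \<noteq> 0" using dim_graded_part_pos_ex by blast
    then obtain c where c: "p = const c" using homog_0_const by blast
    have "I \<noteq> polys {1..n}" using assms(3) by simp
    then have "lk p 0 = 0" using proper_const_term_0[OF hI] p by blast
    then show False using p c by (simp add: const_def)
  qed
  \<comment> \<open>The further variable \<open>z\<close> is the one with index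
    \<open>n + 1\<close>, which is the extension with \<open>m = 1\<close>.\<close>
  have ins: "insert (Suc n) {1..n} = {1..n + 1}" by auto
  have L'V: "L' \<subseteq> polys {1..n + 1}"
    using same_dim(1)[OF L'(1)] polys_mono[of "{1..n}" "{1..n + 1}"]
      by (auto simp: homog_ideal_def is_ideal_def)
  have lex: "mpoly v \<in> gen_ideal (insert (Suc n) {1..n}) L'"
    if "u \<in> monomials_in (insert (Suc n) {1..n})" "v \<in> monomials_in (insert (Suc n) {1..n})"
      "mpoly u \<in> gen_ideal (insert (Suc n) {1..n}) L'" "mdeg v = mdeg u" "v > u" for u v
  proof -
    have "lexsegment (n + 1) (Idl\<^bsub>PR (n + 1)\<^esub> L')"
      using L'(2) unfolding universal_lexsegment_def by blast
    then show ?thesis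
      using that unfolding lexsegment_def ins Idl_PR_eq[OF L'V] monoms_eq by blast
  qed
  have "\<exists>s. lex_hilbert (card {1..n}) (\<lambda>q. vs.dim (graded_part L' q)) s"
  proof (rule universal_lex_lex_hilbert[OF _ _ S one])
    show "v < Suc n" if "v \<in> {1..n}" for v using that by simp
  qed (simp, rule lex)
  then obtain s where "lex_hilbert (card {1..n}) (\<lambda>q. vs.dim (graded_part L' q)) s" ..
  then have lex_hilbert: "lex_hilbert n (\<lambda>q. vs.dim (graded_part I q)) s"
    using same_dim(2)[OF L'(1)] by simp
  have "depth_quot n I = enat (n - s)" by (rule depth_quot_of_lex_hilbert[OF lex_hilbert hI refl])
  moreover have "depth_quot n L = enat (n - s)"
    by (rule depth_quot_of_lex_hilbert[OF lex_hilbert same_dim[OF assms(5)]])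
  ultimately show ?thesis by simp
qed

end
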